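(* Let $n'(\Sigma)$ denote the minimum number of vertices of a face-simple quadrangular embedding of a simple graph in the surface $\Sigma$, and let $n(\Sigma)$ denote the minimum number of vertices of a quadrangular embedding of a simple graph in $\Sigma$. Then $n'(S_0)=8$, and $n'(S_g)=n(S_g)$ for all $g \ge 1$.
   Context: All graphs are simple. $S_g$ is the orientable surface of genus $g$ ($S_0$ is the sphere). All embeddings are cellular (every face is an open disc). A quadrangular embedding is one in which every face is bounded by a $4$-cycle. An embedding is face-simple if its dual is simple, i.e., any two face boundaries share at most one edge. *)

theory Defs
  imports "HOL-Analysis.Analysis"
begin

section \<open>Closed orientable surfaces\<close>

definition closed_surface :: "'a topology \<Rightarrow> bool" where
  "closed_surface X \<longleftrightarrow>
     topspace X \<noteq> {} \<and> compact_space X \<and> connected_space X \<and> Hausdorff_space X \<and>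
     (\<forall>p\<in>topspace X. \<exists>U. openin X U \<and> p \<in> U \<and>
        subtopology X U homeomorphic_space top_of_set (ball (0::complex) 1))"

text \<open>The closed unit square with \<open>(0, t)\<close> glued to \<open>(1, 1 - t)\<close>.\<close>

definition moebius_band :: "'a topology \<Rightarrow> bool" where
  "moebius_band M \<longleftrightarrow>
     (\<exists>q. quotient_map (top_of_set ({0..1::real} \<times> {0..1::real})) M q \<and>
        (\<forall>x\<in>{0..1} \<times> {0..1}. \<forall>y\<in>{0..1} \<times> {0..1}. q x = q y \<longleftrightarrow>
           x = y \<or> (\<exists>t. (x = (0, t) \<and> y = (1, 1 - t)) \<or> (y = (0, t) \<and> x = (1, 1 - t)))))"

definition orientable :: "'a topology \<Rightarrow> bool" where
  "orientable X \<longleftrightarrow> \<not> (\<exists>S \<subseteq> topspace X. moebius_band (subtopology X S))"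

definition simple_closed_curve_in :: "'a topology \<Rightarrow> 'a set \<Rightarrow> bool" where
  "simple_closed_curve_in X c \<longleftrightarrow>
     c \<subseteq> topspace X \<and> subtopology X c homeomorphic_space top_of_set (sphere (0::complex) 1)"

definition nonseparating_curves :: "'a topology \<Rightarrow> 'a set set \<Rightarrow> bool" where
  "nonseparating_curves X \<C> \<longleftrightarrow>
     finite \<C> \<and> (\<forall>c\<in>\<C>. simple_closed_curve_in X c) \<and> pairwise disjnt \<C> \<and>
     connectedin X (topspace X - \<Union>\<C>)"

text \<open>The genus is the largest number of disjoint simple closed curves along which the surface can
  be cut without being disconnected.\<close>

definition has_genus :: "'a topology \<Rightarrow> nat \<Rightarrow> bool" where
  "has_genus X g \<longleftrightarrow>
     (\<exists>\<C>. nonseparating_curves X \<C> \<and> card \<C> = g) \<and>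
     (\<forall>\<C>. nonseparating_curves X \<C> \<longrightarrow> card \<C> \<le> g)"

text \<open>\<open>X\<close> is (a copy of) the orientable surface of genus \<open>g\<close>. By the classification of surfaces this
  determines \<open>X\<close> up to homeomorphism.\<close>

definition orientable_surface :: "nat \<Rightarrow> 'a topology \<Rightarrow> bool" where
  "orientable_surface g X \<longleftrightarrow> closed_surface X \<and> orientable X \<and> has_genus X g"


section \<open>Embedded graphs\<close>

definition simple_graph :: "'a set \<Rightarrow> 'a set set \<Rightarrow> bool" where
  "simple_graph V E \<longleftrightarrow> finite V \<and> (\<forall>e\<in>E. e \<subseteq> V \<and> card e = 2)"

definition arc_joining :: "'a topology \<Rightarrow> 'a \<Rightarrow> 'a \<Rightarrow> 'a set \<Rightarrow> bool" where
  "arc_joining X u v A \<longleftrightarrow>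
     (\<exists>p. pathin X p \<and> inj_on p {0..1} \<and> p 0 = u \<and> p 1 = v \<and> p ` {0..1} = A)"

text \<open>The vertices of an embedded graph are taken to be points of the surface; the edge \<open>{u, v}\<close> is
  drawn as the arc \<open>\<gamma> {u, v}\<close>.\<close>

definition embedding :: "'a topology \<Rightarrow> 'a set \<Rightarrow> 'a set set \<Rightarrow> ('a set \<Rightarrow> 'a set) \<Rightarrow> bool" where
  "embedding X V E \<gamma> \<longleftrightarrow>
     V \<subseteq> topspace X \<and>
     (\<forall>u v. {u, v} \<in> E \<longrightarrow> arc_joining X u v (\<gamma> {u, v})) \<and>
     (\<forall>e\<in>E. \<gamma> e \<inter> V = e) \<and>
     (\<forall>e\<in>E. \<forall>e'\<in>E. e \<noteq> e' \<longrightarrow> \<gamma> e \<inter> \<gamma> e' = e \<inter> e')"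

definition faces :: "'a topology \<Rightarrow> 'a set \<Rightarrow> 'a set set \<Rightarrow> ('a set \<Rightarrow> 'a set) \<Rightarrow> 'a set set" where
  "faces X V E \<gamma> = connected_components_of (subtopology X (topspace X - (V \<union> \<Union>(\<gamma> ` E))))"

definition cellular_embedding ::
  "'a topology \<Rightarrow> 'a set \<Rightarrow> 'a set set \<Rightarrow> ('a set \<Rightarrow> 'a set) \<Rightarrow> bool" where
  "cellular_embedding X V E \<gamma> \<longleftrightarrow>
     embedding X V E \<gamma> \<and>
     (\<forall>F\<in>faces X V E \<gamma>. subtopology X F homeomorphic_space top_of_set (ball (0::complex) 1))"

text \<open>The open disc \<open>F\<close> is bounded by the closed curve \<open>C\<close>: the boundary of the disc runs exactly
  once around \<open>C\<close>. The condition \<open>X frontier_of F = C\<close> would not say this, since the boundary walk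
  could still run around \<open>C\<close> several times (a cycle in the projective plane whose complement is a
  disc is traversed twice).\<close>

definition bounded_by :: "'a topology \<Rightarrow> 'a set \<Rightarrow> 'a set \<Rightarrow> bool" where
  "bounded_by X F C \<longleftrightarrow>
     (\<exists>h. homeomorphic_map (top_of_set (cball (0::complex) 1)) (subtopology X (X closure_of F)) h \<and>
        h ` ball 0 1 = F \<and> h ` sphere 0 1 = C)"

definition quadrangular_embedding ::
  "'a topology \<Rightarrow> 'a set \<Rightarrow> 'a set set \<Rightarrow> ('a set \<Rightarrow> 'a set) \<Rightarrow> bool" where
  "quadrangular_embedding X V E \<gamma> \<longleftrightarrow>
     cellular_embedding X V E \<gamma> \<and>
     (\<forall>F\<in>faces X V E \<gamma>. \<exists>a b c d. distinct [a, b, c, d] \<and>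
        {a, b} \<in> E \<and> {b, c} \<in> E \<and> {c, d} \<in> E \<and> {d, a} \<in> E \<and>
        bounded_by X F (\<gamma> {a, b} \<union> \<gamma> {b, c} \<union> \<gamma> {c, d} \<union> \<gamma> {d, a}))"

text \<open>No parallel edges in the dual. Loops of the dual, i.e. edges with the same face on both sides,
  do not occur when all faces are bounded by cycles.\<close>

definition face_simple ::
  "'a topology \<Rightarrow> 'a set \<Rightarrow> 'a set set \<Rightarrow> ('a set \<Rightarrow> 'a set) \<Rightarrow> bool" where
  "face_simple X V E \<gamma> \<longleftrightarrow>
     (\<forall>F\<in>faces X V E \<gamma>. \<forall>F'\<in>faces X V E \<gamma>. F \<noteq> F' \<longrightarrow>
        card {e\<in>E. \<gamma> e \<subseteq> X frontier_of F \<and> \<gamma> e \<subseteq> X frontier_of F'} \<le> 1)"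

text \<open>The minima are taken in \<^typ>\<open>enat\<close>, so that a surface without any such embedding would get
  the value \<open>\<infinity>\<close> rather than a number.\<close>

definition min_quad :: "'a topology \<Rightarrow> enat" where
  "min_quad X = Inf {enat (card V) | V. \<exists>E \<gamma>. simple_graph V E \<and> quadrangular_embedding X V E \<gamma>}"

definition min_face_simple_quad :: "'a topology \<Rightarrow> enat" where
  "min_face_simple_quad X =
     Inf {enat (card V) | V. \<exists>E \<gamma>. simple_graph V E \<and> quadrangular_embedding X V E \<gamma> \<and>
                                   face_simple X V E \<gamma>}"

end

theory Submission
  imports Defs
begin

text \<open>On an orientable surface of genus at least \<open>1\<close> a quadrangulation with the minimum number of
  vertices is automatically face-simple, so no constructions are needed there. Suppose that two
  faces share two edges. If the edges are adjacent, say \<open>ab\<close> and \<open>bc\<close>, then the faces are \<open>abcd\<close> and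
  \<open>abcd'\<close>, and by invariance of domain their union is a neighbourhood of \<open>b\<close>. For \<open>d = d'\<close> the
  surface is a sphere, where every closed curve separates. For \<open>d \<noteq> d'\<close> the vertex \<open>b\<close> has degree two,
  and deleting it merges the two faces into a quadrilateral, against minimality. If only the
  opposite edges \<open>ab\<close> and \<open>cd\<close> are shared, the faces are \<open>abcd\<close> and \<open>abdc\<close>, and their closures form a
  Moebius band.

  On the sphere the Jordan curve theorem yields \<open>|V| - |E| + |F| \<ge> 2\<close>. Each edge is on the boundary
  of exactly two faces, and a face-simple quadrangulation has minimum degree three, so
  \<open>3|V| \<le> 2|E| \<le> 4|V| - 8\<close>. The radially projected cube attains the resulting bound \<open>|V| \<ge> 8\<close>.\<close>

section \<open>Charts and closed discs\<close>

text \<open>The obstacle is parametrization: \<open>bounded_by\<close> offers some homeomorphism of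
  the closed disc, and those of two neighbouring faces need not agree on their common arc. Coning a
  circle homeomorphism to the centre corrects the boundary values, so every face can be parametrized
  by a lens or a square with prescribed sides. The sphere, the merged quadrilateral and the Moebius
  band are then images of explicit maps, and compactness against Hausdorffness makes these maps
  embeddings or quotient maps.

  For the count on the sphere the edges are drawn one at a time: an arc either joins two pieces of
  the drawing or closes a Jordan curve and thereby splits a face. The two halves of "exactly two
  faces at an edge" have different roles. At most two bounds |F| by |E|/2. At least two yields the
  third edge at a vertex v: the two faces at an edge vb have one further edge at v each, and
  face-simplicity keeps these apart.\<close>

lemma closed_surface_Hausdorff: "closed_surface X \<Longrightarrow> Hausdorff_space X"
  by (simp add: closed_surface_def)

lemma closed_surface_chart:
  assumes "closed_surface X" "p \<in> topspace X"
  obtains N \<phi> \<psi> where "openin X N" "p \<in> N"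
    "homeomorphic_maps (subtopology X N) (top_of_set (ball (0::complex) 1)) \<phi> \<psi>"
  using assms unfolding closed_surface_def homeomorphic_space_def by meson

text \<open>Invariance of domain in the plane, transported through a chart around each image point.
  The domain is any two-dimensional Euclidean type, because round discs live in
  \<open>complex\<close> while lenses and squares live in \<open>real \<times> real\<close>.\<close>

lemma surface_invariance_of_domain_into:
  fixes f :: "'b::euclidean_space \<Rightarrow> 'a"
  assumes X: "closed_surface X" and dim: "DIM('b) = 2" and U: "open U"
    and f: "continuous_map (top_of_set U) X f" and inj: "inj_on f U"
  shows "openin X (f ` U)"
proof (subst openin_subopen, intro ballI)
  fix p assume "p \<in> f ` U"
  have fU: "f ` U \<subseteq> topspace X"
    using f by (auto simp: continuous_map_def)
  then obtain N \<phi> \<psi> where N: "openin X N" "p \<in> N"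
    and h: "homeomorphic_maps (subtopology X N) (top_of_set (ball (0::complex) 1)) \<phi> \<psi>"
    using closed_surface_chart[OF X] \<open>p \<in> f ` U\<close> by blast
  have NX: "N \<subseteq> topspace X" using N openin_subset by blast
  define U' where "U' = {x\<in>U. f x \<in> N}"
  have "openin (top_of_set U) U'"
    using openin_continuous_map_preimage[OF f N(1)] by (simp add: U'_def)
  then have U': "open U'" using U openin_open_eq by blast
  have cm: "continuous_map (top_of_set U') (subtopology X N) f"
    using continuous_map_from_subtopology_mono[OF f, of U']
    by (auto simp: continuous_map_in_subtopology U'_def)
  have c\<phi>: "continuous_map (subtopology X N) (top_of_set (ball (0::complex) 1)) \<phi>"
    and c\<psi>: "continuous_map (top_of_set (ball (0::complex) 1)) (subtopology X N) \<psi>"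
    and inv: "\<And>x. x \<in> N \<Longrightarrow> \<psi> (\<phi> x) = x" "\<And>z. z \<in> ball 0 1 \<Longrightarrow> \<phi> (\<psi> z) = z"
    using h NX unfolding homeomorphic_maps_def by auto
  have "continuous_map (top_of_set U') (top_of_set (ball 0 1)) (\<phi> \<circ> f)"
    using continuous_map_compose[OF cm c\<phi>] .
  then have cont: "continuous_on U' (\<phi> \<circ> f)" and im: "(\<phi> \<circ> f) ` U' \<subseteq> ball 0 1"
    by (auto simp: continuous_map_in_subtopology)
  have "inj_on (\<phi> \<circ> f) U'"
    using inj inv(1) unfolding inj_on_def U'_def by (metis (mono_tags, lifting) comp_apply mem_Collect_eq)
  then have op: "open ((\<phi> \<circ> f) ` U')"
    using invariance_of_domain_gen[OF U' cont] dim by simp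
  \<comment> \<open>Since \<open>\<psi>\<close> inverts \<open>\<phi>\<close> on \<open>N\<close>,
    this image is the whole \<open>\<phi>\<close>-preimage of an open planar set, so continuity of
    \<open>\<phi>\<close> suffices.\<close>
  have eq: "f ` U' = {x \<in> topspace (subtopology X N). \<phi> x \<in> (\<phi> \<circ> f) ` U'}"
    using inv(1) NX unfolding U'_def by (auto simp: image_iff) metis+
  have "openin (subtopology X N) (f ` U')"
    unfolding eq by (rule openin_continuous_map_preimage[OF c\<phi>]) (use op im in \<open>auto simp: openin_open_eq\<close>)
  then have "openin X (f ` U')" using N(1) openin_trans_full by blast
  then show "\<exists>T. openin X T \<and> p \<in> T \<and> T \<subseteq> f ` U"
    using \<open>p \<in> f ` U\<close> N(2) unfolding U'_def by blast
qed

text \<open>The opposite direction: locally \<open>f\<close> is composed with the inverse chart,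
  which makes it a map between planar sets. It limits how large an open part of the surface can be
  once it is mapped injectively into a given planar set.\<close>

lemma surface_invariance_of_domain_from:
  fixes f :: "'a \<Rightarrow> complex"
  assumes X: "closed_surface X" and U: "openin X U"
    and f: "continuous_map (subtopology X U) euclidean f" and inj: "inj_on f U"
  shows "open (f ` U)"
proof (subst open_subopen, intro ballI)
  fix y assume "y \<in> f ` U"
  then obtain p where p: "p \<in> U" "y = f p" by blast
  have UX: "U \<subseteq> topspace X" using U openin_subset by blast
  obtain N \<phi> \<psi> where N: "openin X N" "p \<in> N"
    and h: "homeomorphic_maps (subtopology X N) (top_of_set (ball (0::complex) 1)) \<phi> \<psi>"
    using closed_surface_chart[OF X] p UX by blast
  have NX: "N \<subseteq> topspace X" using N openin_subset by blast
  have c\<phi>: "continuous_map (subtopology X N) (top_of_set (ball (0::complex) 1)) \<phi>"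
    and c\<psi>: "continuous_map (top_of_set (ball (0::complex) 1)) (subtopology X N) \<psi>"
    and inv: "\<And>x. x \<in> N \<Longrightarrow> \<psi> (\<phi> x) = x" "\<And>z. z \<in> ball 0 1 \<Longrightarrow> \<phi> (\<psi> z) = z"
    and \<phi>N: "\<And>x. x \<in> N \<Longrightarrow> \<phi> x \<in> ball 0 1" and \<psi>N: "\<And>z. z \<in> ball 0 1 \<Longrightarrow> \<psi> z \<in> N"
    using h NX unfolding homeomorphic_maps_def continuous_map_def by auto
  define B where "B = {z \<in> ball 0 1. \<psi> z \<in> U}"
  have "openin (subtopology X N) (N \<inter> U)"
    using U by (auto simp: openin_subtopology)
  from openin_continuous_map_preimage[OF c\<psi> this]
  have "openin (top_of_set (ball 0 1)) B"
    by (rule back_subst[where P="openin _"]) (use \<psi>N in \<open>auto simp: B_def\<close>)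
  then have B: "open B" by (meson open_ball openin_open_eq)
  have "continuous_map (top_of_set B) (subtopology X U) \<psi>"
  proof (rule continuous_map_into_subtopology)
    show "continuous_map (top_of_set B) X \<psi>"
      by (rule continuous_map_from_subtopology_mono[OF continuous_map_into_fulltopology[OF c\<psi>]])
        (auto simp: B_def)
  qed (auto simp: B_def)
  from continuous_map_compose[OF this f] have "continuous_on B (f \<circ> \<psi>)" by simp
  moreover have "inj_on (f \<circ> \<psi>) B"
    using inj inv(2) unfolding inj_on_def B_def by (metis (mono_tags, lifting) comp_apply mem_Collect_eq)
  ultimately have "open ((f \<circ> \<psi>) ` B)"
    by (intro invariance_of_domain_gen[OF B]) simp_all
  moreover have "y \<in> (f \<circ> \<psi>) ` B"
    using p N(2) inv(1)[OF N(2)] \<phi>N[OF N(2)] by (intro image_eqI[of _ _ "\<phi> p"]) (auto simp: B_def)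
  moreover have "(f \<circ> \<psi>) ` B \<subseteq> f ` U" by (auto simp: B_def)
  ultimately show "\<exists>T. open T \<and> y \<in> T \<and> T \<subseteq> f ` U" by blast
qed

text \<open>The homeomorphism would map \<open>U\<close> onto an open subset of the plane inside
  \<open>T\<close>. Circles, arcs and single points are the thin sets to which this is
  applied.\<close>

lemma surface_open_not_in_thin:
  assumes X: "closed_surface X" and U: "openin X U" "U \<subseteq> S"
    and h: "subtopology X S homeomorphic_space top_of_set (T::complex set)" and T: "interior T = {}"
  shows "U = {}"
proof -
  obtain \<phi> \<psi> where h: "homeomorphic_maps (subtopology X S) (top_of_set T) \<phi> \<psi>"
    using h homeomorphic_space_def by blast
  have UX: "U \<subseteq> topspace X" using U openin_subset by blast
  have c: "continuous_map (subtopology X S) (top_of_set T) \<phi>"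
    and inv: "\<And>x. x \<in> topspace X \<inter> S \<Longrightarrow> \<psi> (\<phi> x) = x"
    using h unfolding homeomorphic_maps_def by auto
  have im: "\<phi> ` U \<subseteq> T" using c UX U(2) by (auto simp: continuous_map_def)
  have "continuous_map (subtopology X U) euclidean \<phi>"
    using continuous_map_from_subtopology_mono[OF continuous_map_into_fulltopology[OF c] U(2)] .
  moreover have "inj_on \<phi> U"
    using inv UX U(2) by (metis Int_iff inj_onI subset_iff)
  ultimately have "open (\<phi> ` U)"
    using surface_invariance_of_domain_from[OF X U(1)] by blast
  then have "\<phi> ` U \<subseteq> interior T" using im interior_maximal by blast
  then show ?thesis using T by auto
qed

text \<open>Invariance of domain for the homeomorphism and for its inverse sends interior to
  interior, which leaves frontier for frontier.\<close>

lemma convex_compact_homeomorphism_cball: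
  fixes Q :: "'b::euclidean_space set"
  assumes dim: "DIM('b) = 2" and Q: "convex Q" "compact Q" "interior Q \<noteq> {}"
  obtains f g where "homeomorphism Q (cball (0::complex) 1) f g"
    "f ` interior Q = ball 0 1" "f ` frontier Q = sphere 0 1"
proof -
  have "Q homeomorphic cball (0::complex) 1"
    using homeomorphic_convex_compact_sets[of Q "cball (0::complex) 1"] Q dim
    by (simp add: aff_dim_nonempty_interior aff_dim_cball)
  then obtain f g where fg: "homeomorphism Q (cball (0::complex) 1) f g"
    unfolding homeomorphic_def by blast
  have cf: "continuous_on Q f" "f ` Q = cball 0 1" "continuous_on (cball 0 1) g" "g ` cball 0 1 = Q"
    and inv: "\<And>x. x \<in> Q \<Longrightarrow> g (f x) = x" "\<And>x. x \<in> cball 0 1 \<Longrightarrow> f (g x) = x"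
    using fg unfolding homeomorphism_def by auto
  have inj: "inj_on f Q" "inj_on g (cball 0 1)" using inv by (metis inj_on_inverseI)+
  have 1: "f ` interior Q \<subseteq> ball 0 1"
    using continuous_image_subset_interior[OF cf(1) inj(1)] dim cf(2) by (simp add: image_subset_iff_funcset)
  have 2: "g ` ball 0 1 \<subseteq> interior Q"
    using continuous_image_subset_interior[OF cf(3) inj(2)] dim cf(4) by (simp add: image_subset_iff_funcset)
  have e1: "f ` interior Q = ball 0 1"
  proof
    show "ball 0 1 \<subseteq> f ` interior Q"
    proof
      fix z :: complex assume z: "z \<in> ball 0 1"
      then have "z = f (g z)" using inv(2) by (simp add: less_imp_le)
      then show "z \<in> f ` interior Q" using 2 z by blast
    qed
  qed (rule 1)
  have "frontier Q = Q - interior Q" using Q(2) compact_imp_closed frontier_def closure_closed by metis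
  then have "f ` frontier Q = f ` Q - f ` interior Q"
    using inj_on_image_set_diff[OF inj(1), of Q "interior Q"] interior_subset by (metis Diff_subset)
  also have "\<dots> = sphere 0 1" using e1 cf(2) by (auto simp: dist_norm)
  finally show ?thesis using that[OF fg e1] by blast
qed

text \<open>Alexander's trick: \<open>\<theta>\<close> is coned to the origin, each circle around
  the origin being mapped to itself by a scaled copy of \<open>\<theta>\<close>.\<close>

lemma circle_self_homeo_extends:
  fixes \<theta> :: "complex \<Rightarrow> complex"
  assumes c: "continuous_on (sphere 0 1) \<theta>" and inj: "inj_on \<theta> (sphere 0 1)" and im: "\<theta> ` sphere 0 1 = sphere 0 1"
  obtains \<kappa> where "continuous_on (cball 0 1) \<kappa>" "inj_on \<kappa> (cball 0 1)" "\<kappa> ` ball 0 1 = ball 0 1"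
    "\<And>z. z \<in> sphere 0 1 \<Longrightarrow> \<kappa> z = \<theta> z"
proof -
  \<comment> \<open>At the origin the quotient is \<open>0\<close> and the value of
    \<open>\<theta>\<close> there is arbitrary, but the factor \<open>norm z\<close> makes the
    product \<open>0\<close>.\<close>
  define \<kappa> where "\<kappa> z = complex_of_real (norm z) * \<theta> (z / complex_of_real (norm z))" for z
  have nt: "norm (\<theta> z) = 1" if "norm z = 1" for z
    using im that by (metis dist_0_norm image_eqI mem_sphere)
  have ns: "norm (z / complex_of_real (norm z)) = 1" if "z \<noteq> 0" for z
    using that by (simp add: norm_divide)
  have n: "norm (\<kappa> z) = norm z" for z
    using nt[OF ns] by (cases "z = 0") (auto simp: \<kappa>_def norm_mult)
  have cont: "continuous (at z) \<kappa>" for z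
  proof (cases "z = 0")
    case True
    \<comment> \<open>Continuity of \<open>\<theta>\<close> on the circle says nothing at the
      origin; preservation of the norm does.\<close>
    have "\<kappa> \<midarrow>0\<rightarrow> 0"
      by (rule tendsto_norm_zero_cancel) (simp add: n tendsto_norm_zero)
    then show ?thesis using True by (simp add: isCont_def \<kappa>_def)
  next
    case False
    have "continuous_on (-{0}) (\<lambda>z. \<theta> (z / complex_of_real (norm z)))"
      by (rule continuous_on_compose2[OF c]) (auto intro!: continuous_intros simp: norm_divide split: if_splits)
    then have "continuous_on (-{0}) \<kappa>"
      unfolding \<kappa>_def by (intro continuous_intros)
    then show ?thesis using False by (simp add: continuous_on_eq_continuous_at open_Compl)
  qed
  have inj': "inj_on \<kappa> UNIV"
  proof (rule inj_onI)
    fix x y assume e: "\<kappa> x = \<kappa> y"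
    then have nn: "norm x = norm y" using n by metis
    show "x = y"
    proof (cases "x = 0")
      case True then show ?thesis using nn by simp
    next
      case False
      then have y: "y \<noteq> 0" using nn by auto
      have "\<theta> (x / of_real (norm x)) = \<theta> (y / of_real (norm y))"
        using e nn False y by (simp add: \<kappa>_def)
      then have "x / of_real (norm x) = y / of_real (norm y)"
        using inj ns[OF False] ns[OF y] by (auto simp: inj_on_def)
      then show ?thesis using nn False y by simp
    qed
  qed
  have sub: "ball 0 1 \<subseteq> \<kappa> ` ball 0 1"
  proof
    fix w :: complex assume w: "w \<in> ball 0 1"
    show "w \<in> \<kappa> ` ball 0 1"
    proof (cases "w = 0")
      case True then show ?thesis by (auto simp: image_iff \<kappa>_def intro!: bexI[of _ 0])
    next
      case False
      then obtain u where u: "norm u = 1" "\<theta> u = w / of_real (norm w)"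
        using im ns[OF False] by (metis (no_types, lifting) dist_0_norm image_iff mem_sphere)
      have "\<kappa> (of_real (norm w) * u) = w"
        using u False by (simp add: \<kappa>_def norm_mult)
      then show ?thesis using w u by (intro image_eqI[of _ _ "of_real (norm w) * u"]) (auto simp: norm_mult)
    qed
  qed
  show ?thesis
  proof (rule that[of \<kappa>])
    show "continuous_on (cball 0 1) \<kappa>" using cont by (simp add: continuous_at_imp_continuous_on)
    show "inj_on \<kappa> (cball 0 1)" using inj' inj_on_subset by blast
    show "\<kappa> ` ball 0 1 = ball 0 1" using sub n by auto
  qed (auto simp: \<kappa>_def)
qed

section \<open>Closed discs in a surface\<close>

lemma bounded_by_basics:
  assumes "bounded_by X F C"
  shows "X closure_of F = F \<union> C" "F \<inter> C = {}" "F \<subseteq> topspace X" "C \<subseteq> topspace X"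
    "F \<noteq> {}" "C \<noteq> {}" "compactin X (F \<union> C)" "connectedin X F"
    "subtopology X F homeomorphic_space top_of_set (ball (0::complex) 1)"
proof -
  obtain h where h: "homeomorphic_map (top_of_set (cball (0::complex) 1)) (subtopology X (X closure_of F)) h"
    and F: "h ` ball 0 1 = F" and C: "h ` sphere 0 1 = C"
    using assms unfolding bounded_by_def by blast
  have im: "h ` cball 0 1 = X closure_of F"
    using homeomorphic_imp_surjective_map[OF h] closure_of_subset_topspace[of X F]
    by (simp add: Int_absorb1)
  have inj: "inj_on h (cball 0 1)" using homeomorphic_imp_injective_map[OF h] by simp
  have split: "cball (0::complex) 1 = ball 0 1 \<union> sphere 0 1" by force
  show cl: "X closure_of F = F \<union> C" using im F C by (simp add: split image_Un)
  have "h ` (ball 0 1 \<inter> sphere 0 1) = h ` ball 0 1 \<inter> h ` sphere 0 1"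
    by (rule inj_on_image_Int[OF inj]) auto
  then show "F \<inter> C = {}" using F C by (auto simp: dist_norm)
  show FX: "F \<subseteq> topspace X" and CX: "C \<subseteq> topspace X"
    using cl closure_of_subset_topspace[of X F] by auto
  show "F \<noteq> {}" "C \<noteq> {}" using F C by auto
  have ch: "continuous_map (top_of_set (cball 0 1)) X h"
    using homeomorphic_imp_continuous_map[OF h] continuous_map_into_fulltopology by blast
  have "compactin (top_of_set (cball (0::complex) 1)) (cball 0 1)"
    by (simp add: compactin_subtopology)
  from image_compactin[OF this ch] show "compactin X (F \<union> C)" using im cl by simp
  have "connectedin (top_of_set (cball (0::complex) 1)) (ball 0 1)"
    by (auto simp: connectedin_subtopology ball_subset_cball)
  from connectedin_continuous_map_image[OF ch this] show "connectedin X F" using F by simp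
  have "homeomorphic_map (subtopology (top_of_set (cball 0 1)) (ball 0 1))
          (subtopology (subtopology X (X closure_of F)) F) h"
    by (rule homeomorphic_map_subtopologies[OF h])
       (use F cl FX in \<open>auto simp: ball_subset_cball Int_absorb1\<close>)
  then have "homeomorphic_map (top_of_set (ball 0 1)) (subtopology X F) h"
    using cl by (simp add: subtopology_subtopology Int_absorb1 ball_subset_cball)
  then show "subtopology X F homeomorphic_space top_of_set (ball (0::complex) 1)"
    using homeomorphic_map_imp_homeomorphic_space homeomorphic_space_sym by blast
qed

text \<open>The definition of \<open>bounded_by\<close> does not mention openness of
  \<open>F\<close>. In a surface it comes from invariance of domain, and then the frontier is what
  the closure adds.\<close>

lemma bounded_by_surface:
  assumes X: "closed_surface X" and b: "bounded_by X F C"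
  shows "openin X F" "X frontier_of F = C" "closedin X (F \<union> C)"
proof -
  obtain h where h: "homeomorphic_map (top_of_set (cball (0::complex) 1)) (subtopology X (X closure_of F)) h"
    and F: "h ` ball 0 1 = F"
    using b unfolding bounded_by_def by blast
  have "continuous_map (top_of_set (cball 0 1)) X h"
    using homeomorphic_imp_continuous_map[OF h] continuous_map_into_fulltopology by blast
  then have "continuous_map (top_of_set (ball 0 1)) X h"
    using continuous_map_from_subtopology_mono ball_subset_cball by blast
  moreover have "inj_on h (ball 0 1)"
    using homeomorphic_imp_injective_map[OF h] by (auto intro: inj_on_subset[OF _ ball_subset_cball])
  ultimately show op: "openin X F"
    using surface_invariance_of_domain_into[OF X, of "ball (0::complex) 1" h] F by simp
  show "X frontier_of F = C"
    using bounded_by_basics[OF b] op by (auto simp: frontier_of_def interior_of_openin)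
  show "closedin X (F \<union> C)"
    using bounded_by_basics(1)[OF b] by (metis closedin_closure_of)
qed

text \<open>An injective continuous image of a compact body in a Hausdorff space is embedded, so any
  planar convex body with interior may replace the round disc. The lens of the gluing and the square
  facets of the cube enter here.\<close>

lemma bounded_by_image:
  fixes f :: "'b::euclidean_space \<Rightarrow> 'a"
  assumes X: "Hausdorff_space X" and dim: "DIM('b) = 2"
    and Q: "convex Q" "compact Q" "interior Q \<noteq> {}"
    and f: "continuous_map (top_of_set Q) X f" and inj: "inj_on f Q"
  shows "bounded_by X (f ` interior Q) (f ` frontier Q)"
proof -
  obtain k g where kg: "homeomorphism Q (cball (0::complex) 1) k g"
    and k: "k ` interior Q = ball 0 1" "k ` frontier Q = sphere 0 1"
    using convex_compact_homeomorphism_cball[OF dim Q] by blast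
  have cQ: "closed Q" using Q compact_imp_closed by blast
  have g: "continuous_on (cball 0 1) g" "g ` cball 0 1 = Q" and inv: "\<And>x. x \<in> Q \<Longrightarrow> g (k x) = x"
    and inv2: "\<And>x. x \<in> cball 0 1 \<Longrightarrow> k (g x) = x"
    using kg unfolding homeomorphism_def by auto
  have frQ: "frontier Q \<subseteq> Q" using cQ frontier_subset_eq by blast
  have "g ` k ` interior Q = interior Q" "g ` k ` frontier Q = frontier Q"
    using inv interior_subset[of Q] frQ by (force simp: image_iff)+
  then have gi: "g ` ball 0 1 = interior Q" "g ` sphere 0 1 = frontier Q" using k by auto
  have fX: "f ` Q \<subseteq> topspace X" using f by (auto simp: continuous_map_def)
  have "compactin X (f ` Q)"
    by (rule image_compactin[OF _ f]) (use Q in \<open>simp add: compactin_subtopology\<close>)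
  then have clQ: "closedin X (f ` Q)" using X compactin_imp_closedin by blast
  \<comment> \<open>A closed convex set with interior is the closure of that interior, and
    continuity carries this into \<open>X\<close>; closedness of the image gives the
    converse.\<close>
  have cl: "X closure_of (f ` interior Q) = f ` Q"
  proof
    show "X closure_of f ` interior Q \<subseteq> f ` Q"
      by (rule closure_of_minimal[OF _ clQ]) (simp add: image_mono interior_subset)
    have "top_of_set Q closure_of interior Q = Q"
      using convex_closure_interior[OF Q(1,3)] cQ
      by (simp add: closure_of_subtopology Int_absorb1 interior_subset)
    then show "f ` Q \<subseteq> X closure_of f ` interior Q"
      using continuous_map_image_closure_subset[OF f, of "interior Q"] by simp
  qed
  have "homeomorphic_map (top_of_set (cball 0 1)) (subtopology X (f ` Q)) (f \<circ> g)"
  proof (rule continuous_imp_homeomorphic_map)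
    have "continuous_map (top_of_set (cball 0 1)) (top_of_set Q) g"
      using g by (simp add: continuous_map_in_subtopology image_subset_iff_funcset[symmetric])
    moreover have "continuous_map (top_of_set Q) (subtopology X (f ` Q)) f"
      using f by (simp add: continuous_map_in_subtopology)
    ultimately show "continuous_map (top_of_set (cball 0 1)) (subtopology X (f ` Q)) (f \<circ> g)"
      using continuous_map_compose by blast
    show "compact_space (top_of_set (cball (0::complex) 1))" by (simp add: compact_space_subtopology)
    show "Hausdorff_space (subtopology X (f ` Q))" using X Hausdorff_space_subtopology by blast
    show "(f \<circ> g) ` topspace (top_of_set (cball 0 1)) = topspace (subtopology X (f ` Q))"
      unfolding topspace_euclidean_subtopology topspace_subtopology_subset[OF fX] by (metis image_comp g(2))
    show "inj_on (f \<circ> g) (topspace (top_of_set (cball 0 1)))"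
    proof (rule comp_inj_on)
      show "inj_on g (topspace (top_of_set (cball 0 1)))" using inv2 by (intro inj_on_inverseI[of _ k]) auto
      show "inj_on f (g ` topspace (top_of_set (cball 0 1)))" using inj g(2) by simp
    qed
  qed
  then show ?thesis
    unfolding bounded_by_def cl using gi by (intro exI[of _ "f \<circ> g"]) (metis image_comp)
qed

text \<open>The homeomorphism hidden in \<open>bounded_by\<close> has uncontrolled boundary values.
  They differ from the prescribed \<open>\<psi>\<close> by a self-homeomorphism of the circle, and
  extending that one over the disc repairs them. Two faces can thus be parametrized so as to agree
  along common edges.\<close>

lemma bounded_by_extend_parametrization:
  fixes \<psi> :: "'b::euclidean_space \<Rightarrow> 'a"
  assumes X: "Hausdorff_space X" and b: "bounded_by X F C"
    and dim: "DIM('b) = 2" and Q: "convex Q" "compact Q" "interior Q \<noteq> {}"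
    and \<psi>: "continuous_map (top_of_set (frontier Q)) X \<psi>" "inj_on \<psi> (frontier Q)" "\<psi> ` frontier Q = C"
  obtains k where "continuous_map (top_of_set Q) X k" "inj_on k Q" "k ` interior Q = F"
    "\<And>x. x \<in> frontier Q \<Longrightarrow> k x = \<psi> x"
proof -
  obtain f g where fg: "homeomorphism Q (cball (0::complex) 1) f g"
    and fi: "f ` interior Q = ball 0 1" and ff: "f ` frontier Q = sphere 0 1"
    using convex_compact_homeomorphism_cball[OF dim Q] by blast
  have f: "continuous_on Q f" "f ` Q = cball 0 1" and g: "continuous_on (cball 0 1) g" "g ` cball 0 1 = Q"
    and fginv: "\<And>x. x \<in> Q \<Longrightarrow> g (f x) = x" "\<And>x. x \<in> cball 0 1 \<Longrightarrow> f (g x) = x"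
    using fg unfolding homeomorphism_def by auto
  have frQ: "frontier Q \<subseteq> Q" using Q(2) compact_imp_closed frontier_subset_eq by blast
  have gs: "g ` sphere 0 1 = frontier Q"
    using fginv(1) frQ unfolding ff[symmetric] by (force simp: image_iff)
  obtain h where h: "homeomorphic_map (top_of_set (cball (0::complex) 1)) (subtopology X (X closure_of F)) h"
    and F: "h ` ball 0 1 = F" and C: "h ` sphere 0 1 = C"
    using b unfolding bounded_by_def by blast
  obtain h' where hh: "homeomorphic_maps (top_of_set (cball (0::complex) 1)) (subtopology X (F \<union> C)) h h'"
    using h homeomorphic_map_maps bounded_by_basics(1)[OF b] by metis
  have h1: "continuous_map (top_of_set (cball (0::complex) 1)) (subtopology X (F \<union> C)) h"
    and h2: "continuous_map (subtopology X (F \<union> C)) (top_of_set (cball (0::complex) 1)) h'"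
    and hinv: "\<And>z. z \<in> cball 0 1 \<Longrightarrow> h' (h z) = z" "\<And>x. x \<in> F \<union> C \<Longrightarrow> h (h' x) = x"
    using hh bounded_by_basics(3,4)[OF b] unfolding homeomorphic_maps_def by auto
  have h'C: "h' ` C = sphere 0 1"
  proof -
    have "(\<lambda>x. h' (h x)) ` sphere 0 1 = (\<lambda>x. x) ` sphere 0 1"
      by (rule image_cong) (auto simp: hinv)
    then show ?thesis unfolding C[symmetric] image_image by simp
  qed
  \<comment> \<open>The transition map on the circle: \<open>g\<close> leads to the frontier of
    \<open>Q\<close>, \<open>\<psi>\<close> to \<open>C\<close>, and \<open>h'\<close> back to the
    circle.\<close>
  define \<theta> where "\<theta> = h' \<circ> \<psi> \<circ> g"
  have c\<theta>: "continuous_on (sphere 0 1) \<theta>"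
  proof -
    have 1: "continuous_map (top_of_set (sphere 0 1)) (top_of_set (frontier Q)) g"
      using g gs continuous_on_subset[OF g(1) sphere_cball] by (auto simp: continuous_map_in_subtopology)
    have 2: "continuous_map (top_of_set (frontier Q)) (subtopology X (F \<union> C)) \<psi>"
      using \<psi> by (auto simp: continuous_map_in_subtopology)
    show ?thesis
      using continuous_map_into_fulltopology[OF continuous_map_compose[OF continuous_map_compose[OF 1 2] h2]]
      by (simp add: \<theta>_def o_assoc)
  qed
  have inj\<theta>: "inj_on \<theta> (sphere 0 1)"
    unfolding \<theta>_def
  proof (intro comp_inj_on)
    show "inj_on g (sphere 0 1)" using fginv(2) by (intro inj_on_inverseI[of _ f]) auto
    show "inj_on \<psi> (g ` sphere 0 1)" using gs \<psi>(2) by simp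
    show "inj_on h' (\<psi> ` g ` sphere 0 1)"
      using gs \<psi>(3) hinv(2) by (intro inj_on_inverseI[of _ h]) auto
  qed
  have im\<theta>: "\<theta> ` sphere 0 1 = sphere 0 1"
    unfolding \<theta>_def image_comp[symmetric] gs \<psi>(3) h'C ..
  obtain \<kappa> where \<kappa>: "continuous_on (cball 0 1) \<kappa>" "inj_on \<kappa> (cball 0 1)" "\<kappa> ` ball 0 1 = ball 0 1"
    "\<And>z. z \<in> sphere 0 1 \<Longrightarrow> \<kappa> z = \<theta> z"
    using circle_self_homeo_extends[OF c\<theta> inj\<theta> im\<theta>] by blast
  have \<kappa>s: "\<kappa> ` sphere 0 1 = sphere 0 1" using im\<theta> \<kappa>(4) by (metis (no_types, lifting) image_cong)
  have \<kappa>c: "\<kappa> ` cball 0 1 = cball 0 1"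
    proof -
    have "cball (0::complex) 1 = ball 0 1 \<union> sphere 0 1" by force
    then show ?thesis using \<kappa>(3) \<kappa>s image_Un by metis
  qed
  define k where "k = h \<circ> \<kappa> \<circ> f"
  show ?thesis
  proof (rule that[of k])
    have 1: "continuous_map (top_of_set Q) (top_of_set (cball 0 1)) f"
      using f by (simp add: continuous_map_in_subtopology image_subset_iff_funcset[symmetric])
    have 2: "continuous_map (top_of_set (cball 0 1)) (top_of_set (cball 0 1)) \<kappa>"
      using \<kappa>(1) \<kappa>c by (simp add: continuous_map_in_subtopology image_subset_iff_funcset[symmetric])
    show "continuous_map (top_of_set Q) X k"
      using continuous_map_into_fulltopology[OF continuous_map_compose[OF continuous_map_compose[OF 1 2] h1]]
      by (simp add: k_def o_assoc)
    show "inj_on k Q"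
      unfolding k_def
    proof (intro comp_inj_on)
      show "inj_on f Q" using fginv by (intro inj_on_inverseI[of _ g])
      show "inj_on \<kappa> (f ` Q)" using f(2) \<kappa>(2) by simp
      show "inj_on h (\<kappa> ` f ` Q)"
        using f(2) \<kappa>c hinv(1) by (intro inj_on_inverseI[of _ h']) auto
    qed
    show "k ` interior Q = F"
      unfolding k_def image_comp[symmetric] fi \<kappa>(3) F ..
    show "k x = \<psi> x" if "x \<in> frontier Q" for x
    proof -
      have fx: "f x \<in> sphere 0 1" using that ff by blast
      have "\<psi> x \<in> F \<union> C" using \<psi>(3) that by blast
      then show ?thesis
        using fx \<kappa>(4)[OF fx] hinv(2) fginv(1) frQ that by (auto simp: k_def \<theta>_def subset_iff)
    qed
  qed
qed

section \<open>Gluing two discs along an arc\<close>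

lemma arc_joining_basics:
  assumes "arc_joining X u v A"
  shows "u \<in> A" "v \<in> A" "u \<noteq> v" "A \<subseteq> topspace X" "compactin X A" "connectedin X A" "infinite A"
proof -
  obtain p where p: "pathin X p" "inj_on p {0..1}" "p 0 = u" "p 1 = v" "p ` {0..1} = A"
    using assms unfolding arc_joining_def by blast
  show "u \<in> A" "v \<in> A" "u \<noteq> v"
    using p by (auto dest: inj_onD[of p "{0..1}" 0 1])
  have c: "continuous_map (top_of_set {0..1}) X p" using p(1) by (simp add: pathin_def)
  show "A \<subseteq> topspace X" using c p(5) by (auto simp: continuous_map_def)
  show "compactin X A"
    using image_compactin[OF _ c, of "{0..1}"] p(5) by (simp add: compactin_subtopology)
  show "connectedin X A"
    using connectedin_continuous_map_image[OF c, of "{0..1}"] p(5) by (simp add: connectedin_subtopology)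
  have "infinite {0..1::real}" by (simp add: infinite_Icc)
  then show "infinite A" using p(2,5) finite_imageD by blast
qed

lemma arc_joining_closedin: "Hausdorff_space X \<Longrightarrow> arc_joining X u v A \<Longrightarrow> closedin X A"
  using arc_joining_basics(5) compactin_imp_closedin by metis

lemma arc_joining_reverse:
  assumes "arc_joining X u v A"
  shows "arc_joining X v u A"
proof -
  obtain p where p: "pathin X p" "inj_on p {0..1}" "p 0 = u" "p 1 = v" "p ` {0..1} = A"
    using assms unfolding arc_joining_def by blast
  have im: "(\<lambda>t. 1 - t) ` {0..1} = {0..1::real}"
    by (auto simp: image_iff intro!: bexI[of _ "1 - _"])
  have "continuous_map (top_of_set {0..1}) (top_of_set {0..1::real}) (\<lambda>t. 1 - t)"
    by (auto simp: continuous_map_in_subtopology intro!: continuous_intros)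
  from continuous_map_compose[OF this] have "pathin X (p \<circ> (\<lambda>t. 1 - t))"
    using p(1) by (simp add: pathin_def)
  moreover have "inj_on (p \<circ> (\<lambda>t. 1 - t)) {0..1}"
    by (rule comp_inj_on) (use p(2) im in \<open>auto simp: inj_on_def\<close>)
  moreover have "(p \<circ> (\<lambda>t. 1 - t)) ` {0..1} = A"
    by (metis image_comp im p(5))
  ultimately show ?thesis
    unfolding arc_joining_def using p(3,4) by (intro exI[of _ "p \<circ> (\<lambda>t. 1 - t)"]) simp
qed

lemma arc_joining_join:
  assumes 1: "arc_joining X u v A" and 2: "arc_joining X v w B" and AB: "A \<inter> B = {v}"
  shows "arc_joining X u w (A \<union> B)"
proof -
  obtain p where p: "pathin X p" "inj_on p {0..1}" "p 0 = u" "p 1 = v" "p ` {0..1} = A"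
    using 1 unfolding arc_joining_def by blast
  obtain q where q: "pathin X q" "inj_on q {0..1}" "q 0 = v" "q 1 = w" "q ` {0..1} = B"
    using 2 unfolding arc_joining_def by blast
  define r where "r t = (if t \<le> 1/2 then p (2 * t) else q (2 * t - 1))" for t
  have "continuous_map (top_of_set {0..1}) X r"
    unfolding r_def
  proof (rule continuous_map_cases_le)
    have "continuous_map (top_of_set {0..1/2}) (top_of_set {0..1::real}) (\<lambda>t. 2 * t)"
      by (auto simp: continuous_map_in_subtopology intro!: continuous_intros)
    from continuous_map_compose[OF this] p(1)
    have "continuous_map (top_of_set {0..1/2}) X (\<lambda>t. p (2 * t))" by (simp add: pathin_def o_def)
    moreover have "{x \<in> {0..1}. x \<le> 1/2} = {0..1/2::real}" by auto
    ultimately show "continuous_map (subtopology (top_of_set {0..1}) {x \<in> topspace (top_of_set {0..1}). x \<le> 1/2}) X (\<lambda>t. p (2 * t))"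
      by (simp add: subtopology_subtopology Int_absorb1)
    have "continuous_map (top_of_set {1/2..1}) (top_of_set {0..1::real}) (\<lambda>t. 2 * t - 1)"
      by (auto simp: continuous_map_in_subtopology intro!: continuous_intros)
    from continuous_map_compose[OF this] q(1)
    have "continuous_map (top_of_set {1/2..1}) X (\<lambda>t. q (2 * t - 1))" by (simp add: pathin_def o_def)
    moreover have "{x \<in> {0..1}. 1/2 \<le> x} = {1/2..1::real}" by auto
    ultimately show "continuous_map (subtopology (top_of_set {0..1}) {x \<in> topspace (top_of_set {0..1}). 1/2 \<le> x}) X (\<lambda>t. q (2 * t - 1))"
      by (simp add: subtopology_subtopology Int_absorb1)
    show "p (2 * x) = q (2 * x - 1)" if "x = 1/2" for x using p(4) q(3) unfolding that by simp
  qed (auto intro!: continuous_intros)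
  moreover have "inj_on r {0..1}"
  proof -
    have c: "r s \<noteq> r t" if "s \<in> {0..1/2}" "t \<in> {1/2<..1}" for s t
    proof
      assume e: "r s = r t"
      have "r s \<in> A" using that p(5) by (auto simp: r_def)
      moreover have "r t \<in> B" using that q(5) by (auto simp: r_def)
      ultimately have "r t = v" using e AB by auto
      then have "q (2 * t - 1) = q 0" using that q(3) by (simp add: r_def)
      then have "2 * t - 1 = 0" using that q(2) by (auto dest: inj_onD[of q "{0..1}"])
      then show False using that by simp
    qed
    show ?thesis
    proof (rule inj_onI)
      fix s t assume st: "s \<in> {0..1}" "t \<in> {0..1}" "r s = r t"
      consider "s \<le> 1/2" "t \<le> 1/2" | "s > 1/2" "t > 1/2" | "s \<le> 1/2" "t > 1/2" | "s > 1/2" "t \<le> 1/2"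
        by linarith
      then show "s = t"
      proof cases
        case 1 then show ?thesis using st p(2) by (auto simp: r_def dest: inj_onD[of p "{0..1}"])
      next
        case 2 then show ?thesis using st q(2) by (auto simp: r_def dest: inj_onD[of q "{0..1}" "2 * s - 1" "2 * t - 1"])
      next
        case 3 then show ?thesis using st c[of s t] by auto
      next
        case 4 then show ?thesis using st c[of t s] by auto
      qed
    qed
  qed
  moreover have "r ` {0..1} = A \<union> B"
  proof
    show "r ` {0..1} \<subseteq> A \<union> B" using p(5) q(5) by (auto simp: r_def)
    show "A \<union> B \<subseteq> r ` {0..1}"
    proof
      fix x assume "x \<in> A \<union> B"
      then show "x \<in> r ` {0..1}"
      proof
        assume "x \<in> A"
        then obtain t where "t \<in> {0..1}" "x = p t" using p(5) by blast
        then show ?thesis by (intro image_eqI[of _ _ "t/2"]) (auto simp: r_def)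
      next
        assume "x \<in> B"
        then obtain t where t: "t \<in> {0..1}" "x = q t" using q(5) by blast
        show ?thesis
          by (rule image_eqI[of _ _ "(t+1)/2"]) (use t p(4) q(3) in \<open>auto simp: r_def field_simps\<close>)
      qed
    qed
  qed
  ultimately show ?thesis
    unfolding arc_joining_def pathin_def using p(3) q(4) by (intro exI[of _ r]) (simp add: r_def)
qed

text \<open>The two boundary arcs of a lens are both parametrized by the second coordinate, and the mirror
  image of the half lens completes it to the lens; this makes the gluing maps explicit.\<close>

definition half_lens :: "(real \<times> real) set" where
  "half_lens = {z. 0 \<le> fst z \<and> fst z \<le> snd z * (1 - snd z)}"

definition lens :: "(real \<times> real) set" where
  "lens = {z. \<bar>fst z\<bar> \<le> snd z * (1 - snd z)}"

text \<open>The defect is \<open>u * v * (x - y)^2\<close>. Concavity of \<open>y * (1 - y)\<close>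
  makes the region below it convex, and its zeros 0 and 1 are the heights of the two tips of the
  lens.\<close>

lemma parabola_concave:
  fixes x y u v :: real
  assumes "u \<ge> 0" "v \<ge> 0" "u + v = 1"
  shows "u * (x * (1 - x)) + v * (y * (1 - y)) \<le> (u * x + v * y) * (1 - (u * x + v * y))"
proof -
  have v: "v = 1 - u" using assms by simp
  have "(u * x + v * y) * (1 - (u * x + v * y)) - (u * (x * (1 - x)) + v * (y * (1 - y))) = u * v * (x - y)^2"
    unfolding v by (simp add: algebra_simps power2_eq_square)
  moreover have "u * v * (x - y)^2 \<ge> 0" using assms by simp
  ultimately show ?thesis by linarith
qed

lemma parabola_nonneg_iff: "0 \<le> y * (1 - y) \<longleftrightarrow> y \<in> {0..1::real}"
  by (auto simp: zero_le_mult_iff)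

lemma parabola_le_1: "y * (1 - y) \<le> (1::real)"
proof -
  have "0 \<le> (y - 1/2)^2" by simp
  then show ?thesis by (simp add: power2_eq_square algebra_simps)
qed

lemma convex_lens: "convex lens"
proof (rule convexI)
  fix a b :: "real \<times> real" and u v :: real
  assume *: "a \<in> lens" "b \<in> lens" "0 \<le> u" "0 \<le> v" "u + v = 1"
  have "\<bar>u * fst a + v * fst b\<bar> \<le> u * \<bar>fst a\<bar> + v * \<bar>fst b\<bar>"
    using *(3,4) by (intro order_trans[OF abs_triangle_ineq]) (simp add: abs_mult)
  also have "\<dots> \<le> u * (snd a * (1 - snd a)) + v * (snd b * (1 - snd b))"
    using * by (intro add_mono mult_left_mono) (auto simp: lens_def)
  also note parabola_concave[OF *(3-5)]
  finally show "u *\<^sub>R a + v *\<^sub>R b \<in> lens" by (simp add: lens_def)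
qed

lemma half_lens_eq: "half_lens = lens \<inter> {z. 0 \<le> fst z}"
  by (auto simp: half_lens_def lens_def)

lemma compact_lens: "compact lens"
proof -
  have "closed lens" unfolding lens_def by (intro closed_Collect_le continuous_intros)
  moreover have "bounded lens"
  proof (rule bounded_subset)
    show "bounded ({-1..1::real} \<times> {0..1::real})" by (intro bounded_Times bounded_closed_interval)
    show "lens \<subseteq> {-1..1} \<times> {0..1}"
    proof
      fix z :: "real \<times> real" assume "z \<in> lens"
      then have "\<bar>fst z\<bar> \<le> snd z * (1 - snd z)" by (simp add: lens_def)
      then show "z \<in> {-1..1} \<times> {0..1}"
        using parabola_nonneg_iff[of "snd z"] parabola_le_1[of "snd z"]
        by (cases z) (auto simp: abs_le_iff)
    qed
  qed
  ultimately show ?thesis by (simp add: compact_eq_bounded_closed)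
qed

lemma convex_half_lens: "convex half_lens"
proof -
  have "{z::real \<times> real. 0 \<le> fst z} = {z. (1, 0) \<bullet> z \<ge> 0}" by (auto simp: inner_prod_def)
  then show ?thesis
    unfolding half_lens_eq by (metis convex_Int convex_lens convex_halfspace_ge)
qed

lemma compact_half_lens: "compact half_lens"
  unfolding half_lens_eq
  by (intro compact_Int_closed compact_lens closed_Collect_le continuous_intros)

lemma interior_lens: "interior lens = {z. \<bar>fst z\<bar> < snd z * (1 - snd z)}"
proof
  show "{z. \<bar>fst z\<bar> < snd z * (1 - snd z)} \<subseteq> interior lens"
    by (rule interior_maximal) (auto simp: lens_def intro!: open_Collect_less continuous_intros)
  show "interior lens \<subseteq> {z. \<bar>fst z\<bar> < snd z * (1 - snd z)}"
  proof
    fix z assume "z \<in> interior lens"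
    then obtain e where e: "e > 0" "ball z e \<subseteq> lens" by (meson mem_interior)
    \<comment> \<open>Horizontal shifts by half the radius stay in the ball, so the inequality for
      the first coordinate must be strict.\<close>
    have "(fst z + e/2, snd z) \<in> lens" "(fst z - e/2, snd z) \<in> lens"
      using e by (auto intro!: subsetD[OF e(2)] simp: dist_prod_def dist_real_def)
    then show "z \<in> {z. \<bar>fst z\<bar> < snd z * (1 - snd z)}" using e(1) by (auto simp: lens_def)
  qed
qed

lemma interior_half_lens: "interior half_lens = {z. 0 < fst z \<and> fst z < snd z * (1 - snd z)}"
proof
  show "{z. 0 < fst z \<and> fst z < snd z * (1 - snd z)} \<subseteq> interior half_lens"
    by (rule interior_maximal) (auto simp: half_lens_def intro!: open_Collect_less open_Collect_conj continuous_intros)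
  show "interior half_lens \<subseteq> {z. 0 < fst z \<and> fst z < snd z * (1 - snd z)}"
  proof
    fix z assume "z \<in> interior half_lens"
    then obtain e where e: "e > 0" "ball z e \<subseteq> half_lens" by (meson mem_interior)
    have "(fst z + e/2, snd z) \<in> half_lens" "(fst z - e/2, snd z) \<in> half_lens"
      using e by (auto intro!: subsetD[OF e(2)] simp: dist_prod_def dist_real_def)
    then show "z \<in> {z. 0 < fst z \<and> fst z < snd z * (1 - snd z)}" using e(1) by (auto simp: half_lens_def)
  qed
qed

lemma interior_lens_nonempty: "interior lens \<noteq> {}" "interior half_lens \<noteq> {}"
proof -
  have "(1/8, 1/2) \<in> interior lens" "(1/8, 1/2) \<in> interior half_lens"
    by (simp_all add: interior_lens interior_half_lens)
  then show "interior lens \<noteq> {}" "interior half_lens \<noteq> {}" by blast+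
qed

lemma frontier_half_lens:
  "z \<in> frontier half_lens \<longleftrightarrow> snd z \<in> {0..1} \<and> (fst z = 0 \<or> fst z = snd z * (1 - snd z))"
proof -
  have "frontier half_lens = half_lens - interior half_lens"
    using compact_half_lens by (simp add: frontier_def compact_imp_closed)
  then have "z \<in> frontier half_lens \<longleftrightarrow> z \<in> half_lens \<and> \<not> (0 < fst z \<and> fst z < snd z * (1 - snd z))"
    by (simp add: interior_half_lens)
  also have "z \<in> half_lens \<longleftrightarrow> 0 \<le> fst z \<and> fst z \<le> snd z * (1 - snd z)" by (simp add: half_lens_def)
  finally show ?thesis unfolding parabola_nonneg_iff[symmetric]
    by linarith
qed

lemma frontier_lens:
  "z \<in> frontier lens \<longleftrightarrow> snd z \<in> {0..1} \<and> \<bar>fst z\<bar> = snd z * (1 - snd z)"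
proof -
  have "frontier lens = lens - interior lens"
    using compact_lens by (simp add: frontier_def compact_imp_closed)
  then have "z \<in> frontier lens \<longleftrightarrow> z \<in> lens \<and> \<not> (\<bar>fst z\<bar> < snd z * (1 - snd z))"
    by (simp add: interior_lens)
  also have "z \<in> lens \<longleftrightarrow> \<bar>fst z\<bar> \<le> snd z * (1 - snd z)" by (simp add: lens_def)
  finally show ?thesis unfolding parabola_nonneg_iff[symmetric]
    by linarith
qed

text \<open>Both arcs of the face boundary run from one tip to the other, so the height in the lens
  serves as parameter for either: \<open>p\<close> on the straight side, \<open>q\<close> on the
  curved one.\<close>

lemma bounded_by_half_lens:
  assumes X: "Hausdorff_space X" and b: "bounded_by X F (A \<union> B)"
    and p: "pathin X p" "inj_on p {0..1}" "p ` {0..1} = A"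
    and q: "pathin X q" "inj_on q {0..1}" "q ` {0..1} = B"
    and e: "p 0 = q 0" "p 1 = q 1" and AB: "A \<inter> B = {p 0, p 1}"
  obtains k where "continuous_map (top_of_set half_lens) X k" "inj_on k half_lens"
    "k ` interior half_lens = F"
    "\<And>y. y \<in> {0..1} \<Longrightarrow> k (0, y) = p y" "\<And>y. y \<in> {0..1} \<Longrightarrow> k (y * (1 - y), y) = q y"
proof -
  \<comment> \<open>Half the parabola runs between the two sides. It meets the frontier only in the
    tips, where \<open>p\<close> and \<open>q\<close> agree, so two closed pieces are
    pasted.\<close>
  define \<psi> where "\<psi> z = (if fst z \<le> snd z * (1 - snd z) / 2 then p (snd z) else q (snd z))" for z :: "real \<times> real"
  have s: "continuous_map (top_of_set S) (top_of_set {0..1}) snd" if "S \<subseteq> frontier half_lens" for S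
  proof -
    have "snd \<in> S \<rightarrow> {0..1}" using that frontier_half_lens by blast
    moreover have "continuous_on S snd" by (intro continuous_intros)
    ultimately show ?thesis by (simp add: continuous_map_in_subtopology)
  qed
  have \<psi>p: "\<psi> z = p (snd z)" if "z \<in> frontier half_lens" "fst z = 0" for z
    using that frontier_half_lens[of z] by (auto simp: \<psi>_def)
  have \<psi>q: "\<psi> z = q (snd z)" if z: "z \<in> frontier half_lens" "fst z = snd z * (1 - snd z)" for z
  proof (cases "fst z \<le> snd z * (1 - snd z) / 2")
    case True
    moreover have "0 \<le> snd z * (1 - snd z)" using z(1) frontier_half_lens parabola_nonneg_iff by blast
    ultimately have "snd z * (1 - snd z) = 0" using z(2) by linarith
    then have "snd z = 0 \<or> snd z = 1" by auto
    then show ?thesis using e by (auto simp: \<psi>_def)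
  qed (simp add: \<psi>_def)
  have cont: "continuous_map (top_of_set (frontier half_lens)) X \<psi>"
    unfolding \<psi>_def
  proof (rule continuous_map_cases_le)
    show "continuous_map (subtopology (top_of_set (frontier half_lens))
       {x \<in> topspace (top_of_set (frontier half_lens)). fst x \<le> snd x * (1 - snd x) / 2}) X (\<lambda>z. p (snd z))"
      using continuous_map_compose[OF s p(1)[unfolded pathin_def], unfolded o_def]
      by (simp add: subtopology_subtopology)
    show "continuous_map (subtopology (top_of_set (frontier half_lens))
       {x \<in> topspace (top_of_set (frontier half_lens)). snd x * (1 - snd x) / 2 \<le> fst x}) X (\<lambda>z. q (snd z))"
      using continuous_map_compose[OF s q(1)[unfolded pathin_def], unfolded o_def]
      by (simp add: subtopology_subtopology)
    show "p (snd x) = q (snd x)" if "x \<in> topspace (top_of_set (frontier half_lens))" "fst x = snd x * (1 - snd x) / 2" for x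
    proof -
      have "snd x * (1 - snd x) = 0" using that frontier_half_lens[of x] by auto
      then have "snd x = 0 \<or> snd x = 1" by auto
      then show ?thesis using e by auto
    qed
  qed (auto intro!: continuous_intros)
  \<comment> \<open>The arcs meet only in their ends, so a common value forces both parameters to be
    the same \<open>0\<close> or \<open>1\<close>.\<close>
  have cross: "snd z = snd w \<and> (snd z = 0 \<or> snd z = 1)" if "snd z \<in> {0..1}" "snd w \<in> {0..1}" "p (snd z) = q (snd w)" for z w :: "real \<times> real"
  proof -
    have "p (snd z) \<in> A \<inter> B" using that p(3) q(3) by (metis IntI imageI)
    then have "p (snd z) = p 0 \<or> p (snd z) = p 1" using AB by blast
    then show ?thesis
    proof
      assume "p (snd z) = p 0"
      then have "snd z = 0" "snd w = 0"
        using that inj_onD[OF p(2), of "snd z" 0] inj_onD[OF q(2), of "snd w" 0] e by auto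
      then show ?thesis by simp
    next
      assume "p (snd z) = p 1"
      then have "snd z = 1" "snd w = 1"
        using that inj_onD[OF p(2), of "snd z" 1] inj_onD[OF q(2), of "snd w" 1] e by auto
      then show ?thesis by simp
    qed
  qed
  have inj: "inj_on \<psi> (frontier half_lens)"
  proof (rule inj_onI)
    fix z w assume zw: "z \<in> frontier half_lens" "w \<in> frontier half_lens" "\<psi> z = \<psi> w"
    then have s: "snd z \<in> {0..1}" "snd w \<in> {0..1}" using frontier_half_lens by blast+
    consider "fst z = 0" "fst w = 0" | "fst z = snd z * (1 - snd z)" "fst w = snd w * (1 - snd w)"
      | "fst z = 0" "fst w = snd w * (1 - snd w)" | "fst z = snd z * (1 - snd z)" "fst w = 0"
      using zw frontier_half_lens by blast
    then show "z = w"
    proof cases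
      case 1
      then have "snd z = snd w" using zw s \<psi>p p(2) by (metis inj_onD)
      then show ?thesis using 1 by (simp add: prod_eq_iff)
    next
      case 2
      then have "snd z = snd w" using zw s \<psi>q q(2) by (metis inj_onD)
      then show ?thesis using 2 by (simp add: prod_eq_iff)
    next
      case 3
      then have "p (snd z) = q (snd w)" using zw \<psi>p \<psi>q by metis
      then show ?thesis using cross[OF s] 3 by (auto simp: prod_eq_iff)
    next
      case 4
      then have "p (snd w) = q (snd z)" using zw \<psi>p \<psi>q by metis
      then show ?thesis using cross[OF s(2,1)] 4 by (auto simp: prod_eq_iff)
    qed
  qed
  have im: "\<psi> ` frontier half_lens = A \<union> B"
  proof
    show "\<psi> ` frontier half_lens \<subseteq> A \<union> B"
      using p(3) q(3) frontier_half_lens by (auto simp: \<psi>_def)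
    have "p y \<in> \<psi> ` frontier half_lens" if "y \<in> {0..1}" for y
      using that \<psi>p[of "(0, y)"] by (intro image_eqI[of _ _ "(0, y)"]) (auto simp: frontier_half_lens)
    moreover have "q y \<in> \<psi> ` frontier half_lens" if "y \<in> {0..1}" for y
      using that \<psi>q[of "(y * (1 - y), y)"] by (intro image_eqI[of _ _ "(y * (1 - y), y)"]) (auto simp: frontier_half_lens)
    ultimately show "A \<union> B \<subseteq> \<psi> ` frontier half_lens" using p(3) q(3) by blast
  qed
  obtain k where k: "continuous_map (top_of_set half_lens) X k" "inj_on k half_lens"
    "k ` interior half_lens = F" "\<And>x. x \<in> frontier half_lens \<Longrightarrow> k x = \<psi> x"
    using bounded_by_extend_parametrization[OF X b _ convex_half_lens compact_half_lens interior_lens_nonempty(2) cont inj im]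
    by auto
  show ?thesis
    by (rule that[OF k(1-3)]) (auto simp: k(4) \<psi>p \<psi>q frontier_half_lens)
qed

text \<open>The discs are placed on the two halves of a lens. The first claim concerns the inside of
  the lens only, and so covers faces whose outer arcs \<open>B\<close> and \<open>B'\<close>
  overlap. For the whole lens to be embedded as a closed disc, the outer arcs must meet in their
  ends alone.\<close>

lemma glue_discs_along_arc:
  assumes X: "closed_surface X" and b: "bounded_by X F (A \<union> B)" and b': "bounded_by X F' (A \<union> B')"
    and A: "arc_joining X u v A" and B: "arc_joining X u v B" and B': "arc_joining X u v B'"
    and AB: "A \<inter> B = {u, v}" and AB': "A \<inter> B' = {u, v}"
    and FF: "F \<inter> F' = {}" "F \<inter> B' = {}" "F' \<inter> B = {}"
  shows "openin X (F \<union> F' \<union> (A - {u, v}))"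
    and "B \<inter> B' = {u, v} \<Longrightarrow> bounded_by X (F \<union> F' \<union> (A - {u, v})) (B \<union> B')"
proof -
  have H: "Hausdorff_space X" using X closed_surface_Hausdorff by blast
  obtain p where p: "pathin X p" "inj_on p {0..1}" "p 0 = u" "p 1 = v" "p ` {0..1} = A"
    using A unfolding arc_joining_def by blast
  obtain q where q: "pathin X q" "inj_on q {0..1}" "q 0 = u" "q 1 = v" "q ` {0..1} = B"
    using B unfolding arc_joining_def by blast
  obtain q' where q': "pathin X q'" "inj_on q' {0..1}" "q' 0 = u" "q' 1 = v" "q' ` {0..1} = B'"
    using B' unfolding arc_joining_def by blast
  obtain k where k: "continuous_map (top_of_set half_lens) X k" "inj_on k half_lens"
    "k ` interior half_lens = F"
    "\<And>y. y \<in> {0..1} \<Longrightarrow> k (0, y) = p y" "\<And>y. y \<in> {0..1} \<Longrightarrow> k (y * (1 - y), y) = q y"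
    using bounded_by_half_lens[OF H b p(1,2,5) q(1,2,5)] p(3,4) q(3,4) AB by metis
  obtain k' where k': "continuous_map (top_of_set half_lens) X k'" "inj_on k' half_lens"
    "k' ` interior half_lens = F'"
    "\<And>y. y \<in> {0..1} \<Longrightarrow> k' (0, y) = p y" "\<And>y. y \<in> {0..1} \<Longrightarrow> k' (y * (1 - y), y) = q' y"
    using bounded_by_half_lens[OF H b' p(1,2,5) q'(1,2,5)] p(3,4) q'(3,4) AB' by metis
  \<comment> \<open>Reflection in the common side: \<open>f\<close> is \<open>k\<close> on the right
    half and the mirrored \<open>k'\<close> on the left one, and both are \<open>p\<close> on the
    axis.\<close>
  define m where "m z = (- fst z, snd z)" for z :: "real \<times> real"
  define f where "f z = (if 0 \<le> fst z then k z else k' (m z))" for z :: "real \<times> real"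
  have halves: "lens \<inter> {z. 0 \<le> fst z} = half_lens" "m ` (lens \<inter> {z. fst z \<le> 0}) \<subseteq> half_lens"
    by (auto simp: half_lens_def lens_def m_def)
  have cont: "continuous_map (top_of_set lens) X f"
    unfolding f_def
  proof (rule continuous_map_cases_le)
    show "continuous_map (subtopology (top_of_set lens) {x \<in> topspace (top_of_set lens). 0 \<le> fst x}) X k"
    proof -
      have "lens \<inter> {x \<in> lens. 0 \<le> fst x} = half_lens" using halves(1) by auto
      then show ?thesis using k(1) by (simp only: topspace_euclidean_subtopology subtopology_subtopology)
    qed
    have "continuous_map (top_of_set (lens \<inter> {z. fst z \<le> 0})) (top_of_set half_lens) m"
      using halves(2) by (auto simp: continuous_map_in_subtopology m_def intro!: continuous_intros)
    from continuous_map_compose[OF this k'(1)]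
    show "continuous_map (subtopology (top_of_set lens) {x \<in> topspace (top_of_set lens). fst x \<le> 0}) X (\<lambda>z. k' (m z))"
      by (simp add: subtopology_subtopology Int_def o_def)
    show "k x = k' (m x)" if "x \<in> topspace (top_of_set lens)" "0 = fst x" for x
    proof -
      have "snd x \<in> {0..1}" using that parabola_nonneg_iff[of "snd x"] by (auto simp: lens_def)
      moreover have "x = (0, snd x)" "m x = (0, snd x)" using that by (auto simp: m_def prod_eq_iff)
      ultimately show ?thesis using k(4) k'(4) by metis
    qed
  qed (auto intro!: continuous_intros)
  have rng: "z \<in> interior half_lens \<or> (\<exists>y\<in>{0..1}. z = (0, y)) \<or> (\<exists>y\<in>{0..1}. z = (y * (1 - y), y))"
    if "z \<in> half_lens" for z
  proof (cases "z \<in> interior half_lens")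
    case False
    then have "z \<in> frontier half_lens" using that closure_subset by (auto simp: frontier_def)
    then show ?thesis unfolding frontier_half_lens by (metis prod.collapse)
  qed auto
  have kim: "k z \<in> F \<union> A \<union> B" if "z \<in> half_lens" for z
    using rng[OF that] k(3) k(4,5) p(5) q(5) by (metis UnI1 UnI2 imageI)
  have left: "m z \<in> half_lens" "0 < fst (m z)" if "z \<in> lens" "fst z < 0" for z
    using that halves(2) by (auto simp: m_def)
  \<comment> \<open>Strictly left of the axis the common arc does not occur, and points of the outer
    arc come only from the frontier of the lens without its tips.\<close>
  have k'im: "k' (m z) \<in> F' \<or> k' (m z) \<in> B' - {u, v} \<and> z \<notin> interior lens"
    if z: "z \<in> lens" "fst z < 0" for z
  proof (cases "m z \<in> interior half_lens")
    case True then show ?thesis using k'(3) by blast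
  next
    case False
    then obtain y where y: "y \<in> {0..1}" "m z = (y * (1 - y), y)"
      using rng[OF left(1)[OF z]] left(2)[OF z] by auto
    have "y \<noteq> 0" "y \<noteq> 1" using y(2) left(2)[OF z] by auto
    then have "q' y \<noteq> q' 0" "q' y \<noteq> q' 1" using q'(2) y(1) by (auto dest: inj_onD[of q' "{0..1}" y 0] inj_onD[of q' "{0..1}" y 1])
    then have "k' (m z) \<in> B' - {u, v}" using y k'(5) q'(3,4,5) by auto
    moreover have "z \<notin> interior lens" using y(2) z(2) by (auto simp: interior_lens m_def)
    ultimately show ?thesis by blast
  qed
  have dFA: "F \<inter> A = {}" "F' \<inter> A = {}" using bounded_by_basics(2)[OF b] bounded_by_basics(2)[OF b'] by auto
  have cross: "f z \<noteq> f w" if "z \<in> lens" "w \<in> lens" "0 \<le> fst z" "fst w < 0" "w \<in> interior lens \<or> B \<inter> B' = {u, v}" for z w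
  proof -
    have "f z \<in> F \<union> A \<union> B" using that kim[of z] halves(1) by (auto simp: f_def)
    moreover have "f w = k' (m w)" using that by (simp add: f_def)
    ultimately show ?thesis using k'im[OF that(2,4)] that(5) FF dFA AB' by auto
  qed
  \<comment> \<open>Stated for a set \<open>S\<close> to serve both claims: the interior in all
    cases, the whole lens if the outer arcs meet only in their ends.\<close>
  have inj: "inj_on f S" if S: "S \<subseteq> lens" "S \<subseteq> interior lens \<or> B \<inter> B' = {u, v}" for S
  proof (rule inj_onI)
    fix z w assume zw: "z \<in> S" "w \<in> S" "f z = f w"
    consider "0 \<le> fst z" "0 \<le> fst w" | "fst z < 0" "fst w < 0" | "0 \<le> fst z" "fst w < 0" | "fst z < 0" "0 \<le> fst w"
      by linarith
    then show "z = w"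
    proof cases
      case 1
      then have "z \<in> half_lens" "w \<in> half_lens" "k z = k w" using zw S(1) halves(1) by (auto simp: f_def)
      then show ?thesis using k(2) by (auto dest: inj_onD)
    next
      case 2
      then have "m z \<in> half_lens" "m w \<in> half_lens" "k' (m z) = k' (m w)" using zw S(1) left(1)[of z] left(1)[of w] by (auto simp: f_def)
      then have "m z = m w" using k'(2) by (auto dest: inj_onD)
      then show ?thesis by (auto simp: m_def prod_eq_iff)
    next
      case 3 then show ?thesis using cross[of z w] zw S by auto
    next
      case 4 then show ?thesis using cross[of w z] zw S by force
    qed
  qed
  have parab: "\<And>y. 0 \<le> y * (1 - y) \<Longrightarrow> y \<in> {0..1::real}" using parabola_nonneg_iff by blast
  have im: "f ` interior lens = F \<union> F' \<union> (A - {u, v})"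
  proof (intro equalityI subsetI)
    fix x assume "x \<in> f ` interior lens"
    then obtain z where z: "z \<in> interior lens" "x = f z" by blast
    have zl: "z \<in> lens" using z interior_subset by blast
    consider "fst z < 0" | "fst z > 0" | "fst z = 0" by linarith
    then show "x \<in> F \<union> F' \<union> (A - {u, v})"
    proof cases
      case 1 then show ?thesis using k'im[OF zl] z by (auto simp: f_def)
    next
      case 2
      then have "z \<in> interior half_lens" using z(1) by (auto simp: interior_lens interior_half_lens)
      then show ?thesis using 2 k(3) z(2) by (auto simp: f_def)
    next
      case 3
      then have y: "snd z \<in> {0..1}" "snd z \<noteq> 0" "snd z \<noteq> 1" using z(1) parab[of "snd z"] by (auto simp: interior_lens)
      then have "p (snd z) \<noteq> p 0" "p (snd z) \<noteq> p 1"
        using inj_onD[OF p(2), of "snd z" 0] inj_onD[OF p(2), of "snd z" 1] by auto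
      moreover have "x = p (snd z)" using z(2) 3 k(4)[OF y(1)] by (simp add: f_def) (metis prod.collapse)
      ultimately show ?thesis using y(1) p(3-5) by auto
    qed
  next
    fix x assume "x \<in> F \<union> F' \<union> (A - {u, v})"
    then consider "x \<in> F" | "x \<in> F'" | "x \<in> A - {u, v}" by blast
    then show "x \<in> f ` interior lens"
    proof cases
      case 1
      then obtain z where "z \<in> interior half_lens" "x = k z" using k(3) by blast
      then show ?thesis
        by (intro image_eqI[of _ _ z]) (auto simp: f_def interior_half_lens interior_lens)
    next
      case 2
      then obtain z where "z \<in> interior half_lens" "x = k' z" using k'(3) by blast
      then show ?thesis
        by (intro image_eqI[of _ _ "m z"]) (auto simp: f_def m_def interior_half_lens interior_lens)
    next
      case 3
      then obtain y where y: "y \<in> {0..1}" "x = p y" using p(5) by blast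
      then have "y \<noteq> 0" "y \<noteq> 1" using 3 p(3,4) by auto
      then show ?thesis
        using y k(4)[OF y(1)] by (intro image_eqI[of _ _ "(0, y)"]) (auto simp: f_def interior_lens)
    qed
  qed
  show "openin X (F \<union> F' \<union> (A - {u, v}))"
    unfolding im[symmetric]
  proof (rule surface_invariance_of_domain_into[OF X])
    show "continuous_map (top_of_set (interior lens)) X f"
      using continuous_map_from_subtopology_mono[OF cont interior_subset] .
    show "inj_on f (interior lens)" by (rule inj) (auto simp: interior_subset)
  qed auto
  assume BB: "B \<inter> B' = {u, v}"
  have fr: "f ` frontier lens = B \<union> B'"
  proof (intro equalityI subsetI)
    fix x assume "x \<in> f ` frontier lens"
    then obtain z where z: "snd z \<in> {0..1}" "\<bar>fst z\<bar> = snd z * (1 - snd z)" "x = f z"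
      using frontier_lens by blast
    show "x \<in> B \<union> B'"
    proof (cases "0 \<le> fst z")
      case True
      then have "z = (snd z * (1 - snd z), snd z)" using z(2) by (simp add: prod_eq_iff)
      then have "x = q (snd z)" using True z(3) k(5)[OF z(1)] by (simp add: f_def)
      then show ?thesis using q(5) z(1) by blast
    next
      case False
      then have "m z = (snd z * (1 - snd z), snd z)" using z(2) by (simp add: m_def)
      then have "x = q' (snd z)" using False z(3) k'(5)[OF z(1)] by (simp add: f_def)
      then show ?thesis using q'(5) z(1) by blast
    qed
  next
    fix x assume "x \<in> B \<union> B'"
    then show "x \<in> f ` frontier lens"
    proof
      assume "x \<in> B"
      then obtain y where y: "y \<in> {0..1}" "x = q y" using q(5) by blast
      then have "0 \<le> y * (1 - y)" using parabola_nonneg_iff by blast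
      then show ?thesis
        using y(2) k(5)[OF y(1)] y(1) by (intro image_eqI[of _ _ "(y * (1 - y), y)"]) (simp_all add: f_def frontier_lens)
    next
      assume "x \<in> B'"
      then obtain y where y: "y \<in> {0..1}" "x = q' y" using q'(5) by blast
      then have nn: "0 \<le> y * (1 - y)" using parabola_nonneg_iff by blast
      \<comment> \<open>At the tips the first coordinate is \<open>0\<close> and \<open>f\<close>
        takes the right branch; there \<open>p\<close> and \<open>q'\<close> have the same
        value.\<close>
      have "f (- (y * (1 - y)), y) = q' y"
      proof (cases "y * (1 - y) = 0")
        case True
        then have "y = 0 \<or> y = 1" by simp
        then show ?thesis using k(4)[of y] y(1) p(3,4) q'(3,4) True by (auto simp: f_def)
      next
        case False
        then have "\<not> 0 \<le> fst (- (y * (1 - y)), y)" using nn by simp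
        then show ?thesis using k'(5)[OF y(1)] by (simp only: f_def m_def if_False) simp
      qed
      then show ?thesis
        using y nn by (intro image_eqI[of _ _ "(- (y * (1 - y)), y)"]) (simp_all add: frontier_lens)
    qed
  qed
  show "bounded_by X (F \<union> F' \<union> (A - {u, v})) (B \<union> B')"
    unfolding im[symmetric] fr[symmetric]
    by (rule bounded_by_image[OF H _ convex_lens compact_lens interior_lens_nonempty(1) cont inj])
      (use BB in auto)
qed

section \<open>Curves on the sphere\<close>

lemma homeomorphic_maps_top_of_set:
  "homeomorphic_maps (top_of_set A) (top_of_set B) f g \<longleftrightarrow> homeomorphism A B f g"
proof
  assume "homeomorphic_maps (top_of_set A) (top_of_set B) f g"
  then show "homeomorphism A B f g"
    unfolding homeomorphic_maps_def homeomorphism_def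
    by (auto simp: continuous_map_in_subtopology image_iff) (metis Pi_mem)+
next
  assume "homeomorphism A B f g"
  then show "homeomorphic_maps (top_of_set A) (top_of_set B) f g"
    unfolding homeomorphic_maps_def homeomorphism_def
    by (auto simp: continuous_map_in_subtopology)
qed

lemma homeomorphic_space_top_of_set:
  "top_of_set A homeomorphic_space top_of_set B \<longleftrightarrow> A homeomorphic B"
  unfolding homeomorphic_space_def homeomorphic_def homeomorphic_maps_top_of_set ..

lemma punctured_sphere_homeomorphic_plane:
  fixes q :: "'n::euclidean_space"
  assumes "DIM('n) = 3" "q \<in> sphere 0 1"
  shows "sphere 0 1 - {q} homeomorphic (UNIV :: complex set)"
  using homeomorphic_punctured_sphere_affine_gen[of "cball (0::'n) 1" q "UNIV::complex set"] assms
  by (simp add: aff_dim_cball rel_frontier_cball)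

text \<open>The chart at a point is stereographic projection from its antipode. The type is left
  open since the sphere in \<open>complex \<times> real\<close> suits the gluing of two discs and
  the one in \<open>real^3\<close> the theorem.\<close>

lemma closed_surface_sphere:
  assumes "DIM('n::euclidean_space) = 3"
  shows "closed_surface (top_of_set (sphere (0::'n) 1))"
  unfolding closed_surface_def
proof (intro conjI ballI)
  show "topspace (top_of_set (sphere (0::'n) 1)) \<noteq> {}" by simp
  show "compact_space (top_of_set (sphere (0::'n) 1))" by (simp add: compact_space_subtopology)
  show "connected_space (top_of_set (sphere (0::'n) 1))"
    using connected_sphere[of "0::'n" 1] assms by (simp add: connectedin_def[symmetric] connected_space_subtopology)
  show "Hausdorff_space (top_of_set (sphere (0::'n) 1))" by (simp add: Hausdorff_space_subtopology)
  fix p :: 'n assume "p \<in> topspace (top_of_set (sphere (0::'n) 1))"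
  then have p: "p \<in> sphere 0 1" by simp
  have ne: "p \<noteq> - p"
  proof
    assume "p = - p"
    then have "2 *\<^sub>R p = 0" by (metis add.right_inverse scaleR_2)
    then show False using p by simp
  qed
  define U where "U = sphere 0 1 - {- p}"
  have "U homeomorphic (UNIV :: complex set)"
    unfolding U_def by (rule punctured_sphere_homeomorphic_plane[OF assms]) (use p in simp)
  then have "U homeomorphic ball (0::complex) 1"
    using homeomorphic_ball01_UNIV homeomorphic_sym homeomorphic_trans by blast
  moreover have "openin (top_of_set (sphere 0 1)) U"
    unfolding U_def by (simp add: openin_delete)
  moreover have "subtopology (top_of_set (sphere 0 1)) U = top_of_set U"
    by (simp add: subtopology_subtopology U_def Int_absorb1)
  ultimately show "\<exists>U. openin (top_of_set (sphere 0 1)) U \<and> p \<in> U \<and>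
      subtopology (top_of_set (sphere 0 1)) U homeomorphic_space top_of_set (ball (0::complex) 1)"
    using p ne by (intro exI[of _ U]) (auto simp: homeomorphic_space_top_of_set U_def)
qed

lemma interior_sphere: "interior (sphere (a::complex) r) = {}"
  using negligible_sphere[of a r] negligible_subset[OF _ interior_subset] open_interior open_not_negligible by blast

text \<open>Puncturing the sphere at a point off the curve reduces the claim to the Jordan-Brouwer
  theorems in the plane. Besides separation, later arguments rely on both sides accumulating at
  every point of the curve.\<close>

lemma Jordan_curve_sphere:
  fixes c :: "'n::euclidean_space set"
  assumes dim: "DIM('n) = 3" and c: "c \<subseteq> sphere 0 1" "c homeomorphic sphere (0::complex) 1"
  obtains A B where "openin (top_of_set (sphere 0 1)) A" "openin (top_of_set (sphere 0 1)) B"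
    "A \<inter> B = {}" "A \<union> B = sphere 0 1 - c" "c \<subseteq> closure A" "c \<subseteq> closure B"
proof -
  let ?S = "sphere (0::'n) 1"
  \<comment> \<open>Otherwise the surface itself would be thin, being homeomorphic to a circle in
    the plane.\<close>
  have "c \<noteq> ?S"
  proof
    assume e: "c = ?S"
    have "?S = {}"
      by (rule surface_open_not_in_thin[OF closed_surface_sphere[OF dim], of ?S ?S "sphere (0::complex) 1"])
        (use c(2) e interior_sphere in \<open>simp_all add: subtopology_subtopology homeomorphic_space_top_of_set\<close>)
    then show False by simp
  qed
  then obtain q where q: "q \<in> ?S" "q \<notin> c" using c(1) by blast
  obtain f g where fg: "homeomorphism (?S - {q}) (UNIV::complex set) f g"
    using punctured_sphere_homeomorphic_plane[OF dim q(1)] unfolding homeomorphic_def by blast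
  have f: "continuous_on (?S - {q}) f" and g: "continuous_on UNIV g" "range g = ?S - {q}"
    and gf: "\<And>x. x \<in> ?S - {q} \<Longrightarrow> g (f x) = x" and fg': "\<And>z. f (g z) = z"
    using fg unfolding homeomorphism_def by auto
  define c' where "c' = f ` c"
  have gc: "g ` c' = c"
  proof -
    have "(\<lambda>x. g (f x)) ` c = (\<lambda>x. x) ` c" by (rule image_cong) (use gf c(1) q in blast)+
    then show ?thesis by (simp add: c'_def image_image)
  qed
  have "homeomorphism c c' f g"
    by (rule homeomorphism_of_subsets[OF fg]) (use c(1) q c'_def in auto)
  then have hc': "c' homeomorphic sphere (0::complex) 1"
    using c(2) homeomorphic_def homeomorphic_sym homeomorphic_trans by metis
  have nc: "\<not> connected (- c')" using Jordan_Brouwer_separation[OF hc'] by simp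
  have comp: "compact c'" using homeomorphic_compactness[OF hc'] by simp
  obtain T1 where T1: "T1 \<in> components (- c')" "bounded T1"
    using cobounded_has_bounded_component[OF _ nc] comp compact_imp_bounded by auto
  obtain T2 where T2: "T2 \<in> components (- c')" "T2 \<noteq> T1"
    using nc connected_eq_connected_components_eq T1(1) by blast
  have op: "open T1" using T1(1) open_components[of "- c'"] comp compact_imp_closed by blast
  have cl: "c' \<subseteq> closure T1" "c' \<subseteq> closure T2"
    using Jordan_Brouwer_frontier[OF hc' T1(1)] Jordan_Brouwer_frontier[OF hc' T2(1)]
    by (auto simp: frontier_def)
  have sub: "T1 \<subseteq> - c'" "T2 \<subseteq> - c'" using T1 T2 in_components_subset by blast+
  have disj: "T1 \<inter> T2 = {}" using T1(1) T2 components_nonoverlap by blast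
  have "closed (c' \<union> T1)"
  proof -
    have "closure T1 = T1 \<union> c'"
      using Jordan_Brouwer_frontier[OF hc' T1(1)] closure_Un_frontier[of T1] by simp
    then show ?thesis by (metis closed_closure sup_commute)
  qed
  then have "compact (c' \<union> T1)" using T1(2) comp compact_imp_bounded by (simp add: compact_eq_bounded_closed)
  then have cg: "closed (g ` (c' \<union> T1))"
    using compact_continuous_image continuous_on_subset[OF g(1)] compact_imp_closed by blast
  have inj: "inj g" using fg' by (metis injI)
  define A where "A = g ` T1"
  \<comment> \<open>The other side is taken as the complement of a compact set: this makes it open
    and lets it contain the puncture \<open>q\<close>, which \<open>g\<close> misses.\<close>
  define B where "B = ?S - g ` (c' \<union> T1)"
  have hgS: "homeomorphism UNIV (?S - {q}) g f" using fg homeomorphism_sym by blast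
  show ?thesis
  proof (rule that[of A B])
    have "openin (top_of_set (?S - {q})) A"
      unfolding A_def using homeomorphism_imp_open_map[OF hgS, of T1] op by simp
    moreover have "openin (top_of_set ?S) (?S - {q})" by (simp add: openin_delete)
    ultimately show "openin (top_of_set ?S) A" using openin_trans by blast
    show "openin (top_of_set ?S) B"
      unfolding B_def Diff_eq using cg by (simp add: open_Compl openin_open_Int)
    show "A \<inter> B = {}" unfolding A_def B_def by blast
    have "A \<inter> c = {}" unfolding A_def gc[symmetric] using sub(1) inj by (auto dest: injD)
    then show "A \<union> B = ?S - c"
      using g(2) gc unfolding A_def B_def by (auto simp: image_Un)
    show "c \<subseteq> closure A"
      using continuous_image_closure_subset[OF g(1), of T1] cl(1) unfolding A_def gc[symmetric] by blast
    have "g ` T2 \<subseteq> B" using g(2) inj disj sub(2) unfolding B_def by (auto dest: injD)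
    then show "c \<subseteq> closure B"
      using continuous_image_closure_subset[OF g(1), of T2] cl(2) closure_mono unfolding gc[symmetric] by blast
  qed
qed

text \<open>Each closed disc becomes a hemisphere through the vertical projection
  \<open>fst\<close>. The second parametrization is adjusted to the first on the circle, so that
  both match along the equator.\<close>

lemma two_discs_homeomorphic_sphere:
  assumes X: "Hausdorff_space X" and b: "bounded_by X F C" and b': "bounded_by X F' C"
    and disj: "F \<inter> F' = {}" and all: "F \<union> F' \<union> C = topspace X"
  shows "top_of_set (sphere (0 :: complex \<times> real) 1) homeomorphic_space X"
proof -
  obtain h where h0: "homeomorphic_map (top_of_set (cball (0::complex) 1)) (subtopology X (X closure_of F)) h"
    and hF: "h ` ball 0 1 = F" and hC: "h ` sphere 0 1 = C"
    using b unfolding bounded_by_def by blast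
  have h: "continuous_map (top_of_set (cball 0 1)) X h"
    using homeomorphic_imp_continuous_map[OF h0] continuous_map_into_fulltopology by blast
  have hi: "inj_on h (cball 0 1)" using homeomorphic_imp_injective_map[OF h0] by simp
  have fr: "frontier (cball (0::complex) 1) = sphere 0 1" by simp
  obtain k where k: "continuous_map (top_of_set (cball (0::complex) 1)) X k" "inj_on k (cball 0 1)"
    "k ` ball 0 1 = F'" and kh: "\<And>x. x \<in> sphere 0 1 \<Longrightarrow> k x = h x"
  proof (rule bounded_by_extend_parametrization[OF X b', of "cball (0::complex) 1" h])
    show "continuous_map (top_of_set (frontier (cball 0 1))) X h"
      unfolding fr using continuous_map_from_subtopology_mono[OF h sphere_cball] .
    show "inj_on h (frontier (cball 0 1))" unfolding fr using inj_on_subset[OF hi sphere_cball] .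
  qed (use hC fr in auto)
  let ?S = "sphere (0 :: complex \<times> real) 1"
  define G where "G w = (if 0 \<le> snd w then h (fst w) else k (fst w))" for w :: "complex \<times> real"
  have S: "w \<in> ?S \<longleftrightarrow> (norm (fst w))\<^sup>2 + (snd w)\<^sup>2 = 1" for w :: "complex \<times> real"
    by (simp add: norm_prod_def real_sqrt_eq_1_iff)
  have fst1: "norm (fst w) \<le> 1" if "w \<in> ?S" for w
    using that norm_fst_le[of "fst w" "snd w"] by simp
  have fst2: "norm (fst w) < 1" if "w \<in> ?S" "snd w \<noteq> 0" for w
  proof -
    have "(snd w)\<^sup>2 > 0" using that(2) by simp
    moreover have "(norm (fst w))\<^sup>2 + (snd w)\<^sup>2 = 1" using that(1) S by blast
    ultimately have "(norm (fst w))\<^sup>2 < 1\<^sup>2" unfolding power_one by linarith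
    then show ?thesis by (rule power2_less_imp_less) simp
  qed
  have "continuous_map (top_of_set ?S) (top_of_set (cball 0 1)) fst"
    using fst1 by (auto simp: continuous_map_in_subtopology intro!: continuous_intros)
  then have c: "continuous_map (top_of_set ?S) X (\<lambda>w. h (fst w))" "continuous_map (top_of_set ?S) X (\<lambda>w. k (fst w))"
    using continuous_map_compose h k(1) unfolding o_def by blast+
  have cont: "continuous_map (top_of_set ?S) X G"
    unfolding G_def
  proof (rule continuous_map_cases_le)
    show "h (fst x) = k (fst x)" if "x \<in> topspace (top_of_set ?S)" "0 = snd x" for x
    proof -
      have "(norm (fst x))\<^sup>2 = 1" using that S[of x] by simp
      then have "fst x \<in> sphere 0 1" by (simp add: power2_eq_1_iff) (metis norm_ge_zero neg_0_le_iff_le not_one_le_zero)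
      then show ?thesis using kh by simp
    qed
  qed (auto intro!: continuous_intros c continuous_map_from_subtopology)
  have himg: "h (fst w) \<in> F \<union> C" if "w \<in> ?S" for w
  proof (cases "norm (fst w) < 1")
    case True then show ?thesis using hF by auto
  next
    case False
    then have "fst w \<in> sphere 0 1" using fst1[OF that] by simp
    then show ?thesis using hC by blast
  qed
  have kimg: "k (fst w) \<in> F'" if "w \<in> ?S" "snd w < 0" for w
    using fst2[of w] that k(3) by auto
  have F'C: "F' \<inter> C = {}" using bounded_by_basics(2)[OF b'] .
  have snd_eq: "z = w" if "z \<in> ?S" "w \<in> ?S" "fst z = fst w" "0 \<le> snd z \<longleftrightarrow> 0 \<le> snd w" for z w
  proof -
    have "(snd z)\<^sup>2 = (snd w)\<^sup>2" using that S[of z] S[of w] by simp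
    then have "snd z = snd w" using that(4) by (auto simp: power2_eq_iff)
    then show ?thesis using that(3) by (simp add: prod_eq_iff)
  qed
  have inj: "inj_on G ?S"
  proof (rule inj_onI)
    fix z w assume zw: "z \<in> ?S" "w \<in> ?S" "G z = G w"
    have m: "fst z \<in> cball 0 1" "fst w \<in> cball 0 1" using fst1 zw by auto
    consider "0 \<le> snd z" "0 \<le> snd w" | "snd z < 0" "snd w < 0" | "0 \<le> snd z" "snd w < 0" | "snd z < 0" "0 \<le> snd w"
      by linarith
    then show "z = w"
    proof cases
      case 1 then show ?thesis using zw m hi snd_eq[of z w] by (auto simp: G_def dest: inj_onD)
    next
      case 2 then show ?thesis using zw m k(2) snd_eq[of z w] by (auto simp: G_def dest: inj_onD)
    next
      case 3 then show ?thesis using zw himg[of z] kimg[of w] disj F'C by (auto simp: G_def)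
    next
      case 4 then show ?thesis using zw himg[of w] kimg[of z] disj F'C by (force simp: G_def)
    qed
  qed
  have lift: "\<exists>t. (z, t) \<in> ?S \<and> 0 \<le> t" if "norm z \<le> 1" for z :: complex
  proof -
    have "(norm z)\<^sup>2 \<le> 1" using that by (simp add: abs_square_le_1)
    then show ?thesis by (intro exI[of _ "sqrt (1 - (norm z)\<^sup>2)"]) (simp add: norm_Pair)
  qed
  have surj: "G ` ?S = topspace X"
  proof
    show "G ` ?S \<subseteq> topspace X" using cont by (auto simp: continuous_map_def)
    show "topspace X \<subseteq> G ` ?S"
    proof
      fix x assume "x \<in> topspace X"
      then have "x \<in> F \<union> C \<or> x \<in> F'" using all by blast
      then show "x \<in> G ` ?S"
      proof
        assume "x \<in> F \<union> C"
        then have "x \<in> h ` (ball 0 1 \<union> sphere 0 1)" by (simp only: image_Un hF hC)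
        then obtain z where z0: "z \<in> ball 0 1 \<union> sphere 0 1" "x = h z" by (rule imageE)
        then have z: "norm z \<le> 1" "x = h z" by auto
        obtain t where "(z, t) \<in> ?S" "0 \<le> t" using lift z(1) by blast
        then show ?thesis using z(2) by (intro image_eqI[of _ _ "(z, t)"]) (auto simp: G_def)
      next
        assume "x \<in> F'"
        then have "x \<in> k ` ball 0 1" by (simp only: k(3))
        then obtain z where z0: "z \<in> ball 0 1" "x = k z" by (rule imageE)
        then have z: "norm z < 1" "x = k z" by auto
        obtain t where t: "(z, t) \<in> ?S" "0 \<le> t" using lift[OF less_imp_le[OF z(1)]] by blast
        \<comment> \<open>Points of \<open>F'\<close> come from the open disc, so they lie off the
          equator and the mirror image has strictly negative height, as the second branch of
          \<open>G\<close> demands.\<close>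
        have "t \<noteq> 0" using t(1) z(1) S[of "(z, t)"] by (auto simp: power2_eq_1_iff)
        then show ?thesis using z(2) t S[of "(z, t)"] S[of "(z, - t)"]
          by (intro image_eqI[of _ _ "(z, - t)"]) (auto simp: G_def)
      qed
    qed
  qed
  have "homeomorphic_map (top_of_set ?S) X G"
    by (rule continuous_imp_homeomorphic_map[OF cont]) (use surj inj X in \<open>auto simp: compact_space_subtopology\<close>)
  then show ?thesis using homeomorphic_map_imp_homeomorphic_space by blast
qed

text \<open>One curve of the family already separates, by Jordan. The other curves cannot swallow a
  side: they form a closed set disjoint from \<open>c\<close>, whereas each side accumulates at
  \<open>c\<close>. In this way positive genus rules out the sphere.\<close>

lemma sphere_no_nonseparating_curve:
  assumes X: "closed_surface X" and S: "top_of_set (sphere (0 :: complex \<times> real) 1) homeomorphic_space X"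
    and ns: "nonseparating_curves X \<C>"
  shows "\<C> = {}"
proof (rule ccontr)
  assume "\<C> \<noteq> {}"
  then obtain c where c: "c \<in> \<C>" by blast
  let ?S = "sphere (0 :: complex \<times> real) 1"
  have curves: "\<And>c. c \<in> \<C> \<Longrightarrow> simple_closed_curve_in X c" and fin: "finite \<C>" and pd: "pairwise disjnt \<C>"
    and con: "connectedin X (topspace X - \<Union>\<C>)"
    using ns unfolding nonseparating_curves_def by auto
  obtain g f where fg: "homeomorphic_maps (top_of_set ?S) X g f"
    using S homeomorphic_space_def by blast
  have cX: "c \<subseteq> topspace X" and hc: "subtopology X c homeomorphic_space top_of_set (sphere (0::complex) 1)"
    using curves[OF c] unfolding simple_closed_curve_in_def by auto
  have g: "continuous_map (top_of_set ?S) X g" and f: "continuous_map X (top_of_set ?S) f"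
    and gf: "\<And>x. x \<in> topspace X \<Longrightarrow> g (f x) = x" and fg': "\<And>z. z \<in> ?S \<Longrightarrow> f (g z) = z"
    using fg unfolding homeomorphic_maps_def by auto
  have fS: "f ` topspace X \<subseteq> ?S" using f by (auto simp: continuous_map_in_subtopology)
  have gX: "g ` ?S \<subseteq> topspace X" using g by (auto simp: continuous_map_def)
  have "homeomorphic_map X (top_of_set ?S) f" using fg homeomorphic_maps_map by metis
  have fc: "f ` c \<subseteq> ?S" using cX fS by blast
  from homeomorphic_map_subtopologies[OF \<open>homeomorphic_map X _ f\<close>, of c "f ` c"]
  have "homeomorphic_map (subtopology X c) (subtopology (top_of_set ?S) (f ` c)) f"
    using Int_absorb1[OF cX] Int_absorb1[OF fc] by simp
  moreover have "subtopology (top_of_set ?S) (f ` c) = top_of_set (f ` c)"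
    by (simp add: subtopology_subtopology Int_absorb1[OF fc])
  ultimately have "subtopology X c homeomorphic_space top_of_set (f ` c)"
    using homeomorphic_map_imp_homeomorphic_space by metis
  then have "f ` c homeomorphic sphere (0::complex) 1"
    using hc homeomorphic_space_sym homeomorphic_space_trans homeomorphic_space_top_of_set by blast
  then obtain A B where A: "openin (top_of_set ?S) A" and B: "openin (top_of_set ?S) B"
    and AB: "A \<inter> B = {}" "A \<union> B = ?S - f ` c" and cl: "f ` c \<subseteq> closure A" "f ` c \<subseteq> closure B"
    using Jordan_curve_sphere[of "f ` c"] fc by auto
  define R where "R = \<Union>(\<C> - {c})"
  have cne: "c \<noteq> {}"
  proof
    assume "c = {}"
    then have "f ` c = {}" by simp
    then show False using \<open>f ` c homeomorphic sphere (0::complex) 1\<close> homeomorphic_empty by fastforce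
  qed
  have clR: "closedin X R"
    unfolding R_def
  proof (rule closedin_Union)
    fix d assume "d \<in> \<C> - {c}"
    then have d: "d \<subseteq> topspace X" "subtopology X d homeomorphic_space top_of_set (sphere (0::complex) 1)"
      using curves unfolding simple_closed_curve_in_def by auto
    have "compact_space (subtopology X d)"
      using homeomorphic_compact_space[OF d(2)] by (simp add: compact_space_subtopology)
    then have "compactin X d" using d(1) compactin_subspace by blast
    then show "closedin X d" using compactin_imp_closedin closed_surface_Hausdorff[OF X] by blast
  qed (use fin in auto)
  have cR: "c \<inter> R = {}" using pd c unfolding R_def pairwise_def disjnt_def by blast
  \<comment> \<open>The preimage of one side, with the remaining curves taken out.\<close>
  define P where "P T = {x \<in> topspace X. f x \<in> T} - R" for T
  have op: "openin X (P T)" if "openin (top_of_set ?S) T" for T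
    unfolding P_def using openin_continuous_map_preimage[OF f that] clR openin_diff by blast
  have ne: "P T \<noteq> {}" if T: "openin (top_of_set ?S) T" "f ` c \<subseteq> closure T" for T
  proof
    assume e: "P T = {}"
    have TS: "T \<subseteq> ?S" using T(1) openin_imp_subset by blast
    have "g ` T \<subseteq> R"
      using e TS gX fg' unfolding P_def by (fastforce simp: image_subset_iff subset_iff)
    have "f ` R \<subseteq> ?S" using clR closedin_subset fS by fastforce
    have "compactin X R" using clR X closedin_compact_space[of X R] by (simp add: closed_surface_def)
    then have "compactin (top_of_set ?S) (f ` R)" using image_compactin[OF _ f] by simp
    then have "compact (f ` R)" by (simp add: compactin_subtopology)
    then have "closed (f ` R)" by (rule compact_imp_closed)
    moreover have "T \<subseteq> f ` R"
    proof
      fix t assume t: "t \<in> T"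
      have "f (g t) \<in> f ` R" by (intro imageI subsetD[OF \<open>g ` T \<subseteq> R\<close>] t)
      then show "t \<in> f ` R" using fg'[OF subsetD[OF TS t]] by simp
    qed
    ultimately have "f ` c \<subseteq> f ` R" by (intro order_trans[OF T(2) closure_minimal])
    then have fcR: "\<And>x. x \<in> c \<Longrightarrow> f x \<in> f ` R" by blast
    have "c \<subseteq> R"
    proof
      fix x assume x: "x \<in> c"
      then obtain r where r: "r \<in> R" "f x = f r" using fcR by blast
      have "r \<in> topspace X" using r(1) closedin_subset[OF clR] by blast
      then have "x = r" using gf r(2) x cX by (metis subsetD)
      then show "x \<in> R" using r(1) by simp
    qed
    then show False using cR cne by blast
  qed
  have eq: "P A \<union> P B = topspace X - \<Union>\<C>"
  proof -
    have "\<Union>\<C> = c \<union> R" using c unfolding R_def by blast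
    moreover have "f x \<in> f ` c \<longleftrightarrow> x \<in> c" if "x \<in> topspace X" for x
      using that gf cX by (metis image_iff subset_iff)
    moreover have "f x \<in> A \<union> B \<longleftrightarrow> f x \<notin> f ` c" if "x \<in> topspace X" for x
      using that fS unfolding AB(2) by blast
    ultimately have "x \<in> P A \<union> P B \<longleftrightarrow> x \<in> topspace X - \<Union>\<C>" for x
      unfolding P_def Un_iff Diff_iff mem_Collect_eq by blast
    then show ?thesis by blast
  qed
  have "P A \<inter> P B = {}" using AB(1) by (auto simp: P_def)
  then show False
    using connectedinD[OF con op[OF A] op[OF B]] eq ne[OF A cl(1)] ne[OF B cl(2)] by auto
qed

section \<open>Moebius bands\<close>

abbreviation (input) unit_square :: "(real \<times> real) set" where
  "unit_square \<equiv> {0..1} \<times> {0..1}"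

lemma interior_unit_square: "interior unit_square = {0<..<1} \<times> {0<..<1}"
  by (simp add: interior_Times)

lemma frontier_unit_square:
  "z \<in> frontier unit_square \<longleftrightarrow>
     (fst z = 0 \<or> fst z = 1) \<and> snd z \<in> {0..1} \<or> (snd z = 0 \<or> snd z = 1) \<and> fst z \<in> {0..1}"
proof -
  have "frontier unit_square = unit_square - {0<..<1} \<times> {0<..<1}"
    unfolding frontier_def interior_unit_square by (simp add: closure_Times)
  then show ?thesis by (cases z) auto
qed

text \<open>Continuity of the boundary map of a square is checked by closed preimages; this is the
  contribution of one side \<open>e\<close>.\<close>

lemma closed_image_pathin_preimage:
  fixes e :: "real \<Rightarrow> 'b::t2_space"
  assumes "pathin X p" "closedin X K" "continuous_on {0..1} e"
  shows "closed (e ` {y\<in>{0..1}. p y \<in> K})"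
proof -
  have "closedin (top_of_set {0..1}) {y\<in>{0..1}. p y \<in> K}"
    using closedin_continuous_map_preimage[of "top_of_set {0..1}" X p K] assms(1,2) by (simp add: pathin_def)
  then have "compact {y\<in>{0..1}. p y \<in> K}" using closedin_compact compact_Icc by blast
  then have "compact (e ` {y\<in>{0..1}. p y \<in> K})"
    using assms(3) by (intro compact_continuous_image) (auto intro: continuous_on_subset)
  then show ?thesis by (rule compact_imp_closed)
qed

text \<open>The analogue of the half lens with a square as model, since the Moebius band is defined
  as a quotient of the square. The corner equations fix the directions of the paths: left and right
  side upwards, bottom and top to the right.\<close>

lemma bounded_by_unit_square:
  assumes X: "Hausdorff_space X"
    and b: "bounded_by X F (l ` {0..1} \<union> t ` {0..1} \<union> r ` {0..1} \<union> b ` {0..1})"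
    and path: "pathin X l" "pathin X t" "pathin X r" "pathin X b"
    and inj: "inj_on l {0..1}" "inj_on t {0..1}" "inj_on r {0..1}" "inj_on b {0..1}"
    and corner: "l 0 = b 0" "l 1 = t 0" "r 0 = b 1" "r 1 = t 1"
    and lr: "l ` {0..1} \<inter> r ` {0..1} = {}" and tb: "t ` {0..1} \<inter> b ` {0..1} = {}"
    and adj: "l ` {0..1} \<inter> t ` {0..1} = {l 1}" "l ` {0..1} \<inter> b ` {0..1} = {l 0}"
       "r ` {0..1} \<inter> t ` {0..1} = {r 1}" "r ` {0..1} \<inter> b ` {0..1} = {r 0}"
  obtains k where "continuous_map (top_of_set unit_square) X k" "inj_on k unit_square"
    "k ` interior unit_square = F"
    "\<And>y. y \<in> {0..1} \<Longrightarrow> k (0, y) = l y" "\<And>y. y \<in> {0..1} \<Longrightarrow> k (1, y) = r y"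
    "\<And>x. x \<in> {0..1} \<Longrightarrow> k (x, 0) = b x" "\<And>x. x \<in> {0..1} \<Longrightarrow> k (x, 1) = t x"
proof -
  let ?fr = "frontier unit_square"
  \<comment> \<open>At a corner two sides compete, and \<open>corner\<close> makes both candidates
    equal.\<close>
  define \<psi> where "\<psi> z = (if fst z = 0 then l (snd z) else if fst z = 1 then r (snd z)
     else if snd z = 1 then t (fst z) else b (fst z))" for z :: "real \<times> real"
  have \<psi>: "\<psi> (0, y) = l y" "\<psi> (1, y) = r y" "\<psi> (y, 0) = b y" "\<psi> (y, 1) = t y" for y
    using corner by (auto simp: \<psi>_def)
  have meet: "p s = p u \<and> q v = p u" if "p ` {0..1} \<inter> q ` {0..1} = {p u}" "s \<in> {0..1}" "v \<in> {0..1}" "p s = q v"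
    for p q :: "real \<Rightarrow> 'a" and s u v
    using that by (metis IntI imageI singletonD)
  have m: "\<And>s v. s \<in> {0..1} \<Longrightarrow> v \<in> {0..1} \<Longrightarrow> l s = t v \<Longrightarrow> s = 1 \<and> v = 0"
    "\<And>s v. s \<in> {0..1} \<Longrightarrow> v \<in> {0..1} \<Longrightarrow> l s = b v \<Longrightarrow> s = 0 \<and> v = 0"
    "\<And>s v. s \<in> {0..1} \<Longrightarrow> v \<in> {0..1} \<Longrightarrow> r s = t v \<Longrightarrow> s = 1 \<and> v = 1"
    "\<And>s v. s \<in> {0..1} \<Longrightarrow> v \<in> {0..1} \<Longrightarrow> r s = b v \<Longrightarrow> s = 0 \<and> v = 1"
    subgoal for s v using meet[OF adj(1), of s v] inj_onD[OF inj(1), of s 1] inj_onD[OF inj(2), of v 0] corner by auto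
    subgoal for s v using meet[OF adj(2), of s v] inj_onD[OF inj(1), of s 0] inj_onD[OF inj(4), of v 0] corner by auto
    subgoal for s v using meet[OF adj(3), of s v] inj_onD[OF inj(3), of s 1] inj_onD[OF inj(2), of v 1] corner by auto
    subgoal for s v using meet[OF adj(4), of s v] inj_onD[OF inj(3), of s 0] inj_onD[OF inj(4), of v 1] corner by auto
    done
  have n: "\<And>s v. s \<in> {0..1} \<Longrightarrow> v \<in> {0..1} \<Longrightarrow> l s \<noteq> r v" "\<And>s v. s \<in> {0..1} \<Longrightarrow> v \<in> {0..1} \<Longrightarrow> t s \<noteq> b v"
    using lr tb by (metis IntI empty_iff imageI)+
  have frE: "\<exists>y\<in>{0..1}. z = (0, y) \<or> z = (1, y) \<or> z = (y, 0) \<or> z = (y, 1)" if "z \<in> ?fr" for z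
    using that unfolding frontier_unit_square by (cases z) auto
  have frI: "(0, y) \<in> ?fr" "(1, y) \<in> ?fr" "(y, 0) \<in> ?fr" "(y, 1) \<in> ?fr" if "y \<in> {0..1}" for y
    using that by (auto simp: frontier_unit_square)
  have im: "\<psi> ` ?fr = l ` {0..1} \<union> t ` {0..1} \<union> r ` {0..1} \<union> b ` {0..1}"
  proof (intro equalityI subsetI)
    fix x assume "x \<in> \<psi> ` ?fr"
    then obtain z where z: "z \<in> ?fr" "x = \<psi> z" by (rule imageE)
    obtain y where y: "y \<in> {0..1}" and "z = (0, y) \<or> z = (1, y) \<or> z = (y, 0) \<or> z = (y, 1)"
      using frE[OF z(1)] by blast
    then have "x = l y \<or> x = r y \<or> x = b y \<or> x = t y" using z(2) \<psi> by auto
    then show "x \<in> l ` {0..1} \<union> t ` {0..1} \<union> r ` {0..1} \<union> b ` {0..1}" using y by auto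
  next
    fix x assume x: "x \<in> l ` {0..1} \<union> t ` {0..1} \<union> r ` {0..1} \<union> b ` {0..1}"
    have "l y \<in> \<psi> ` ?fr" "r y \<in> \<psi> ` ?fr" "b y \<in> \<psi> ` ?fr" "t y \<in> \<psi> ` ?fr" if "y \<in> {0..1}" for y
      using frI[OF that, THEN imageI[of _ _ \<psi>]] by (simp_all only: \<psi>)
    then show "x \<in> \<psi> ` ?fr" using x by auto
  qed
  have pt: "l ` {0..1} \<union> t ` {0..1} \<union> r ` {0..1} \<union> b ` {0..1} \<subseteq> topspace X"
    using bounded_by_basics(4)[OF b] .
  have cont: "continuous_map (top_of_set ?fr) X \<psi>"
  proof (unfold continuous_map_closedin, intro conjI allI impI)
    show "\<psi> \<in> topspace (top_of_set ?fr) \<rightarrow> topspace X"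
      unfolding topspace_euclidean_subtopology image_subset_iff_funcset[symmetric] im by (rule pt)
    fix K assume K: "closedin X K"
    let ?P = "\<lambda>p e. e ` {y\<in>{0..1}. p y \<in> K}"
    have eq: "{z \<in> ?fr. \<psi> z \<in> K} = ?P l (\<lambda>y. (0, y)) \<union> ?P r (\<lambda>y. (1, y)) \<union> ?P b (\<lambda>y. (y, 0)) \<union> ?P t (\<lambda>y. (y, 1))"
      (is "?L = ?R")
    proof (intro equalityI subsetI)
      fix z assume z: "z \<in> ?L"
      then obtain y where y: "y \<in> {0..1}" and "z = (0, y) \<or> z = (1, y) \<or> z = (y, 0) \<or> z = (y, 1)" using frE by blast
      then show "z \<in> ?R" using z by (elim disjE) (auto simp: \<psi>)
    next
      fix z assume "z \<in> ?R"
      then show "z \<in> ?L" using frI by (auto simp: \<psi>)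
    qed
    have "closed ?R"
      by (intro closed_Un closed_image_pathin_preimage[OF _ K] path continuous_intros)
    then show "closedin (top_of_set ?fr) {x \<in> topspace (top_of_set ?fr). \<psi> x \<in> K}"
      using eq by (intro closed_subset) auto
  qed
  have inj\<psi>: "inj_on \<psi> ?fr"
  proof (rule inj_onI)
    fix z w assume zw: "z \<in> ?fr" "w \<in> ?fr" "\<psi> z = \<psi> w"
    obtain s where s: "s \<in> {0..1}" "z = (0, s) \<or> z = (1, s) \<or> z = (s, 0) \<or> z = (s, 1)" using frE[OF zw(1)] by blast
    obtain v where v: "v \<in> {0..1}" "w = (0, v) \<or> w = (1, v) \<or> w = (v, 0) \<or> w = (v, 1)" using frE[OF zw(2)] by blast
    have io: "l s = l v \<longrightarrow> s = v" "t s = t v \<longrightarrow> s = v" "r s = r v \<longrightarrow> s = v" "b s = b v \<longrightarrow> s = v"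
      using inj s(1) v(1) unfolding inj_on_def by blast+
    have mm: "l s = t v \<longrightarrow> s = 1 \<and> v = 0" "l s = b v \<longrightarrow> s = 0 \<and> v = 0"
      "r s = t v \<longrightarrow> s = 1 \<and> v = 1" "r s = b v \<longrightarrow> s = 0 \<and> v = 1"
      "l v = t s \<longrightarrow> v = 1 \<and> s = 0" "l v = b s \<longrightarrow> v = 0 \<and> s = 0"
      "r v = t s \<longrightarrow> v = 1 \<and> s = 1" "r v = b s \<longrightarrow> v = 0 \<and> s = 1"
      using m[OF s(1) v(1)] m[OF v(1) s(1)] by iprover+
    have nn: "l s \<noteq> r v" "t s \<noteq> b v" "l v \<noteq> r s" "t v \<noteq> b s"
      using n[OF s(1) v(1)] n[OF v(1) s(1)] by iprover+
    \<comment> \<open>One case for each pair of sides: equal sides use injectivity, adjacent ones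
      the shared corner, opposite ones disjointness.\<close>
    from s(2) show "z = w"
    proof (elim disjE)
      assume z: "z = (0, s)"
      from v(2) show ?thesis
        apply (elim disjE)
        subgoal premises h using zw(3)[unfolded z h \<psi>] io mm nn unfolding z h prod.inject by metis
        subgoal premises h using zw(3)[unfolded z h \<psi>] io mm nn unfolding z h prod.inject by metis
        subgoal premises h using zw(3)[unfolded z h \<psi>] io mm nn unfolding z h prod.inject by metis
        subgoal premises h using zw(3)[unfolded z h \<psi>] io mm nn unfolding z h prod.inject by metis
        done
    next
      assume z: "z = (1, s)"
      from v(2) show ?thesis
        apply (elim disjE)
        subgoal premises h using zw(3)[unfolded z h \<psi>] io mm nn unfolding z h prod.inject by metis
        subgoal premises h using zw(3)[unfolded z h \<psi>] io mm nn unfolding z h prod.inject by metis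
        subgoal premises h using zw(3)[unfolded z h \<psi>] io mm nn unfolding z h prod.inject by metis
        subgoal premises h using zw(3)[unfolded z h \<psi>] io mm nn unfolding z h prod.inject by metis
        done
    next
      assume z: "z = (s, 0)"
      from v(2) show ?thesis
        apply (elim disjE)
        subgoal premises h using zw(3)[unfolded z h \<psi>] io mm nn unfolding z h prod.inject by metis
        subgoal premises h using zw(3)[unfolded z h \<psi>] io mm nn unfolding z h prod.inject by metis
        subgoal premises h using zw(3)[unfolded z h \<psi>] io mm nn unfolding z h prod.inject by metis
        subgoal premises h using zw(3)[unfolded z h \<psi>] io mm nn unfolding z h prod.inject by metis
        done
    next
      assume z: "z = (s, 1)"
      from v(2) show ?thesis
        apply (elim disjE)
        subgoal premises h using zw(3)[unfolded z h \<psi>] io mm nn unfolding z h prod.inject by metis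
        subgoal premises h using zw(3)[unfolded z h \<psi>] io mm nn unfolding z h prod.inject by metis
        subgoal premises h using zw(3)[unfolded z h \<psi>] io mm nn unfolding z h prod.inject by metis
        subgoal premises h using zw(3)[unfolded z h \<psi>] io mm nn unfolding z h prod.inject by metis
        done
    qed
  qed
  obtain k where k: "continuous_map (top_of_set unit_square) X k" "inj_on k unit_square"
    "k ` interior unit_square = F" "\<And>x. x \<in> ?fr \<Longrightarrow> k x = \<psi> x"
  proof (rule bounded_by_extend_parametrization[OF X b _ _ _ _ cont inj\<psi> im])
    show "convex unit_square" "compact unit_square" by (simp_all add: convex_Times compact_Times)
    show "interior unit_square \<noteq> {}" unfolding interior_unit_square by auto
  qed auto
  show ?thesis
    by (rule that[OF k(1-3)]) (simp_all add: k(4) frI \<psi>)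
qed

text \<open>The square is cut by a vertical middle line: \<open>F\<close> fills the left half, from
  \<open>P\<close> to \<open>R\<close>, and \<open>F'\<close> the right half, from \<open>R\<close>
  back to \<open>P\<close>, but with \<open>P\<close> run downwards. The twist shows in
  \<open>T'\<close> leading from \<open>r1\<close> to \<open>p0\<close> and \<open>B'\<close> from
  \<open>r0\<close> to \<open>p1\<close>.\<close>

lemma moebius_band_from_two_discs:
  assumes H: "Hausdorff_space X"
    and b: "bounded_by X F (P \<union> T \<union> R \<union> B)" and b': "bounded_by X F' (R \<union> T' \<union> P \<union> B')"
    and P: "arc_joining X p0 p1 P" and R: "arc_joining X r0 r1 R"
    and T: "arc_joining X p1 r1 T" and B: "arc_joining X p0 r0 B"
    and T': "arc_joining X r1 p0 T'" and B': "arc_joining X r0 p1 B'"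
    and PR: "P \<inter> R = {}" and TB: "T \<inter> B = {}" "T' \<inter> B' = {}"
    and corners: "P \<inter> T = {p1}" "P \<inter> B = {p0}" "R \<inter> T = {r1}" "R \<inter> B = {r0}"
       "R \<inter> T' = {r1}" "R \<inter> B' = {r0}" "P \<inter> T' = {p0}" "P \<inter> B' = {p1}"
    and FF: "F \<inter> F' = {}" "F \<inter> (T' \<union> B') = {}" "F' \<inter> (T \<union> B) = {}"
    and TT: "(T \<union> B) \<inter> (T' \<union> B') = {p0, p1, r0, r1}"
  shows "\<exists>S\<subseteq>topspace X. moebius_band (subtopology X S)"
proof -
  obtain p where p: "pathin X p" "inj_on p {0..1}" "p 0 = p0" "p 1 = p1" "p ` {0..1} = P"
    using P unfolding arc_joining_def by blast
  obtain r where r: "pathin X r" "inj_on r {0..1}" "r 0 = r0" "r 1 = r1" "r ` {0..1} = R"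
    using R unfolding arc_joining_def by blast
  obtain t where t: "pathin X t" "inj_on t {0..1}" "t 0 = p1" "t 1 = r1" "t ` {0..1} = T"
    using T unfolding arc_joining_def by blast
  obtain bb where bb: "pathin X bb" "inj_on bb {0..1}" "bb 0 = p0" "bb 1 = r0" "bb ` {0..1} = B"
    using B unfolding arc_joining_def by blast
  obtain t' where t': "pathin X t'" "inj_on t' {0..1}" "t' 0 = r1" "t' 1 = p0" "t' ` {0..1} = T'"
    using T' unfolding arc_joining_def by blast
  obtain bb' where bb': "pathin X bb'" "inj_on bb' {0..1}" "bb' 0 = r0" "bb' 1 = p1" "bb' ` {0..1} = B'"
    using B' unfolding arc_joining_def by blast
  \<comment> \<open>The right end of the second square is \<open>P\<close> reversed, so height
    \<open>y\<close> on the left end meets height \<open>1 - y\<close> on the right one.\<close>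
  define pr where "pr = (\<lambda>y. p (1 - y))"
  have pr: "pathin X pr" "inj_on pr {0..1}" "pr 0 = p1" "pr 1 = p0" "pr ` {0..1} = P"
  proof -
    have im: "(\<lambda>t. 1 - t) ` {0..1} = {0..1::real}"
      by (auto simp: image_iff intro!: bexI[of _ "1 - _"])
    have "continuous_map (top_of_set {0..1}) (top_of_set {0..1::real}) (\<lambda>t. 1 - t)"
      by (auto simp: continuous_map_in_subtopology intro!: continuous_intros)
    from continuous_map_compose[OF this] show "pathin X pr"
      using p(1) by (simp add: pathin_def pr_def o_def)
    show "inj_on pr {0..1}"
    proof (rule inj_onI)
      fix x y assume "x \<in> {0..1}" "y \<in> {0..1}" "pr x = pr y"
      then have "1 - x = 1 - y" by (intro inj_onD[OF p(2)]) (auto simp: pr_def)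
      then show "x = y" by simp
    qed
    show "pr 0 = p1" "pr 1 = p0" using p by (auto simp: pr_def)
    have "pr ` {0..1} = p ` (\<lambda>t. 1 - t) ` {0..1}" unfolding pr_def image_image ..
    then show "pr ` {0..1} = P" using im p(5) by simp
  qed
  obtain k where k: "continuous_map (top_of_set unit_square) X k" "inj_on k unit_square"
    "k ` interior unit_square = F"
    "\<And>y. y \<in> {0..1} \<Longrightarrow> k (0, y) = p y" "\<And>y. y \<in> {0..1} \<Longrightarrow> k (1, y) = r y"
    "\<And>x. x \<in> {0..1} \<Longrightarrow> k (x, 0) = bb x" "\<And>x. x \<in> {0..1} \<Longrightarrow> k (x, 1) = t x"
  proof (rule bounded_by_unit_square[OF H, of F p t r bb])
    show "bounded_by X F (p ` {0..1} \<union> t ` {0..1} \<union> r ` {0..1} \<union> bb ` {0..1})"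
      using b p(5) t(5) r(5) bb(5) by simp
  qed (use PR TB corners in \<open>simp_all add: p r t bb Int_commute\<close>)
  obtain k' where k': "continuous_map (top_of_set unit_square) X k'" "inj_on k' unit_square"
    "k' ` interior unit_square = F'"
    "\<And>y. y \<in> {0..1} \<Longrightarrow> k' (0, y) = r y" "\<And>y. y \<in> {0..1} \<Longrightarrow> k' (1, y) = pr y"
    "\<And>x. x \<in> {0..1} \<Longrightarrow> k' (x, 0) = bb' x" "\<And>x. x \<in> {0..1} \<Longrightarrow> k' (x, 1) = t' x"
  proof (rule bounded_by_unit_square[OF H, of F' r t' pr bb'])
    show "bounded_by X F' (r ` {0..1} \<union> t' ` {0..1} \<union> pr ` {0..1} \<union> bb' ` {0..1})"
      using b' pr(5) t'(5) r(5) bb'(5) by simp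
  qed (use PR TB corners in \<open>simp_all add: pr r t' bb' Int_commute\<close>)
  \<comment> \<open>Both squares are compressed to half width and laid side by side, with
    \<open>R\<close> as the seam.\<close>
  define q where "q z = (if fst z \<le> 1/2 then k (2 * fst z, snd z) else k' (2 * fst z - 1, snd z))" for z :: "real \<times> real"
  have cont: "continuous_map (top_of_set unit_square) X q"
    unfolding q_def
  proof (rule continuous_map_cases_le)
    have "continuous_map (top_of_set (unit_square \<inter> {z. fst z \<le> 1/2})) (top_of_set unit_square) (\<lambda>z. (2 * fst z, snd z))"
      by (auto simp: continuous_map_in_subtopology intro!: continuous_intros)
    from continuous_map_compose[OF this k(1)]
    show "continuous_map (subtopology (top_of_set unit_square) {x \<in> topspace (top_of_set unit_square). fst x \<le> 1/2}) X (\<lambda>z. k (2 * fst z, snd z))"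
      by (simp add: subtopology_subtopology Int_def o_def)
    have "continuous_map (top_of_set (unit_square \<inter> {z. 1/2 \<le> fst z})) (top_of_set unit_square) (\<lambda>z. (2 * fst z - 1, snd z))"
      by (auto simp: continuous_map_in_subtopology intro!: continuous_intros)
    from continuous_map_compose[OF this k'(1)]
    show "continuous_map (subtopology (top_of_set unit_square) {x \<in> topspace (top_of_set unit_square). 1/2 \<le> fst x}) X (\<lambda>z. k' (2 * fst z - 1, snd z))"
      by (simp add: subtopology_subtopology Int_def o_def)
    show "k (2 * fst x, snd x) = k' (2 * fst x - 1, snd x)" if "x \<in> topspace (top_of_set unit_square)" "fst x = 1/2" for x
    proof -
      have "snd x \<in> {0..1}" using that by auto
      then show ?thesis unfolding that(2) using k(5) k'(4) by simp
    qed
  qed (auto intro!: continuous_intros)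
  have rng: "z \<in> interior unit_square \<or> fst z = 0 \<or> fst z = 1 \<or> snd z = 0 \<or> snd z = 1"
    if "z \<in> unit_square" for z
    using that unfolding interior_unit_square by (cases z) auto
  have kim: "k z \<in> F \<and> z \<in> interior unit_square \<or> k z \<in> P \<and> fst z = 0 \<or> k z \<in> R \<and> fst z = 1 \<or> k z \<in> B \<and> snd z = 0 \<or> k z \<in> T \<and> snd z = 1"
    if z: "z \<in> unit_square" for z
  proof -
    obtain x y where xy: "z = (x, y)" "x \<in> {0..1}" "y \<in> {0..1}" using z by blast
    show ?thesis using rng[OF z]
    proof (elim disjE)
      assume "z \<in> interior unit_square"
      then show ?thesis using k(3) by blast
    next
      assume "fst z = 0"
      moreover from this have "k z \<in> P" using k(4)[OF xy(3)] p(5) xy by auto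
      ultimately show ?thesis by blast
    next
      assume "fst z = 1"
      moreover from this have "k z \<in> R" using k(5)[OF xy(3)] r(5) xy by auto
      ultimately show ?thesis by blast
    next
      assume "snd z = 0"
      moreover from this have "k z \<in> B" using k(6)[OF xy(2)] bb(5) xy by auto
      ultimately show ?thesis by blast
    next
      assume "snd z = 1"
      moreover from this have "k z \<in> T" using k(7)[OF xy(2)] t(5) xy by auto
      ultimately show ?thesis by blast
    qed
  qed
  have k'im: "k' z \<in> F' \<and> z \<in> interior unit_square \<or> k' z \<in> R \<and> fst z = 0 \<or> k' z \<in> P \<and> fst z = 1 \<or> k' z \<in> B' \<and> snd z = 0 \<or> k' z \<in> T' \<and> snd z = 1"
    if z: "z \<in> unit_square" for z
  proof -
    obtain x y where xy: "z = (x, y)" "x \<in> {0..1}" "y \<in> {0..1}" using z by blast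
    show ?thesis using rng[OF z]
    proof (elim disjE)
      assume "z \<in> interior unit_square"
      then show ?thesis using k'(3) by blast
    next
      assume "fst z = 0"
      moreover from this have "k' z \<in> R" using k'(4)[OF xy(3)] r(5) xy by auto
      ultimately show ?thesis by blast
    next
      assume "fst z = 1"
      moreover from this have "k' z \<in> P" using k'(5)[OF xy(3)] pr(5) xy by auto
      ultimately show ?thesis by blast
    next
      assume "snd z = 0"
      moreover from this have "k' z \<in> B'" using k'(6)[OF xy(2)] bb'(5) xy by auto
      ultimately show ?thesis by blast
    next
      assume "snd z = 1"
      moreover from this have "k' z \<in> T'" using k'(7)[OF xy(2)] t'(5) xy by auto
      ultimately show ?thesis by blast
    qed
  qed
  have dF: "F \<inter> (P \<union> R \<union> T \<union> B \<union> T' \<union> B' \<union> F') = {}" "F' \<inter> (P \<union> R \<union> T \<union> B \<union> T' \<union> B' \<union> F) = {}"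
    using bounded_by_basics(2)[OF b] bounded_by_basics(2)[OF b'] FF by auto
  have vert: "p0 \<in> P" "p1 \<in> P" "r0 \<in> R" "r1 \<in> R"
    using arc_joining_basics(1,2)[OF P] arc_joining_basics(1,2)[OF R] by auto
  have kP: "\<exists>y\<in>{0..1}. z = (0, y) \<and> x = p y" if h: "z \<in> unit_square" "k z = x" "x \<in> P" for z x
  proof -
    obtain y where y: "y \<in> {0..1}" "x = p y" using h(3) p(5) by blast
    then have "k z = k (0, y)" using k(4) h(2) by simp
    then have "z = (0, y)" using k(2) h(1) y(1) by (auto dest: inj_onD)
    then show ?thesis using y by blast
  qed
  have kR: "\<exists>y\<in>{0..1}. z = (1, y) \<and> x = r y" if h: "z \<in> unit_square" "k z = x" "x \<in> R" for z x
  proof -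
    obtain y where y: "y \<in> {0..1}" "x = r y" using h(3) r(5) by blast
    then have "k z = k (1, y)" using k(5) h(2) by simp
    then have "z = (1, y)" using k(2) h(1) y(1) by (auto dest: inj_onD)
    then show ?thesis using y by blast
  qed
  have k'P: "\<exists>y\<in>{0..1}. z = (1, 1 - y) \<and> x = p y" if h: "z \<in> unit_square" "k' z = x" "x \<in> P" for z x
  proof -
    obtain y where y: "y \<in> {0..1}" "x = p y" using h(3) p(5) by blast
    then have "k' z = k' (1, 1 - y)" using k'(5)[of "1 - y"] h(2) by (simp add: pr_def)
    then have "z = (1, 1 - y)" using k'(2) h(1) y(1) by (auto dest: inj_onD)
    then show ?thesis using y by blast
  qed
  have k'R: "\<exists>y\<in>{0..1}. z = (0, y) \<and> x = r y" if h: "z \<in> unit_square" "k' z = x" "x \<in> R" for z x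
  proof -
    obtain y where y: "y \<in> {0..1}" "x = r y" using h(3) r(5) by blast
    then have "k' z = k' (0, y)" using k'(4) h(2) by simp
    then have "z = (0, y)" using k'(2) h(1) y(1) by (auto dest: inj_onD)
    then show ?thesis using y by blast
  qed
  have cross: "\<exists>y\<in>{0..1}. z = (0, y) \<and> w = (1, 1 - y) \<or> z = (1, y) \<and> w = (0, y)"
    if zw: "z \<in> unit_square" "w \<in> unit_square" "k z = k' w" for z w
  proof -
    \<comment> \<open>Outer sides of the two squares meet at most in the four corners, and these lie
      on \<open>P\<close> or \<open>R\<close>.\<close>
    have "k z \<in> P \<or> k z \<in> R"
      using kim[OF zw(1)] k'im[OF zw(2)] zw(3) dF TT vert by auto
    then show ?thesis
    proof
      assume a: "k z \<in> P"
      obtain y where y: "y \<in> {0..1}" "z = (0, y)" "k z = p y" using kP[OF zw(1) refl a] by blast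
      obtain y' where y': "y' \<in> {0..1}" "w = (1, 1 - y')" "k z = p y'" using k'P[OF zw(2) zw(3)[symmetric] a] by blast
      have "y = y'" using y y' p(2) by (auto dest: inj_onD)
      then show ?thesis using y y' by blast
    next
      assume a: "k z \<in> R"
      obtain y where y: "y \<in> {0..1}" "z = (1, y)" "k z = r y" using kR[OF zw(1) refl a] by blast
      obtain y' where y': "y' \<in> {0..1}" "w = (0, y')" "k z = r y'" using k'R[OF zw(2) zw(3)[symmetric] a] by blast
      have "y = y'" using y y' r(2) by (auto dest: inj_onD)
      then show ?thesis using y y' by blast
    qed
  qed
  have ends: "q (0, y) = q (1, 1 - y)" if "y \<in> {0..1}" for y
    using that k(4)[of y] k'(5)[of "1 - y"] by (simp add: q_def pr_def)
  have tI: "s \<in> {0..1}" if "(0, s) \<in> unit_square \<or> (1, s) \<in> unit_square" for s :: real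
    using that by auto
  \<comment> \<open>The strict inequality assigns the seam to the left square, so only the two outer
    ends can be identified.\<close>
  have sep: "z = (0, snd z) \<and> w = (1, 1 - snd z)" if zw: "z \<in> unit_square" "w \<in> unit_square" "q z = q w" "fst z \<le> 1/2" "1/2 < fst w" for z w
  proof -
    have "k (2 * fst z, snd z) = k' (2 * fst w - 1, snd w)" using zw by (simp add: q_def)
    from cross[OF _ _ this] zw
    obtain y where "2 * fst z = 0 \<and> snd z = y \<and> 2 * fst w - 1 = 1 \<and> snd w = 1 - y
      \<or> 2 * fst z = 1 \<and> snd z = y \<and> 2 * fst w - 1 = 0 \<and> snd w = y" by auto
    then have "fst z = 0 \<and> snd z = y \<and> fst w = 1 \<and> snd w = 1 - y" using zw(5) by auto
    then show ?thesis by (metis prod.collapse)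
  qed
  have main: "q z = q w \<longleftrightarrow> z = w \<or> (\<exists>t. (z = (0, t) \<and> w = (1, 1 - t)) \<or> (w = (0, t) \<and> z = (1, 1 - t)))"
    if zw: "z \<in> unit_square" "w \<in> unit_square" for z w
  proof
    assume e: "q z = q w"
    consider "fst z \<le> 1/2" "fst w \<le> 1/2" | "1/2 < fst z" "1/2 < fst w" | "fst z \<le> 1/2" "1/2 < fst w" | "1/2 < fst z" "fst w \<le> 1/2"
      by linarith
    then show "z = w \<or> (\<exists>t. (z = (0, t) \<and> w = (1, 1 - t)) \<or> (w = (0, t) \<and> z = (1, 1 - t)))"
    proof cases
      case 1
      then have "k (2 * fst z, snd z) = k (2 * fst w, snd w)" using e by (simp add: q_def)
      then have "(2 * fst z, snd z) = (2 * fst w, snd w)" using 1 zw by (intro inj_onD[OF k(2)]) auto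
      then show ?thesis by (simp add: prod_eq_iff)
    next
      case 2
      then have "k' (2 * fst z - 1, snd z) = k' (2 * fst w - 1, snd w)" using e by (simp add: q_def)
      then have "(2 * fst z - 1, snd z) = (2 * fst w - 1, snd w)" using 2 zw by (intro inj_onD[OF k'(2)]) auto
      then show ?thesis by (simp add: prod_eq_iff)
    next
      case 3 then show ?thesis using sep[OF zw e] by blast
    next
      case 4 then show ?thesis using sep[OF zw(2,1) e[symmetric]] by blast
    qed
  next
    assume "z = w \<or> (\<exists>t. (z = (0, t) \<and> w = (1, 1 - t)) \<or> (w = (0, t) \<and> z = (1, 1 - t)))"
    then show "q z = q w" using ends tI zw by metis
  qed
  have sub: "q ` unit_square \<subseteq> topspace X" using cont by (auto simp: continuous_map_def)
  have "quotient_map (top_of_set unit_square) (subtopology X (q ` unit_square)) q"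
  proof (rule continuous_imp_quotient_map)
    show "continuous_map (top_of_set unit_square) (subtopology X (q ` unit_square)) q"
      using cont by (simp add: continuous_map_in_subtopology)
    show "compact_space (top_of_set unit_square)" by (simp add: compact_space_subtopology compact_Times)
    show "Hausdorff_space (subtopology X (q ` unit_square))" using H Hausdorff_space_subtopology by blast
    show "q ` topspace (top_of_set unit_square) = topspace (subtopology X (q ` unit_square))"
      using sub by (simp add: Int_absorb1)
  qed
  then have "moebius_band (subtopology X (q ` unit_square))"
    unfolding moebius_band_def using main by blast
  then show ?thesis using sub by blast
qed

section \<open>Faces of a quadrangulation\<close>

text \<open>The complement of each piece is open as well, so a connected set cannot leave its piece.
  Faces are identified in this way after the deletion of a vertex and for the cube.\<close>

lemma connected_components_of_open_partition:
  assumes un: "\<Union>P = topspace Y" and C: "\<And>C. C \<in> P \<Longrightarrow> C \<noteq> {} \<and> openin Y C \<and> connectedin Y C"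
    and disj: "pairwise disjnt P"
  shows "connected_components_of Y = P"
proof -
  have sub: "C \<in> connected_components_of Y" if "C \<in> P" for C
  proof -
    obtain x where x: "x \<in> C" using C \<open>C \<in> P\<close> by blast
    have xY: "x \<in> topspace Y" using un x that by blast
    define D where "D = connected_component_of_set Y x"
    have D: "D \<in> connected_components_of Y" "x \<in> D"
      using xY by (auto simp: D_def connected_components_of_def connected_component_of_refl)
    have conD: "connectedin Y D" by (simp add: D_def connectedin_connected_component_of)
    have "C \<subseteq> D" using connected_components_of_maximal[OF D(1), of C] C[OF that] D(2) x by (auto simp: disjnt_def)
    moreover have "D \<subseteq> C"
    proof (rule ccontr)
      assume nD: "\<not> D \<subseteq> C"
      let ?R = "\<Union>(P - {C})"
      have o: "openin Y ?R" using C by (intro openin_Union) auto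
      have CR: "C \<inter> ?R = {}" using disj that unfolding pairwise_def disjnt_def by blast
      have DS: "D \<subseteq> C \<union> ?R" using connectedin_subset_topspace[OF conD] un by blast
      obtain y where "y \<in> D" "y \<notin> C" using nD by blast
      then have "?R \<inter> D \<noteq> {}" using DS by blast
      then show False
        using connectedinD[OF conD _ o DS] C[OF that] CR D(2) x by blast
    qed
    ultimately show ?thesis using D(1) by simp
  qed
  moreover have "D \<in> P" if D: "D \<in> connected_components_of Y" for D
  proof -
    obtain x where x: "x \<in> D" using nonempty_connected_components_of[OF D] by blast
    then have "x \<in> topspace Y" using connected_components_of_subset[OF D] by blast
    then obtain C where "C \<in> P" "x \<in> C" using un by blast
    then have "C = D" using sub[of C] D x connected_components_of_overlap[of C Y D] by blast
    then show ?thesis using \<open>C \<in> P\<close> by simp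
  qed
  ultimately show ?thesis by blast
qed

locale quadrangulation =
  fixes X :: "'a topology" and V E \<gamma>
  assumes surface: "closed_surface X" and graph: "simple_graph V E"
    and quad: "quadrangular_embedding X V E \<gamma>"
begin

text \<open>Records one traversal of the boundary cycle. Rotations and reversal give the other names
  of the same face, so a face can be listed from any chosen boundary edge.\<close>

definition quad_face :: "'a set \<Rightarrow> 'a \<Rightarrow> 'a \<Rightarrow> 'a \<Rightarrow> 'a \<Rightarrow> bool" where
  "quad_face F a b c d \<longleftrightarrow> F \<in> faces X V E \<gamma> \<and> distinct [a, b, c, d] \<and>
     {a, b} \<in> E \<and> {b, c} \<in> E \<and> {c, d} \<in> E \<and> {d, a} \<in> E \<and>
     bounded_by X F (\<gamma> {a, b} \<union> \<gamma> {b, c} \<union> \<gamma> {c, d} \<union> \<gamma> {d, a})"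

lemma Hausdorff: "Hausdorff_space X"
  using surface closed_surface_Hausdorff by blast

lemma ex_quad_face: "F \<in> faces X V E \<gamma> \<Longrightarrow> \<exists>a b c d. quad_face F a b c d"
  using quad unfolding quadrangular_embedding_def quad_face_def by blast

lemma quad_face_rotate: "quad_face F a b c d \<Longrightarrow> quad_face F b c d a"
  unfolding quad_face_def by (auto simp: Un_ac)

lemma quad_face_reverse: "quad_face F a b c d \<Longrightarrow> quad_face F d c b a"
proof -
  assume "quad_face F a b c d"
  moreover have "{d, c} = {c, d}" "{c, b} = {b, c}" "{b, a} = {a, b}" "{a, d} = {d, a}" by blast+
  moreover have "\<gamma> {c, d} \<union> \<gamma> {b, c} \<union> \<gamma> {a, b} \<union> \<gamma> {d, a} = \<gamma> {a, b} \<union> \<gamma> {b, c} \<union> \<gamma> {c, d} \<union> \<gamma> {d, a}"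
    by blast
  moreover have "distinct [d, c, b, a]" using \<open>quad_face F a b c d\<close> unfolding quad_face_def by auto
  ultimately show "quad_face F d c b a" unfolding quad_face_def by (simp only:)
qed

lemma embedding: "embedding X V E \<gamma>"
  using quad unfolding quadrangular_embedding_def cellular_embedding_def by blast

lemma edge_arc: "{u, v} \<in> E \<Longrightarrow> arc_joining X u v (\<gamma> {u, v})"
  using embedding unfolding embedding_def by simp

lemma edge_Int: "e \<in> E \<Longrightarrow> e' \<in> E \<Longrightarrow> e \<noteq> e' \<Longrightarrow> \<gamma> e \<inter> \<gamma> e' = e \<inter> e'"
  using embedding unfolding embedding_def by blast

lemma edge_vertices: "e \<in> E \<Longrightarrow> \<gamma> e \<inter> V = e"
  using embedding unfolding embedding_def by blast

lemma edge_doubleton: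
  assumes "e \<in> E"
  obtains u v where "e = {u, v}" "u \<noteq> v" "arc_joining X u v (\<gamma> e)"
proof -
  have "card e = 2" using graph assms unfolding simple_graph_def by blast
  then obtain u v where "e = {u, v}" "u \<noteq> v" by (meson card_2_iff)
  then show ?thesis using that edge_arc assms by blast
qed

lemma edge_subset: "e \<in> E \<Longrightarrow> e \<subseteq> V" "e \<in> E \<Longrightarrow> finite e"
  using graph finite_subset unfolding simple_graph_def by blast+

lemma finite_graph: "finite V" "finite E"
proof -
  show "finite V" using graph unfolding simple_graph_def by blast
  moreover have "E \<subseteq> Pow V" using edge_subset by blast
  ultimately show "finite E" using finite_subset finite_Pow_iff by blast
qed

lemma edge_subset_topspace: "e \<in> E \<Longrightarrow> \<gamma> e \<subseteq> topspace X"
  by (metis edge_doubleton arc_joining_basics(4))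

lemma infinite_edge: "e \<in> E \<Longrightarrow> infinite (\<gamma> e)"
  by (metis edge_doubleton arc_joining_basics(7))

lemma subset_edge: "e \<in> E \<Longrightarrow> e \<subseteq> \<gamma> e"
  using edge_vertices by blast

lemma Union_faces: "\<Union>(faces X V E \<gamma>) = topspace X - (V \<union> \<Union>(\<gamma> ` E))"
  unfolding faces_def by (auto simp: Union_connected_components_of)

lemma face_disjoint_graph:
  "F \<in> faces X V E \<gamma> \<Longrightarrow> F \<inter> V = {}" "F \<in> faces X V E \<gamma> \<Longrightarrow> e \<in> E \<Longrightarrow> F \<inter> \<gamma> e = {}"
  using Union_faces by blast+

lemma faces_disjoint: "F \<in> faces X V E \<gamma> \<Longrightarrow> F' \<in> faces X V E \<gamma> \<Longrightarrow> F \<noteq> F' \<Longrightarrow> F \<inter> F' = {}"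
  unfolding faces_def using connected_components_of_overlap by blast

lemma quad_face_face: "quad_face F a b c d \<Longrightarrow> F \<in> faces X V E \<gamma>"
  unfolding quad_face_def by blast

lemma face_basics:
  assumes "F \<in> faces X V E \<gamma>"
  shows "openin X F" "connectedin X F" "F \<noteq> {}"
  using ex_quad_face[OF assms] bounded_by_surface(1)[OF surface] bounded_by_basics(5,8)
  unfolding quad_face_def by metis+

lemma frontier_quad_face:
  "quad_face F a b c d \<Longrightarrow> X frontier_of F = \<gamma> {a, b} \<union> \<gamma> {b, c} \<union> \<gamma> {c, d} \<union> \<gamma> {d, a}"
  unfolding quad_face_def using bounded_by_surface(2)[OF surface] by blast

text \<open>Other edges meet \<open>e\<close> in at most its two ends, but an arc is infinite. Hence
  the edges on the boundary of a face can be read off from the point set.\<close>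

lemma edge_subset_Union:
  assumes e: "e \<in> E" and D: "D \<subseteq> E" "finite D" and sub: "\<gamma> e \<subseteq> \<Union>(\<gamma> ` D)"
  shows "e \<in> D"
proof (rule ccontr)
  assume "e \<notin> D"
  then have "\<gamma> e \<inter> \<gamma> e' \<subseteq> e" if "e' \<in> D" for e'
    using edge_Int[OF e, of e'] that D by blast
  then have "\<gamma> e \<subseteq> e" using sub by blast
  then show False using edge_subset(2)[OF e] infinite_edge[OF e] finite_subset by blast
qed

lemma edge_in_frontier_iff:
  assumes q: "quad_face F a b c d" and e: "e \<in> E"
  shows "\<gamma> e \<subseteq> X frontier_of F \<longleftrightarrow> e \<in> {{a, b}, {b, c}, {c, d}, {d, a}}"
proof -
  have fr: "X frontier_of F = \<Union>(\<gamma> ` {{a, b}, {b, c}, {c, d}, {d, a}})"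
    using frontier_quad_face[OF q] by auto
  have "{{a, b}, {b, c}, {c, d}, {d, a}} \<subseteq> E" using q unfolding quad_face_def by auto
  then show ?thesis unfolding fr using edge_subset_Union[OF e, of "{{a, b}, {b, c}, {c, d}, {d, a}}"] by auto
qed

section \<open>Faces that share edges\<close>

lemma adjacent_edge_Int: "{u, v} \<in> E \<Longrightarrow> {v, w} \<in> E \<Longrightarrow> u \<noteq> w \<Longrightarrow> \<gamma> {u, v} \<inter> \<gamma> {v, w} = {v}"
  by (subst edge_Int) (auto simp: doubleton_eq_iff)

lemma disjoint_edge_Int: "{u, v} \<in> E \<Longrightarrow> {w, x} \<in> E \<Longrightarrow> {u, v} \<inter> {w, x} = {} \<Longrightarrow> \<gamma> {u, v} \<inter> \<gamma> {w, x} = {}"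
  by (subst edge_Int) (auto simp: doubleton_eq_iff)

lemma path2_arc:
  assumes "{u, v} \<in> E" "{v, w} \<in> E" "u \<noteq> w"
  shows "arc_joining X u w (\<gamma> {u, v} \<union> \<gamma> {v, w})"
  by (rule arc_joining_join[OF edge_arc[OF assms(1)] edge_arc[OF assms(2)] adjacent_edge_Int[OF assms]])

lemma path3_arc:
  assumes "{u, v} \<in> E" "{v, w} \<in> E" "{w, x} \<in> E" "distinct [u, v, w, x]"
  shows "arc_joining X u x (\<gamma> {u, v} \<union> \<gamma> {v, w} \<union> \<gamma> {w, x})"
proof (rule arc_joining_join[OF path2_arc edge_arc])
  show "(\<gamma> {u, v} \<union> \<gamma> {v, w}) \<inter> \<gamma> {w, x} = {w}"
    using adjacent_edge_Int[OF assms(2,3)] disjoint_edge_Int[OF assms(1,3)] assms(4) by auto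
qed (use assms in auto)

text \<open>The outer paths have three edges each and may overlap, so the open part of the gluing is
  taken: an inner point of an edge has a neighbourhood made of the two faces and the edge.\<close>

lemma shared_edge_open:
  assumes q: "quad_face F a b c d" and q': "quad_face F' a b c' d'" and ne: "F \<noteq> F'"
  shows "openin X (F \<union> F' \<union> (\<gamma> {a, b} - {a, b}))"
proof -
  have aux: "bounded_by X G (\<gamma> {a, b} \<union> (\<gamma> {a, y} \<union> \<gamma> {y, x} \<union> \<gamma> {x, b}))"
    "arc_joining X a b (\<gamma> {a, y} \<union> \<gamma> {y, x} \<union> \<gamma> {x, b})"
    "\<gamma> {a, b} \<inter> (\<gamma> {a, y} \<union> \<gamma> {y, x} \<union> \<gamma> {x, b}) = {a, b}"
    "\<And>H. H \<in> faces X V E \<gamma> \<Longrightarrow> H \<inter> (\<gamma> {a, y} \<union> \<gamma> {y, x} \<union> \<gamma> {x, b}) = {}"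
    if g: "quad_face G a b x y" for G x y
  proof -
    have E: "{a, b} \<in> E" "{b, x} \<in> E" "{x, y} \<in> E" "{y, a} \<in> E" and d: "distinct [a, b, x, y]"
      and bd: "bounded_by X G (\<gamma> {a, b} \<union> \<gamma> {b, x} \<union> \<gamma> {x, y} \<union> \<gamma> {y, a})"
      using g unfolding quad_face_def by auto
    have eq: "\<gamma> {a, b} \<union> (\<gamma> {a, y} \<union> \<gamma> {y, x} \<union> \<gamma> {x, b}) = \<gamma> {a, b} \<union> \<gamma> {b, x} \<union> \<gamma> {x, y} \<union> \<gamma> {y, a}"
      by (auto simp: insert_commute)
    show "bounded_by X G (\<gamma> {a, b} \<union> (\<gamma> {a, y} \<union> \<gamma> {y, x} \<union> \<gamma> {x, b}))" unfolding eq by (rule bd)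
    have E': "{a, y} \<in> E" "{y, x} \<in> E" "{x, b} \<in> E" using E by (simp_all add: insert_commute)
    show "arc_joining X a b (\<gamma> {a, y} \<union> \<gamma> {y, x} \<union> \<gamma> {x, b})"
      by (rule path3_arc) (use E' d in auto)
    have "\<gamma> {a, b} \<inter> \<gamma> {a, y} = {a}"
      using adjacent_edge_Int[of b a y] E(1) E'(1) d by (simp add: insert_commute)
    moreover have "\<gamma> {a, b} \<inter> \<gamma> {y, x} = {}" using disjoint_edge_Int[OF E(1) E'(2)] d by auto
    moreover have "\<gamma> {a, b} \<inter> \<gamma> {x, b} = {b}"
      using adjacent_edge_Int[of a b x] E(1,2) d by (simp add: insert_commute)
    ultimately show "\<gamma> {a, b} \<inter> (\<gamma> {a, y} \<union> \<gamma> {y, x} \<union> \<gamma> {x, b}) = {a, b}" by blast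
    show "H \<inter> (\<gamma> {a, y} \<union> \<gamma> {y, x} \<union> \<gamma> {x, b}) = {}" if "H \<in> faces X V E \<gamma>" for H
      using face_disjoint_graph(2)[OF that] E' by blast
  qed
  have arc: "arc_joining X a b (\<gamma> {a, b})" using q edge_arc unfolding quad_face_def by blast
  have FF: "F \<inter> F' = {}" using faces_disjoint quad_face_face q q' ne by blast
  show ?thesis
    by (rule glue_discs_along_arc(1)[OF surface aux(1)[OF q] aux(1)[OF q'] arc aux(2)[OF q] aux(2)[OF q']
          aux(3)[OF q] aux(3)[OF q'] FF aux(4)[OF q' quad_face_face[OF q]] aux(4)[OF q quad_face_face[OF q']]])
qed

text \<open>Gluing along the whole path through \<open>b\<close> turns \<open>b\<close> into an
  inner point of the union. For \<open>d \<noteq> d'\<close> the outer paths meet only in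
  \<open>a\<close> and \<open>c\<close>, which gives a closed disc again.\<close>

lemma shared_path_glue:
  assumes q: "quad_face F a b c d" and q': "quad_face F' a b c d'" and ne: "F \<noteq> F'"
  shows "openin X (F \<union> F' \<union> (\<gamma> {a, b} \<union> \<gamma> {b, c} - {a, c}))"
    and "d \<noteq> d' \<Longrightarrow> bounded_by X (F \<union> F' \<union> (\<gamma> {a, b} \<union> \<gamma> {b, c} - {a, c}))
           (\<gamma> {a, d} \<union> \<gamma> {d, c} \<union> (\<gamma> {a, d'} \<union> \<gamma> {d', c}))"
proof -
  have aux: "bounded_by X G (\<gamma> {a, b} \<union> \<gamma> {b, c} \<union> (\<gamma> {a, y} \<union> \<gamma> {y, c}))"
    "arc_joining X a c (\<gamma> {a, y} \<union> \<gamma> {y, c})"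
    "(\<gamma> {a, b} \<union> \<gamma> {b, c}) \<inter> (\<gamma> {a, y} \<union> \<gamma> {y, c}) = {a, c}"
    "\<And>H. H \<in> faces X V E \<gamma> \<Longrightarrow> H \<inter> (\<gamma> {a, y} \<union> \<gamma> {y, c}) = {}"
    "{a, y} \<in> E" "{y, c} \<in> E"
    if g: "quad_face G a b c y" for G y
  proof -
    have E: "{a, b} \<in> E" "{b, c} \<in> E" "{c, y} \<in> E" "{y, a} \<in> E" and d: "distinct [a, b, c, y]"
      and bd: "bounded_by X G (\<gamma> {a, b} \<union> \<gamma> {b, c} \<union> \<gamma> {c, y} \<union> \<gamma> {y, a})"
      using g unfolding quad_face_def by auto
    have eq: "\<gamma> {a, b} \<union> \<gamma> {b, c} \<union> (\<gamma> {a, y} \<union> \<gamma> {y, c}) = \<gamma> {a, b} \<union> \<gamma> {b, c} \<union> \<gamma> {c, y} \<union> \<gamma> {y, a}"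
      by (auto simp: insert_commute)
    show "bounded_by X G (\<gamma> {a, b} \<union> \<gamma> {b, c} \<union> (\<gamma> {a, y} \<union> \<gamma> {y, c}))" unfolding eq by (rule bd)
    show E': "{a, y} \<in> E" "{y, c} \<in> E" using E by (simp_all add: insert_commute)
    show "arc_joining X a c (\<gamma> {a, y} \<union> \<gamma> {y, c})" by (rule path2_arc) (use E' d in auto)
    have "\<gamma> {a, b} \<inter> \<gamma> {a, y} = {a}"
      using adjacent_edge_Int[of b a y] E(1) E'(1) d by (simp add: insert_commute)
    moreover have "\<gamma> {a, b} \<inter> \<gamma> {y, c} = {}" using disjoint_edge_Int[OF E(1) E'(2)] d by auto
    moreover have "\<gamma> {b, c} \<inter> \<gamma> {a, y} = {}" using disjoint_edge_Int[OF E(2) E'(1)] d by auto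
    moreover have "\<gamma> {b, c} \<inter> \<gamma> {y, c} = {c}"
      using adjacent_edge_Int[of b c y] E(2,3) d by (simp add: insert_commute)
    ultimately show "(\<gamma> {a, b} \<union> \<gamma> {b, c}) \<inter> (\<gamma> {a, y} \<union> \<gamma> {y, c}) = {a, c}" by blast
    show "H \<inter> (\<gamma> {a, y} \<union> \<gamma> {y, c}) = {}" if "H \<in> faces X V E \<gamma>" for H
      using face_disjoint_graph(2)[OF that] E' by blast
  qed
  have ab: "{a, b} \<in> E" "{b, c} \<in> E" and d: "distinct [a, b, c, d]" "distinct [a, b, c, d']"
    using q q' unfolding quad_face_def by auto
  have arc: "arc_joining X a c (\<gamma> {a, b} \<union> \<gamma> {b, c})" using path2_arc[OF ab] d by auto
  have FF: "F \<inter> F' = {}" using faces_disjoint quad_face_face q q' ne by blast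
  note glue = glue_discs_along_arc[OF surface aux(1)[OF q] aux(1)[OF q'] arc aux(2)[OF q] aux(2)[OF q']
      aux(3)[OF q] aux(3)[OF q'] FF aux(4)[OF q' quad_face_face[OF q]] aux(4)[OF q quad_face_face[OF q']]]
  show "openin X (F \<union> F' \<union> (\<gamma> {a, b} \<union> \<gamma> {b, c} - {a, c}))" by (rule glue(1))
  assume dd: "d \<noteq> d'"
  have "\<gamma> {a, d} \<inter> \<gamma> {a, d'} = {a}"
    using adjacent_edge_Int[of d a d'] aux(5)[OF q] aux(5)[OF q'] dd by (simp add: insert_commute)
  moreover have "\<gamma> {a, d} \<inter> \<gamma> {d', c} = {}"
    using disjoint_edge_Int[OF aux(5)[OF q] aux(6)[OF q']] dd d by auto
  moreover have "\<gamma> {d, c} \<inter> \<gamma> {a, d'} = {}"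
    using disjoint_edge_Int[OF aux(6)[OF q] aux(5)[OF q']] dd d by auto
  moreover have "\<gamma> {d, c} \<inter> \<gamma> {d', c} = {c}"
    using adjacent_edge_Int[of d c d'] aux(6)[OF q] aux(6)[OF q'] dd by (simp add: insert_commute)
  ultimately have "(\<gamma> {a, d} \<union> \<gamma> {d, c}) \<inter> (\<gamma> {a, d'} \<union> \<gamma> {d', c}) = {a, c}" by blast
  then show "bounded_by X (F \<union> F' \<union> (\<gamma> {a, b} \<union> \<gamma> {b, c} - {a, c}))
           (\<gamma> {a, d} \<union> \<gamma> {d, c} \<union> (\<gamma> {a, d'} \<union> \<gamma> {d', c}))"
    by (rule glue(2))
qed

text \<open>The union of the two closed faces is closed. It is also open, so connectedness makes it
  all of \<open>X\<close>, and two discs with a common boundary form a sphere.\<close>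

lemma same_boundary_sphere:
  assumes q: "quad_face F a b c d" and q': "quad_face F' a b c d" and ne: "F \<noteq> F'"
  shows "top_of_set (sphere (0 :: complex \<times> real) 1) homeomorphic_space X"
proof -
  let ?C = "\<gamma> {a, b} \<union> \<gamma> {b, c} \<union> \<gamma> {c, d} \<union> \<gamma> {d, a}"
  let ?W = "\<lambda>a b c. F \<union> F' \<union> (\<gamma> {a, b} \<union> \<gamma> {b, c} - {a, c})"
  note r = quad_face_rotate
  have o: "openin X (?W a b c)" "openin X (?W b c d)" "openin X (?W c d a)" "openin X (?W d a b)"
    using shared_path_glue(1)[OF q q' ne] shared_path_glue(1)[OF r[OF q] r[OF q'] ne]
      shared_path_glue(1)[OF r[OF r[OF q]] r[OF r[OF q']] ne]
      shared_path_glue(1)[OF r[OF r[OF r[OF q]]] r[OF r[OF r[OF q']]] ne] by auto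
  have d: "distinct [a, b, c, d]" and E: "{a, b} \<in> E" "{b, c} \<in> E" "{c, d} \<in> E" "{d, a} \<in> E"
    and bF: "bounded_by X F ?C" and bF': "bounded_by X F' ?C"
    using q q' unfolding quad_face_def by auto
  \<comment> \<open>Each glued set omits the ends of its path, but every corner is the middle of one
    of the four paths.\<close>
  have "?W a b c \<union> ?W b c d \<union> ?W c d a \<union> ?W d a b = F \<union> F' \<union> ?C"
  proof -
    have "a \<in> \<gamma> {d, a}" "b \<in> \<gamma> {a, b}" "c \<in> \<gamma> {b, c}" "d \<in> \<gamma> {c, d}"
      using subset_edge E by blast+
    then show ?thesis using d by auto
  qed
  then have op: "openin X (F \<union> F' \<union> ?C)" using o openin_Un by metis
  have "closedin X ((F \<union> ?C) \<union> (F' \<union> ?C))"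
    using bounded_by_surface(3)[OF surface bF] bounded_by_surface(3)[OF surface bF'] closedin_Un by blast
  moreover have "(F \<union> ?C) \<union> (F' \<union> ?C) = F \<union> F' \<union> ?C" by blast
  ultimately have "closedin X (F \<union> F' \<union> ?C)" by simp
  moreover have "connected_space X" using surface unfolding closed_surface_def by blast
  ultimately have "F \<union> F' \<union> ?C = topspace X"
    using op face_basics(3)[OF quad_face_face[OF q]] unfolding connected_space_clopen_in by blast
  moreover have "F \<inter> F' = {}" using faces_disjoint quad_face_face q q' ne by blast
  ultimately show ?thesis using two_discs_homeomorphic_sphere[OF Hausdorff bF bF'] by blast
qed

text \<open>The first face leads from ab to dc, with a going to d and b to c. The second leads back
  with d going to b and c to a. Going round thus exchanges the ends of ab.\<close>

lemma twisted_faces_moebius: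
  assumes q: "quad_face F a b c d" and q': "quad_face F' a b d c" and ne: "F \<noteq> F'"
  shows "\<not> orientable X"
proof -
  have d: "distinct [a, b, c, d]" and E: "{a, b} \<in> E" "{b, c} \<in> E" "{d, c} \<in> E" "{a, d} \<in> E" "{c, a} \<in> E" "{d, b} \<in> E"
    and bF: "bounded_by X F (\<gamma> {a, b} \<union> \<gamma> {b, c} \<union> \<gamma> {d, c} \<union> \<gamma> {a, d})"
    and bF': "bounded_by X F' (\<gamma> {d, c} \<union> \<gamma> {c, a} \<union> \<gamma> {a, b} \<union> \<gamma> {d, b})"
    using q q' unfolding quad_face_def by (auto simp: insert_commute Un_ac)
  note F = quad_face_face[OF q] quad_face_face[OF q']
  have I: "\<gamma> {a, b} \<inter> \<gamma> {d, c} = {}" "\<gamma> {b, c} \<inter> \<gamma> {a, d} = {}" "\<gamma> {c, a} \<inter> \<gamma> {d, b} = {}"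
    "\<gamma> {a, b} \<inter> \<gamma> {b, c} = {b}" "\<gamma> {a, b} \<inter> \<gamma> {a, d} = {a}" "\<gamma> {d, c} \<inter> \<gamma> {b, c} = {c}" "\<gamma> {d, c} \<inter> \<gamma> {a, d} = {d}"
    "\<gamma> {d, c} \<inter> \<gamma> {c, a} = {c}" "\<gamma> {d, c} \<inter> \<gamma> {d, b} = {d}" "\<gamma> {a, b} \<inter> \<gamma> {c, a} = {a}" "\<gamma> {a, b} \<inter> \<gamma> {d, b} = {b}"
    "\<gamma> {b, c} \<inter> \<gamma> {c, a} = {c}" "\<gamma> {b, c} \<inter> \<gamma> {d, b} = {b}" "\<gamma> {a, d} \<inter> \<gamma> {c, a} = {a}" "\<gamma> {a, d} \<inter> \<gamma> {d, b} = {d}"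
    using E d by (subst edge_Int; auto simp: doubleton_eq_iff)+
  have "(\<gamma> {b, c} \<union> \<gamma> {a, d}) \<inter> (\<gamma> {c, a} \<union> \<gamma> {d, b}) = {a, b, d, c}"
    using I(12-15) by blast
  moreover have "F \<inter> F' = {}" using faces_disjoint F ne by blast
  moreover have "F \<inter> (\<gamma> {c, a} \<union> \<gamma> {d, b}) = {}" "F' \<inter> (\<gamma> {b, c} \<union> \<gamma> {a, d}) = {}"
    using face_disjoint_graph(2)[OF F(1)] face_disjoint_graph(2)[OF F(2)] E by blast+
  ultimately have "\<exists>S\<subseteq>topspace X. moebius_band (subtopology X S)"
    by (intro moebius_band_from_two_discs[OF Hausdorff bF bF' edge_arc[OF E(1)] edge_arc[OF E(3)] edge_arc[OF E(2)]
        edge_arc[OF E(4)] edge_arc[OF E(5)] edge_arc[OF E(6)] I(1-11)])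
  then show ?thesis unfolding orientable_def by blast
qed

end

context quadrangulation
begin

text \<open>\<open>W\<close> is an open neighbourhood of \<open>b\<close> that contains nothing of
  the graph but parts of the two deleted edges. So no other edge ends in \<open>b\<close>, and no
  other face borders on those edges. The merged face has the corners a, d, c, d', which are distinct
  since \<open>d \<noteq> d'\<close>.\<close>

lemma degree_two_vertex_removable:
  assumes q: "quad_face F a b c d" and q': "quad_face F' a b c d'" and ne: "F \<noteq> F'" and dd: "d \<noteq> d'"
  obtains V\<^sub>1 E\<^sub>1 where "simple_graph V\<^sub>1 E\<^sub>1" "quadrangular_embedding X V\<^sub>1 E\<^sub>1 \<gamma>" "card V\<^sub>1 < card V"
proof -
  define A where "A = \<gamma> {a, b} \<union> \<gamma> {b, c}"
  define W where "W = F \<union> F' \<union> (A - {a, c})"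
  define V\<^sub>1 where "V\<^sub>1 = V - {b}"
  define E\<^sub>1 where "E\<^sub>1 = E - {{a, b}, {b, c}}"
  have E: "{a, b} \<in> E" "{b, c} \<in> E" "{c, d} \<in> E" "{d, a} \<in> E" "{c, d'} \<in> E" "{d', a} \<in> E"
    and dist: "distinct [a, b, c, d]" "distinct [a, b, c, d']"
    using q q' unfolding quad_face_def by auto
  note F = quad_face_face[OF q] quad_face_face[OF q']
  have opW: "openin X W" and bW: "bounded_by X W (\<gamma> {a, d} \<union> \<gamma> {d, c} \<union> (\<gamma> {a, d'} \<union> \<gamma> {d', c}))"
    using shared_path_glue[OF q q' ne] dd unfolding W_def A_def by blast+
  have E1E: "E\<^sub>1 \<subseteq> E" unfolding E\<^sub>1_def by blast
  have V: "a \<in> V" "b \<in> V" "c \<in> V" using edge_subset(1) E by blast+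
  have bA: "b \<in> A" "a \<in> A" "c \<in> A" using subset_edge E unfolding A_def by blast+
  have AV: "A \<inter> V = {a, b, c}" using edge_vertices[OF E(1)] edge_vertices[OF E(2)] unfolding A_def by blast
  have eA: "\<gamma> e \<inter> A \<subseteq> {a, b, c}" if "e \<in> E\<^sub>1" for e
    using edge_Int[of e "{a, b}"] edge_Int[of e "{b, c}"] that E(1,2) unfolding E\<^sub>1_def A_def by auto
  have eW: "\<gamma> e \<inter> W \<subseteq> {b}" if "e \<in> E\<^sub>1" for e
    using eA[OF that] face_disjoint_graph(2)[OF F(1), of e] face_disjoint_graph(2)[OF F(2), of e] that E1E
    unfolding W_def by blast
  have bW': "b \<in> W" using bA dist unfolding W_def by auto
  \<comment> \<open>An edge of \<open>E\<^sub>1\<close> meets \<open>W\<close> at most in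
    \<open>b\<close>. If it contained \<open>b\<close>, then \<open>W\<close> and the complement of
    \<open>b\<close> would split this connected arc.\<close>
  have be: "b \<notin> e" if e: "e \<in> E\<^sub>1" for e
  proof
    assume "b \<in> e"
    then have b: "b \<in> \<gamma> e" using subset_edge e E1E by blast
    have con: "connectedin X (\<gamma> e)" by (metis edge_doubleton arc_joining_basics(6) e E1E subsetD)
    have sub: "\<gamma> e \<subseteq> topspace X" using edge_subset_topspace e E1E by blast
    have op: "openin X (topspace X - {b})"
      using Hausdorff closedin_Hausdorff_singleton[of X b] sub b by (intro openin_diff) auto
    have "infinite (\<gamma> e)" using infinite_edge e E1E by blast
    then have "\<not> \<gamma> e \<subseteq> {b}" using finite_subset by blast
    then have "(topspace X - {b}) \<inter> \<gamma> e \<noteq> {}" using sub by blast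
    moreover have "W \<inter> \<gamma> e \<noteq> {}" using b bW' by blast
    moreover have "W \<inter> (topspace X - {b}) \<inter> \<gamma> e = {}" using eW[OF e] by blast
    moreover have "\<gamma> e \<subseteq> W \<union> (topspace X - {b})" using sub bW' by blast
    ultimately show False using connectedinD[OF con opW op] by blast
  qed
  have bge: "b \<notin> \<gamma> e" if "e \<in> E\<^sub>1" for e
    using be[OF that] edge_vertices[of e] that E1E V(2) by blast
  have eA0: "\<gamma> e \<inter> A \<subseteq> {a, c}" if "e \<in> E\<^sub>1" for e using eA[OF that] bge[OF that] by blast
  have sg: "simple_graph V\<^sub>1 E\<^sub>1"
    unfolding simple_graph_def
  proof (intro conjI ballI)
    show "finite V\<^sub>1" using finite_graph(1) by (simp add: V\<^sub>1_def)
    fix e assume e: "e \<in> E\<^sub>1"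
    then have "e \<in> E" using E1E by (rule subsetD[rotated])
    then show "e \<subseteq> V\<^sub>1" "card e = 2"
      using graph be[OF e] by (auto simp: simple_graph_def V\<^sub>1_def)
  qed
  have emb: "Defs.embedding X V\<^sub>1 E\<^sub>1 \<gamma>"
    unfolding embedding_def
  proof (intro conjI ballI allI impI)
    have "V \<subseteq> topspace X" using embedding unfolding embedding_def by simp
    then show "V\<^sub>1 \<subseteq> topspace X" unfolding V\<^sub>1_def by blast
    show "arc_joining X u v (\<gamma> {u, v})" if "{u, v} \<in> E\<^sub>1" for u v
      by (rule edge_arc[OF subsetD[OF E1E that]])
    show "\<gamma> e \<inter> V\<^sub>1 = e" if "e \<in> E\<^sub>1" for e
      using edge_vertices[of e] be[OF that] that E1E unfolding V\<^sub>1_def by blast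
    show "\<gamma> e \<inter> \<gamma> e' = e \<inter> e'" if "e \<in> E\<^sub>1" "e' \<in> E\<^sub>1" "e \<noteq> e'" for e e'
      by (rule edge_Int[OF subsetD[OF E1E that(1)] subsetD[OF E1E that(2)] that(3)])
  qed
  let ?K = "V \<union> \<Union>(\<gamma> ` E)" and ?K1 = "V\<^sub>1 \<union> \<Union>(\<gamma> ` E\<^sub>1)"
  have K: "?K = ?K1 \<union> A"
  proof -
    have "E = E\<^sub>1 \<union> {{a, b}, {b, c}}" using E unfolding E\<^sub>1_def by blast
    then have "\<Union>(\<gamma> ` E) = \<Union>(\<gamma> ` E\<^sub>1) \<union> A" unfolding A_def by auto
    then show ?thesis using bA V unfolding V\<^sub>1_def by blast
  qed
  have K1A: "?K1 \<inter> A = {a, c}"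
  proof -
    have "V\<^sub>1 \<inter> A = {a, c}" using AV dist unfolding V\<^sub>1_def by auto
    then show ?thesis using eA0 by blast
  qed
  have AX: "A \<subseteq> topspace X" using edge_subset_topspace E unfolding A_def by blast
  have compl: "topspace X - ?K1 = \<Union>(faces X V E \<gamma>) \<union> (A - {a, c})"
    unfolding Union_faces K using K1A AX by blast
  define P where "P = insert W (faces X V E \<gamma> - {F, F'})"
  have UP: "\<Union>P = topspace X - ?K1"
    unfolding compl P_def W_def using F by blast
  have GA: "G \<inter> A = {}" if "G \<in> faces X V E \<gamma>" for G
    using face_disjoint_graph(2)[OF that] E unfolding A_def by blast
  have GW: "G \<inter> W = {}" if "G \<in> faces X V E \<gamma> - {F, F'}" for G
    using GA[of G] faces_disjoint[of G F] faces_disjoint[of G F'] F that unfolding W_def by blast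
  have fcs: "faces X V\<^sub>1 E\<^sub>1 \<gamma> = P"
    unfolding faces_def
  proof (rule connected_components_of_open_partition)
    show "\<Union>P = topspace (subtopology X (topspace X - ?K1))" using UP by auto
    fix C assume C: "C \<in> P"
    then have "openin X C" "connectedin X C" "C \<noteq> {}"
      using opW bounded_by_basics(5,8)[OF bW] face_basics unfolding P_def by blast+
    moreover have "C \<subseteq> topspace X - ?K1" using C UP by blast
    ultimately show "C \<noteq> {} \<and> openin (subtopology X (topspace X - ?K1)) C \<and> connectedin (subtopology X (topspace X - ?K1)) C"
      by (auto simp: connectedin_subtopology openin_subtopology intro!: exI[of _ C])
  next
    show "pairwise disjnt P"
    proof (rule pairwiseI)
      fix C D assume CD: "C \<in> P" "D \<in> P" "C \<noteq> D"
      show "disjnt C D"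
      proof (cases "C = W \<or> D = W")
        case True
        then show ?thesis using CD GW[of C] GW[of D] unfolding P_def disjnt_def by auto
      next
        case False
        then have "C \<in> faces X V E \<gamma>" "D \<in> faces X V E \<gamma>" using CD unfolding P_def by auto
        then show ?thesis using faces_disjoint[OF _ _ CD(3)] unfolding disjnt_def by simp
      qed
    qed
  qed
  have quad_faces: "\<exists>a b c d. distinct [a, b, c, d] \<and> {a, b} \<in> E\<^sub>1 \<and> {b, c} \<in> E\<^sub>1 \<and> {c, d} \<in> E\<^sub>1 \<and> {d, a} \<in> E\<^sub>1 \<and>
        bounded_by X G (\<gamma> {a, b} \<union> \<gamma> {b, c} \<union> \<gamma> {c, d} \<union> \<gamma> {d, a})" if G: "G \<in> P" for G
  proof (cases "G = W")
    case True
    have comm: "{c, d'} = {d', c}" "{d', a} = {a, d'}" by blast+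
    have "bounded_by X W (\<gamma> {a, d} \<union> \<gamma> {d, c} \<union> \<gamma> {c, d'} \<union> \<gamma> {d', a})"
      using bW unfolding comm by (simp only: Un_ac)
    moreover have "{a, d} \<in> E\<^sub>1" "{d, c} \<in> E\<^sub>1" "{c, d'} \<in> E\<^sub>1" "{d', a} \<in> E\<^sub>1"
      using E dist unfolding E\<^sub>1_def by (auto simp: doubleton_eq_iff insert_commute)
    moreover have "distinct [a, d, c, d']" using dist dd by auto
    ultimately show ?thesis using True by blast
  next
    case False
    then have G': "G \<in> faces X V E \<gamma> - {F, F'}" using G unfolding P_def by blast
    then obtain x y z w where g: "quad_face G x y z w" using ex_quad_face by blast
    have cl: "X closure_of G = G \<union> X frontier_of G"
      using bounded_by_basics(1) bounded_by_surface(2)[OF surface] g unfolding quad_face_def by metis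
    \<comment> \<open>An inner point of a deleted edge lies in the open set \<open>W\<close>; if it
      were in the closure of \<open>G\<close>, then \<open>G\<close> would meet
      \<open>W\<close>.\<close>
    have "e \<in> E\<^sub>1" if e: "e \<in> E" "\<gamma> e \<subseteq> X frontier_of G" for e
    proof (rule ccontr)
      assume "e \<notin> E\<^sub>1"
      then have eA: "\<gamma> e \<subseteq> A" using e(1) unfolding E\<^sub>1_def A_def by blast
      have "\<not> \<gamma> e \<subseteq> {a, c}" using infinite_edge[OF e(1)] finite_subset by blast
      then obtain x where x: "x \<in> \<gamma> e" "x \<in> W" using eA unfolding W_def by blast
      then have "x \<in> X closure_of G" using e(2) cl by blast
      then have "\<exists>y\<in>G. y \<in> W" using opW x(2) unfolding in_closure_of by blast
      then show False using GW[OF G'] by blast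
    qed
    then have "{x, y} \<in> E\<^sub>1" "{y, z} \<in> E\<^sub>1" "{z, w} \<in> E\<^sub>1" "{w, x} \<in> E\<^sub>1"
      using edge_in_frontier_iff[OF g] g unfolding quad_face_def by auto
    then show ?thesis using g unfolding quad_face_def by blast
  qed
  have "quadrangular_embedding X V\<^sub>1 E\<^sub>1 \<gamma>"
    unfolding quadrangular_embedding_def cellular_embedding_def fcs
    using emb quad_faces bounded_by_basics(9) by blast
  moreover have "card V\<^sub>1 < card V" unfolding V\<^sub>1_def by (rule card_Diff1_less[OF finite_graph(1) V(2)])
  ultimately show ?thesis using that sg by blast
qed

section \<open>Listing a face from a given edge\<close>

lemma quad_face_start_at:
  assumes q: "quad_face F p q r s" and e: "{x, y} \<in> {{p, q}, {q, r}, {r, s}, {s, p}}"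
  obtains u v where "quad_face F x y u v"
proof -
  have aux: "\<exists>u v. quad_face F x y u v" if "quad_face F p q r s" "{x, y} = {p, q}" for p q r s
  proof -
    have "x = p \<and> y = q \<or> x = q \<and> y = p" using that(2) by (simp add: doubleton_eq_iff)
    then show ?thesis
      using that(1) quad_face_rotate[OF quad_face_rotate[OF quad_face_reverse[OF that(1)]]] by blast
  qed
  note r = quad_face_rotate
  have "{x, y} = {p, q} \<or> {x, y} = {q, r} \<or> {x, y} = {r, s} \<or> {x, y} = {s, p}" using e by simp
  then have "\<exists>u v. quad_face F x y u v"
    using aux[OF q] aux[OF r[OF q]] aux[OF r[OF r[OF q]]] aux[OF r[OF r[OF r[OF q]]]] by (elim disjE)
  then show ?thesis using that by blast
qed

lemma quad_face_at_edge:
  assumes F: "F \<in> faces X V E \<gamma>" and e: "{x, y} \<in> E" "\<gamma> {x, y} \<subseteq> X frontier_of F"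
  obtains u v where "quad_face F x y u v"
proof -
  obtain p q r s where q: "quad_face F p q r s" using ex_quad_face[OF F] by blast
  have "{x, y} \<in> {{p, q}, {q, r}, {r, s}, {s, p}}"
    using edge_in_frontier_iff[OF q e(1)] e(2) by simp
  then show ?thesis using that by (rule quad_face_start_at[OF q])
qed

lemma minimal_imp_face_simple:
  assumes or: "orientable X" and ns: "\<not> top_of_set (sphere (0 :: complex \<times> real) 1) homeomorphic_space X"
    and min: "\<And>V' E' \<gamma>'. simple_graph V' E' \<Longrightarrow> quadrangular_embedding X V' E' \<gamma>' \<Longrightarrow> card V \<le> card V'"
  shows "face_simple X V E \<gamma>"
  unfolding face_simple_def
proof (intro ballI impI, rule ccontr)
  fix F F' assume F: "F \<in> faces X V E \<gamma>" "F' \<in> faces X V E \<gamma>" "F \<noteq> F'"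
  let ?S = "{e \<in> E. \<gamma> e \<subseteq> X frontier_of F \<and> \<gamma> e \<subseteq> X frontier_of F'}"
  assume "\<not> card ?S \<le> 1"
  then obtain e1 e2 where e: "e1 \<in> ?S" "e2 \<in> ?S" "e1 \<noteq> e2"
    using card_le_Suc0_iff_eq[of ?S] finite_graph(2) by (auto simp: numeral_eq_Suc)
  have adjacent: False if f: "quad_face F a b c d" "quad_face F' a b c d'" for a b c d d'
  proof (cases "d = d'")
    case True
    then show False using same_boundary_sphere[of F a b c d F'] f F(3) ns by blast
  next
    case False
    from degree_two_vertex_removable[OF f F(3) False] show False using min by (metis leD)
  qed
  \<comment> \<open>On the boundary of the second face only two edges contain \<open>b\<close>, so
    its corner after \<open>b\<close> must be \<open>c\<close> as well.\<close>
  have adjacent': False if f: "quad_face F a b c d" and e: "\<gamma> {a, b} \<subseteq> X frontier_of F'" "\<gamma> {b, c} \<subseteq> X frontier_of F'" for a b c d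
  proof -
    have E: "{a, b} \<in> E" "{b, c} \<in> E" and dist: "distinct [a, b, c, d]" using f unfolding quad_face_def by auto
    obtain u v where uv: "quad_face F' a b u v"
      using quad_face_at_edge[OF F(2) E(1) e(1)] by blast
    have "{b, c} \<in> {{a, b}, {b, u}, {u, v}, {v, a}}" using edge_in_frontier_iff[OF uv E(2)] e(2) by blast
    moreover have "distinct [a, b, u, v]" using uv unfolding quad_face_def by blast
    ultimately have "u = c" using dist by (auto simp: doubleton_eq_iff)
    then show False using adjacent[OF f] uv by blast
  qed
  have "e1 \<in> E" using e(1) by simp
  then obtain x y where xy: "e1 = {x, y}" by (rule edge_doubleton)
  have e1: "{x, y} \<in> E" "\<gamma> {x, y} \<subseteq> X frontier_of F" "\<gamma> {x, y} \<subseteq> X frontier_of F'"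
    using e(1) xy by auto
  obtain u v where f: "quad_face F x y u v"
    using quad_face_at_edge[OF F(1) e1(1,2)] by blast
  have "e2 \<in> {{x, y}, {y, u}, {u, v}, {v, x}}" using edge_in_frontier_iff[OF f] e(2) by blast
  then consider "e2 = {y, u}" | "e2 = {v, x}" | "e2 = {u, v}" using e(3) xy by blast
  then show False
  proof cases
    case 1
    then show False using adjacent'[OF f] e xy by blast
  next
    case 2
    \<comment> \<open>Read backwards from \<open>y\<close>, the edge \<open>{v, x}\<close> becomes
      the second one.\<close>
    have "quad_face F y x v u" using quad_face_rotate[OF quad_face_rotate[OF quad_face_reverse[OF f]]] .
    moreover have "{y, x} = {x, y}" "{x, v} = {v, x}" by blast+
    ultimately show False using adjacent'[of y x v u] e1 e(2) 2 by simp
  next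
    case 3
    obtain u' v' where f': "quad_face F' x y u' v'"
      using quad_face_at_edge[OF F(2) e1(1,3)] by blast
    have "{u, v} \<in> E" "\<gamma> {u, v} \<subseteq> X frontier_of F'" using e(2) 3 by auto
    from edge_in_frontier_iff[OF f' this(1), THEN iffD1, OF this(2)]
    have "{u, v} = {x, y} \<or> {u, v} = {y, u'} \<or> {u, v} = {u', v'} \<or> {u, v} = {v', x}"
      by (simp only: insert_iff empty_iff simp_thms)
    \<comment> \<open>The edge opposite to xy contains neither \<open>x\<close> nor
      \<open>y\<close>, hence is opposite in \<open>F'\<close> too. The two ways of matching its
      ends give equal boundaries or the twisted case.\<close>
    moreover have "x \<notin> {u, v}" "y \<notin> {u, v}" using f unfolding quad_face_def by auto
    ultimately have "{u, v} = {u', v'}" by (metis insertI1 insertI2)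
    then have "u' = u \<and> v' = v \<or> u' = v \<and> v' = u" unfolding doubleton_eq_iff by blast
    then show False
    proof
      assume "u' = u \<and> v' = v"
      then have "quad_face F' x y u v" using f' by simp
      then show False by (rule adjacent[OF f])
    next
      assume "u' = v \<and> v' = u"
      then have "quad_face F' x y v u" using f' by simp
      then show False using twisted_faces_moebius[OF f _ F(3)] or by simp
    qed
  qed
qed

end

text \<open>A nonempty set in \<open>enat\<close> attains its infimum, so there is a minimal
  quadrangulation, and it is face-simple. Without any quadrangulation both minima are
  infinite.\<close>

lemma min_face_simple_quad_eq:
  assumes "g \<ge> 1" and S: "orientable_surface g X"
  shows "min_face_simple_quad X = min_quad X"
proof -
  have surf: "closed_surface X" and or: "orientable X" and gen: "has_genus X g"
    using S unfolding orientable_surface_def by auto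
  have ns: "\<not> top_of_set (sphere (0 :: complex \<times> real) 1) homeomorphic_space X"
  proof
    assume h: "top_of_set (sphere (0 :: complex \<times> real) 1) homeomorphic_space X"
    obtain \<C> where "nonseparating_curves X \<C>" "card \<C> = g" using gen unfolding has_genus_def by blast
    then show False using sphere_no_nonseparating_curve[OF surf h] assms(1) by fastforce
  qed
  let ?Q = "{enat (card V) | V. \<exists>E \<gamma>. simple_graph V E \<and> quadrangular_embedding X V E \<gamma>}"
  let ?S = "{enat (card V) | V. \<exists>E \<gamma>. simple_graph V E \<and> quadrangular_embedding X V E \<gamma> \<and> face_simple X V E \<gamma>}"
  have sub: "?S \<subseteq> ?Q" by blast
  have "Inf ?S \<le> Inf ?Q"
  proof (cases "?Q = {}")
    case True
    then have "?S = {}" using sub by blast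
    then show ?thesis unfolding True by simp
  next
    case False
    then obtain k where "k \<in> ?Q" by blast
    then have "Inf ?Q \<in> ?Q" by (rule wellorder_InfI)
    then obtain V E \<gamma> where V: "Inf ?Q = enat (card V)" "simple_graph V E" "quadrangular_embedding X V E \<gamma>" by blast
    have min: "card V \<le> card V'" if "simple_graph V' E'" "quadrangular_embedding X V' E' \<gamma>'" for V' E' \<gamma>'
    proof -
      have "enat (card V') \<in> ?Q" using that by blast
      then have "Inf ?Q \<le> enat (card V')" by (rule Inf_lower)
      then show ?thesis using V(1) by simp
    qed
    interpret quadrangulation X V E \<gamma> using surf V by unfold_locales
    have "face_simple X V E \<gamma>" using minimal_imp_face_simple[OF or ns min] .
    then have "enat (card V) \<in> ?S" using V by blast
    then show ?thesis unfolding V(1) by (rule Inf_lower)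
  qed
  moreover have "Inf ?Q \<le> Inf ?S" using sub by (rule Inf_superset_mono)
  ultimately show ?thesis unfolding min_face_simple_quad_def min_quad_def by (rule antisym)
qed

section \<open>The Euler inequality on the sphere\<close>

text \<open>An arc is homeomorphic to a segment of the real axis in \<open>complex\<close>, which
  has empty interior.\<close>

lemma surface_open_not_in_arc:
  assumes X: "closed_surface X" and A: "arc_joining X u v A" and U: "openin X U" "U \<subseteq> A"
  shows "U = {}"
proof -
  obtain p where p: "pathin X p" "inj_on p {0..1}" "p ` {0..1} = A"
    using A unfolding arc_joining_def by blast
  have AX: "A \<subseteq> topspace X" using arc_joining_basics(4)[OF A] .
  have "homeomorphic_map (top_of_set {0..1}) (subtopology X A) p"
  proof (rule continuous_imp_homeomorphic_map)
    show "continuous_map (top_of_set {0..1}) (subtopology X A) p"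
      using p(1,3) by (auto simp: pathin_def continuous_map_in_subtopology)
    show "Hausdorff_space (subtopology X A)" using closed_surface_Hausdorff[OF X] Hausdorff_space_subtopology by blast
    show "p ` topspace (top_of_set {0..1}) = topspace (subtopology X A)" using p(3) AX by (simp add: Int_absorb1)
  qed (use p in \<open>auto simp: compact_space_subtopology\<close>)
  then have 1: "subtopology X A homeomorphic_space top_of_set {0..1::real}"
    using homeomorphic_map_imp_homeomorphic_space homeomorphic_space_sym by blast
  have "{0..1::real} homeomorphic complex_of_real ` {0..1}"
    by (rule homeomorphic_compact) (auto intro: continuous_intros inj_onI)
  then have 2: "subtopology X A homeomorphic_space top_of_set (complex_of_real ` {0..1})"
    using 1 homeomorphic_space_trans homeomorphic_space_top_of_set by blast
  have "interior (complex_of_real ` {0..1}) = {}"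
  proof (rule ccontr)
    assume "interior (complex_of_real ` {0..1}) \<noteq> {}"
    then obtain x e where e: "e > 0" "ball x e \<subseteq> complex_of_real ` {0..1}" by (meson all_not_in_conv mem_interior)
    have im: "Im z = 0" if "z \<in> complex_of_real ` {0..1}" for z using that by auto
    have "x \<in> ball x e" "x + \<i> * of_real (e/2) \<in> ball x e"
      using e(1) by (auto simp: dist_norm norm_mult)
    then have "Im x = 0" "Im (x + \<i> * of_real (e/2)) = 0" using e(2) im by blast+
    then show False using e(1) by simp
  qed
  from surface_open_not_in_thin[OF X U 2 this] show ?thesis .
qed

text \<open>Components are counted as images of a set of points under the map to their component. A
  coarser classification factors through a finer one and loses a class as soon as two are
  merged.\<close>

lemma card_image_coarser:
  assumes fin: "finite (f ` V)" and co: "\<forall>v\<in>V. \<forall>w\<in>V. f v = f w \<longrightarrow> g v = g w"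
  shows "finite (g ` V)" "card (g ` V) \<le> card (f ` V)"
    and "v \<in> V \<Longrightarrow> w \<in> V \<Longrightarrow> g v = g w \<Longrightarrow> f v \<noteq> f w \<Longrightarrow> card (g ` V) < card (f ` V)"
proof -
  define h where "h y = g (inv_into V f y)" for y
  have hf: "h (f v) = g v" if "v \<in> V" for v
    unfolding h_def
    by (rule co[rule_format, OF inv_into_into[of "f v" f V] that f_inv_into_f[of "f v" f V]]) (use that in auto)
  have eq: "g ` V = h ` f ` V" using hf by (simp add: image_image cong: image_cong)
  then show "finite (g ` V)" "card (g ` V) \<le> card (f ` V)" using fin card_image_le by auto
  assume vw: "v \<in> V" "w \<in> V" "g v = g w" "f v \<noteq> f w"
  have "h (f w) = h (f v)" "f v \<in> f ` V - {f w}" using hf vw by auto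
  then have "h (f w) \<in> h ` (f ` V - {f w})" by (simp add: rev_image_eqI)
  moreover have "f ` V = insert (f w) (f ` V - {f w})" using vw(2) by blast
  then have "h ` f ` V = insert (h (f w)) (h ` (f ` V - {f w}))" by (metis image_insert)
  ultimately have "h ` f ` V = h ` (f ` V - {f w})" by (simp only: insert_absorb)
  then have "card (g ` V) \<le> card (f ` V - {f w})" using eq fin card_image_le[of "f ` V - {f w}" h] by simp
  also have "\<dots> < card (f ` V)" using fin vw(2) by (intro card_Diff1_less) auto
  finally show "card (g ` V) < card (f ` V)" .
qed

lemma connected_component_of_top_of_set:
  "connected_component_of (top_of_set S) x y \<longleftrightarrow> connected_component S x y"
  unfolding connected_component_of_def connected_component_def
  by (auto simp: connectedin_subtopology)

lemma connected_components_of_top_of_set: "connected_components_of (top_of_set S) = components S"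
proof -
  have "connected_component_of (top_of_set S) = connected_component S"
    by (intro ext connected_component_of_top_of_set)
  then show ?thesis unfolding connected_components_of_def components_def by simp
qed

lemma arc_joining_top_of_set:
  fixes S :: "'a::t2_space set"
  assumes "arc_joining (top_of_set S) u v A"
  obtains g where "arc g" "path_image g = A" "pathstart g = u" "pathfinish g = v"
proof -
  obtain p where p: "pathin (top_of_set S) p" "inj_on p {0..1}" "p 0 = u" "p 1 = v" "p ` {0..1} = A"
    using assms unfolding arc_joining_def by blast
  show ?thesis
    by (rule that[of p]) (use p in \<open>auto simp: arc_def pathin_canon_iff path_image_def pathstart_def pathfinish_def\<close>)
qed

text \<open>Spheres are ANRs, hence locally connected, and local connectedness passes to open
  subsets.\<close>

lemma sphere_component_open:
  fixes B :: "'n::euclidean_space set"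
  assumes "openin (top_of_set (sphere 0 1)) B" "C \<in> components B"
  shows "openin (top_of_set (sphere 0 1)) C"
proof -
  have "locally connected (sphere (0::'n) 1)"
    using ANR_imp_locally_connected ANR_sphere by blast
  then have "locally connected B" using locally_open_subset assms(1) by blast
  then show ?thesis using openin_components_locally_connected assms openin_trans by blast
qed

text \<open>One stage of drawing a graph: \<open>K\<close> is what has been drawn so far and
  \<open>A\<close> the next edge, attached only at its ends.\<close>

locale sphere_arc =
  fixes K A :: "'n::euclidean_space set" and u v :: 'n
  assumes dim: "DIM('n) = 3"
    and K: "closed K" "K \<subseteq> sphere 0 1"
    and arc: "arc_joining (top_of_set (sphere 0 1)) u v A"
    and KA: "K \<inter> A = {u, v}"
begin

lemma surf: "closed_surface (top_of_set (sphere (0::'n) 1))"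
  by (rule closed_surface_sphere[OF dim])

lemma A_subset: "A \<subseteq> sphere 0 1"
  using arc_joining_basics(4)[OF arc] by simp

lemma open_compl: "openin (top_of_set (sphere 0 1)) (sphere 0 1 - K)"
  using K(1) by (simp add: Diff_eq open_Compl openin_open_Int)

text \<open>A component of the complement of \<open>K\<close> is open and therefore not contained in
  the arc. So the components with and without \<open>A\<close> removed can be counted with
  representatives from one common set of points.\<close>

lemma component_meets: "connected_component_set (sphere 0 1 - K) ` (sphere 0 1 - (K \<union> A)) = components (sphere 0 1 - K)"
proof
  show "connected_component_set (sphere 0 1 - K) ` (sphere 0 1 - (K \<union> A)) \<subseteq> components (sphere 0 1 - K)"
    unfolding components_def by blast
  show "components (sphere 0 1 - K) \<subseteq> connected_component_set (sphere 0 1 - K) ` (sphere 0 1 - (K \<union> A))"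
  proof
    fix C assume C: "C \<in> components (sphere 0 1 - K)"
    have "C \<noteq> {}" using C in_components_nonempty by blast
    then have "\<not> C \<subseteq> A"
      using surface_open_not_in_arc[OF surf arc sphere_component_open[OF open_compl C]] by blast
    then obtain x where x: "x \<in> C" "x \<notin> A" by blast
    have "x \<in> sphere 0 1 - K" using C x(1) in_components_subset by blast
    moreover have "C = connected_component_set (sphere 0 1 - K) x"
      using C x(1) by (metis components_iff connected_component_eq)
    ultimately show "C \<in> connected_component_set (sphere 0 1 - K) ` (sphere 0 1 - (K \<union> A))" using x(2) by blast
  qed
qed

lemma components_mono:
  assumes fin: "finite (components (sphere 0 1 - (K \<union> A)))"
  shows "finite (components (sphere 0 1 - K))"
    "card (components (sphere 0 1 - K)) \<le> card (components (sphere 0 1 - (K \<union> A)))"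
    "x \<in> sphere 0 1 - (K \<union> A) \<Longrightarrow> y \<in> sphere 0 1 - (K \<union> A) \<Longrightarrow> connected_component (sphere 0 1 - K) x y \<Longrightarrow>
      \<not> connected_component (sphere 0 1 - (K \<union> A)) x y \<Longrightarrow>
      card (components (sphere 0 1 - K)) < card (components (sphere 0 1 - (K \<union> A)))"
proof -
  let ?B = "sphere 0 1 - K" and ?A = "sphere 0 1 - (K \<union> A)"
  have fin': "finite (connected_component_set ?A ` ?A)" using fin unfolding components_def .
  have co': "connected_component_set ?B v = connected_component_set ?B w"
    if "v \<in> ?A" "w \<in> ?A" "connected_component_set ?A v = connected_component_set ?A w" for v w
  proof -
    have "w \<in> connected_component_set ?A v" unfolding that(3) using connected_component_refl[OF that(2)] by simp
    then have "connected_component ?A v w" by simp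
    then have "connected_component ?B v w" by (rule connected_component_of_subset) blast
    then show ?thesis by (simp add: connected_component_eq)
  qed
  have co: "\<forall>v\<in>?A. \<forall>w\<in>?A. connected_component_set ?A v = connected_component_set ?A w \<longrightarrow>
      connected_component_set ?B v = connected_component_set ?B w"
    using co' by blast
  note c = card_image_coarser[where f="connected_component_set ?A" and V="?A" and g="connected_component_set ?B", OF fin' co]
  show "finite (components ?B)" "card (components ?B) \<le> card (components ?A)"
    unfolding component_meets[symmetric] components_def[of ?A] by (rule c(1), rule c(2))
  assume xy: "x \<in> ?A" "y \<in> ?A" "connected_component ?B x y" "\<not> connected_component ?A x y"
  have "connected_component_set ?B x = connected_component_set ?B y"
    using xy(3) by (simp add: connected_component_eq)
  moreover have "connected_component_set ?A x \<noteq> connected_component_set ?A y"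
  proof
    assume "connected_component_set ?A x = connected_component_set ?A y"
    then have "y \<in> connected_component_set ?A x" using connected_component_refl[OF xy(2)] by simp
    then show False using xy(4) by simp
  qed
  ultimately have "card (connected_component_set ?B ` ?A) < card (connected_component_set ?A ` ?A)"
    using c(3)[OF xy(1,2)] by blast
  then show "card (components ?B) < card (components ?A)"
    unfolding component_meets[symmetric] components_def[of ?A] .
qed

text \<open>A path from \<open>u\<close> to \<open>v\<close> in \<open>K\<close> closes the arc up to a Jordan curve, and both of its sides meet every
  neighbourhood of an inner point of the arc.\<close>

lemma components_increase:
  assumes fin: "finite (components (sphere 0 1 - (K \<union> A)))" and pc: "path_component K u v"
  shows "card (components (sphere 0 1 - K)) < card (components (sphere 0 1 - (K \<union> A)))"
proof -
  let ?S = "sphere (0::'n) 1"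
  have uv: "u \<noteq> v" using arc_joining_basics(3)[OF arc] .
  obtain q where q: "arc q" "path_image q = A" "pathstart q = u" "pathfinish q = v"
    using arc_joining_top_of_set[OF arc] by blast
  have "u \<in> path_component_set K u" "v \<in> path_component_set K u"
    using pc path_component_mem(1)[OF pc] by (auto simp: path_component_refl)
  moreover have "path_connected (path_component_set K u)" by simp
  \<comment> \<open>Path connectedness supplies an arc inside \<open>K\<close>, as a Jordan curve
    requires; this is why the pieces of the drawing are counted as path components.\<close>
  ultimately obtain g where g: "arc g" "path_image g \<subseteq> path_component_set K u" "pathstart g = u" "pathfinish g = v"
    using uv unfolding path_connected_arcwise by blast
  have gK: "path_image g \<subseteq> K" using g(2) path_component_subset by blast
  define c where "c = path_image g \<union> A"
  have sp: "simple_path (g +++ reversepath q)"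
    by (rule simple_path_join_loop) (use g q gK KA arc_reversepath in auto)
  have ci: "path_image (g +++ reversepath q) = c"
    using g q by (subst path_image_join) (auto simp: c_def)
  have hc: "c homeomorphic sphere (0::complex) 1"
    using homeomorphic_simple_path_image_circle[OF sp, of 1 0] g q unfolding ci by simp
  have cS: "c \<subseteq> ?S" unfolding c_def using gK K(2) A_subset by blast
  obtain A1 B1 where AB: "openin (top_of_set ?S) A1" "openin (top_of_set ?S) B1"
    "A1 \<inter> B1 = {}" "A1 \<union> B1 = ?S - c" "c \<subseteq> closure A1" "c \<subseteq> closure B1"
    using Jordan_curve_sphere[OF dim cS hc] by blast
  have "infinite A" using arc_joining_basics(7)[OF arc] .
  then have "\<not> A \<subseteq> {u, v}" using finite_subset by blast
  then obtain p where p: "p \<in> A" "p \<notin> K" using KA by blast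
  have pB: "p \<in> ?S - K" using p A_subset by blast
  define C where "C = connected_component_set (?S - K) p"
  have C: "C \<in> components (?S - K)" using pB unfolding C_def components_def by blast
  have pC: "p \<in> C" using pB unfolding C_def by (simp add: connected_component_refl)
  have CB: "C \<subseteq> ?S - K" using C in_components_subset by blast
  obtain T where T: "open T" "C = ?S \<inter> T" using sphere_component_open[OF open_compl C] by (auto simp: openin_open)
  have "p \<in> closure A1" "p \<in> closure B1" using AB(5,6) p(1) unfolding c_def by blast+
  moreover have "p \<in> T" using pC T(2) by blast
  ultimately have "T \<inter> A1 \<noteq> {}" "T \<inter> B1 \<noteq> {}"
    using open_Int_closure_eq_empty[OF T(1), of A1] open_Int_closure_eq_empty[OF T(1), of B1] by blast+
  then obtain x y where x: "x \<in> T" "x \<in> A1" and y: "y \<in> T" "y \<in> B1" by blast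
  have xS: "x \<in> ?S - c" and yS: "y \<in> ?S - c" using AB(4) x y by blast+
  have xC: "x \<in> C" and yC: "y \<in> C" using x y xS yS T(2) by blast+
  have xA: "x \<in> ?S - (K \<union> A)" and yA: "y \<in> ?S - (K \<union> A)" using xC yC CB xS yS unfolding c_def by blast+
  have "connected_component (?S - K) x y"
    using xC yC unfolding C_def by (metis connected_component_sym connected_component_trans mem_Collect_eq)
  \<comment> \<open>A connected set off \<open>K\<close> and \<open>A\<close> avoids the Jordan
    curve and stays on one side of it.\<close>
  moreover have "\<not> connected_component (?S - (K \<union> A)) x y"
  proof
    assume "connected_component (?S - (K \<union> A)) x y"
    then obtain D where D: "connected D" "D \<subseteq> ?S - (K \<union> A)" "x \<in> D" "y \<in> D"
      unfolding connected_component_def by blast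
    have "connectedin (top_of_set ?S) D" using D by (auto simp: connectedin_subtopology)
    moreover have "D \<subseteq> A1 \<union> B1" unfolding AB(4) c_def using D(2) gK by blast
    ultimately show False
      using connectedinD[OF _ AB(1,2)] AB(3) x(2) y(2) D(3,4) by blast
  qed
  ultimately show ?thesis using components_mono(3)[OF fin xA yA] by blast
qed

text \<open>The number of faces minus the number of classes of vertices in the same path component grows by
  at least one with every new arc.\<close>

lemma Euler_step:
  assumes V: "finite V" "u \<in> V" "v \<in> V" "V \<subseteq> K"
    and fin: "finite (components (sphere 0 1 - (K \<union> A)))"
  shows "card (components (sphere 0 1 - K)) + card (path_component_set (K \<union> A) ` V) + 1
      \<le> card (components (sphere 0 1 - (K \<union> A))) + card (path_component_set K ` V)"
proof -
  have fin': "finite (path_component_set K ` V)" using V(1) by simp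
  have co': "path_component_set (K \<union> A) x = path_component_set (K \<union> A) y"
    if "x \<in> V" "y \<in> V" "path_component_set K x = path_component_set K y" for x y
  proof -
    have "y \<in> path_component_set K x" unfolding that(3) using path_component_refl[OF subsetD[OF V(4) that(2)]] by simp
    then have "path_component K x y" by simp
    then have "path_component (K \<union> A) x y" by (rule path_component_of_subset[rotated]) blast
    then show ?thesis by (simp add: path_component_eq)
  qed
  have co: "\<forall>x\<in>V. \<forall>y\<in>V. path_component_set K x = path_component_set K y \<longrightarrow>
      path_component_set (K \<union> A) x = path_component_set (K \<union> A) y"
    using co' by blast
  note c = card_image_coarser[where f="path_component_set K" and V=V and g="path_component_set (K \<union> A)", OF fin' co]
  show ?thesis
  \<comment> \<open>Either the arc closes a cycle and the number of faces grows, or it joins two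
    path components and the number of classes drops.\<close>
  proof (cases "path_component K u v")
    case True
    then show ?thesis using components_increase[OF fin] c(2) by linarith
  next
    case False
    obtain q where q: "arc q" "path_image q = A" "pathstart q = u" "pathfinish q = v"
      using arc_joining_top_of_set[OF arc] by blast
    then have "path_component (K \<union> A) u v" unfolding path_component_def by (metis arc_imp_path sup_ge2)
    then have "path_component_set (K \<union> A) u = path_component_set (K \<union> A) v" by (simp add: path_component_eq)
    moreover have "path_component_set K u \<noteq> path_component_set K v"
    proof
      assume "path_component_set K u = path_component_set K v"
      then have "v \<in> path_component_set K u" using path_component_refl[OF subsetD[OF V(4,3)]] by simp
      then show False using False by simp
    qed
    ultimately have "card (path_component_set (K \<union> A) ` V) < card (path_component_set K ` V)"
      using c(3)[OF V(2,3)] by blast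
    then show ?thesis using components_mono(2)[OF fin] by linarith
  qed
qed

end

text \<open>All vertices are present from the start, and edges are added one by one. The invariant
  has 1 in place of 2 because it also counts the path classes of the vertices, and at least one
  class is left in the end.\<close>

lemma Euler_inequality_sphere:
  fixes V :: "'n::euclidean_space set"
  assumes dim: "DIM('n) = 3" and g: "simple_graph V E" and emb: "embedding (top_of_set (sphere 0 1)) V E \<gamma>"
    and fin: "finite (faces (top_of_set (sphere 0 1)) V E \<gamma>)" and ne: "V \<noteq> {}"
  shows "card E + 2 \<le> card (faces (top_of_set (sphere 0 1)) V E \<gamma>) + card V"
proof -
  let ?S = "sphere (0::'n) 1"
  have VS: "V \<subseteq> ?S" and earc: "\<And>u v. {u, v} \<in> E \<Longrightarrow> arc_joining (top_of_set ?S) u v (\<gamma> {u, v})"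
    and eV: "\<And>e. e \<in> E \<Longrightarrow> \<gamma> e \<inter> V = e"
    and ee: "\<And>e e'. e \<in> E \<Longrightarrow> e' \<in> E \<Longrightarrow> e \<noteq> e' \<Longrightarrow> \<gamma> e \<inter> \<gamma> e' = e \<inter> e'"
    using emb unfolding embedding_def by auto
  have finV: "finite V" and edge: "\<And>e. e \<in> E \<Longrightarrow> e \<subseteq> V \<and> card e = 2"
    using g unfolding simple_graph_def by auto
  have "E \<subseteq> Pow V" using edge by blast
  then have finE: "finite E" using finV finite_subset by auto
  define K where "K D = V \<union> \<Union>(\<gamma> ` D)" for D
  have doubleton: "\<exists>u v. e = {u, v} \<and> arc_joining (top_of_set ?S) u v (\<gamma> e)" if "e \<in> E" for e
    using edge[OF that] earc that by (metis card_2_iff)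
  have ecl: "closed (\<gamma> e)" "\<gamma> e \<subseteq> ?S" if e: "e \<in> E" for e
  proof -
    obtain u v where a: "arc_joining (top_of_set ?S) u v (\<gamma> e)" using doubleton[OF e] by blast
    show "\<gamma> e \<subseteq> ?S" using arc_joining_basics(4)[OF a] by simp
    have "compact (\<gamma> e)" using arc_joining_basics(5)[OF a] by (simp add: compactin_subtopology)
    then show "closed (\<gamma> e)" by (rule compact_imp_closed)
  qed
  \<comment> \<open>Finiteness is only known for the full graph; as a premise of the implication it
    passes down to fewer edges by \<open>components_mono\<close>.\<close>
  have main: "finite (components (?S - K D)) \<longrightarrow>
      card D + card (path_component_set (K D) ` V) + 1 \<le> card (components (?S - K D)) + card V"
    if "D \<subseteq> E" for D
    using finite_subset[OF that finE] that
  proof (induction D rule: finite_induct)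
    case empty
    \<comment> \<open>The base case needs one face: finitely many points cannot exhaust the sphere,
      since a finite connected set has at most one point.\<close>
    have "?S \<noteq> V"
    proof
      assume "?S = V"
      then have "finite (?S)" using finV by simp
      moreover have "connected ?S" using connected_sphere[of "0::'n" 1] dim by simp
      ultimately have "?S = {} \<or> (\<exists>a. ?S = {a})" using connected_finite_iff_sing by blast
      then obtain a where a: "?S = {a}" by auto
      obtain b :: 'n where "b \<in> Basis" by (meson nonempty_Basis ex_in_conv)
      then have "b \<in> ?S" "- b \<in> ?S" by auto
      then have "b = - b" using a by auto
      then have "2 *\<^sub>R b = 0" by (metis add.right_inverse scaleR_2)
      then show False using \<open>b \<in> Basis\<close> by auto
    qed
    then have "?S - K {} \<noteq> {}" using VS by (auto simp: K_def)
    then have "components (?S - K {}) \<noteq> {}" by (simp add: components_eq_empty)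
    then have "card (components (?S - K {})) > 0" if "finite (components (?S - K {}))"
      using that unfolding card_gt_0_iff by blast
    moreover have "card (path_component_set (K {}) ` V) \<le> card V" using card_image_le finV by blast
    ultimately show ?case by (simp only: card.empty) linarith
  next
    case (insert e D)
    have e: "e \<in> E" and D: "D \<subseteq> E" using insert.prems by auto
    obtain u v where uv: "e = {u, v}" "arc_joining (top_of_set ?S) u v (\<gamma> e)" using doubleton[OF e] by blast
    have Ke: "K (insert e D) = K D \<union> \<gamma> e" unfolding K_def by auto
    have int: "K D \<inter> \<gamma> e = {u, v}"
    proof -
      have "\<gamma> d \<inter> \<gamma> e \<subseteq> e" if "d \<in> D" for d using ee[of d e] that D e insert.hyps(2) by blast
      then show ?thesis using eV[OF e] uv(1) unfolding K_def by blast
    qed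
    have "closed (\<Union>(\<gamma> ` D))" using insert.hyps(1) ecl(1) D by (intro closed_UN) auto
    then have "closed (K D)" unfolding K_def using finV by (simp add: closed_Un finite_imp_closed)
    moreover have "K D \<subseteq> ?S" unfolding K_def using VS ecl(2) D by blast
    ultimately interpret sphere_arc "K D" "\<gamma> e" u v
      using dim uv(2) int by unfold_locales
    show ?case
    proof
      assume fin: "finite (components (?S - K (insert e D)))"
      have "V \<subseteq> K D" "u \<in> V" "v \<in> V" using edge[OF e] uv(1) unfolding K_def by auto
      from Euler_step[OF finV this(2,3,1)] fin
      have "card (components (?S - K D)) + card (path_component_set (K (insert e D)) ` V) + 1
        \<le> card (components (?S - K (insert e D))) + card (path_component_set (K D) ` V)"
        unfolding Ke by blast
      moreover have "card D + card (path_component_set (K D) ` V) + 1 \<le> card (components (?S - K D)) + card V"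
        using insert.IH[OF D] components_mono(1) fin unfolding Ke by blast
      moreover have "card (insert e D) = card D + 1" using insert.hyps by simp
      ultimately show "card (insert e D) + card (path_component_set (K (insert e D)) ` V) + 1
        \<le> card (components (?S - K (insert e D))) + card V" by linarith
    qed
  qed
  have fc: "faces (top_of_set ?S) V E \<gamma> = components (?S - K E)"
    unfolding faces_def K_def
    by (simp add: subtopology_subtopology Int_absorb1 connected_components_of_top_of_set)
  have "card (path_component_set (K E) ` V) \<noteq> 0" using finV ne by simp
  then show ?thesis using main[OF subset_refl] fin unfolding fc by linarith
qed

section \<open>Face-simple quadrangulations of the sphere\<close>

text \<open>A boundary point of a closed disc has no neighbourhood inside the disc: invariance of
  domain would map that neighbourhood to an open planar subset of the closed unit disc, which lies
  in the open one. This forces a second face at every edge.\<close>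

lemma bounded_by_open_subset:
  assumes X: "closed_surface X" and b: "bounded_by X F C" and U: "openin X U" "U \<subseteq> F \<union> C"
  shows "U \<subseteq> F"
proof -
  obtain h where h: "homeomorphic_map (top_of_set (cball (0::complex) 1)) (subtopology X (X closure_of F)) h"
    and F: "h ` ball 0 1 = F" and C: "h ` sphere 0 1 = C"
    using b unfolding bounded_by_def by blast
  obtain k where hk: "homeomorphic_maps (top_of_set (cball (0::complex) 1)) (subtopology X (F \<union> C)) h k"
    using h homeomorphic_map_maps bounded_by_basics(1)[OF b] by metis
  have FC: "F \<union> C \<subseteq> topspace X" using bounded_by_basics(3,4)[OF b] by blast
  have k: "continuous_map (subtopology X (F \<union> C)) (top_of_set (cball 0 1)) k"
    and hk': "\<And>x. x \<in> F \<union> C \<Longrightarrow> h (k x) = x" and kC: "k ` (F \<union> C) \<subseteq> cball 0 1"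
    using hk FC unfolding homeomorphic_maps_def continuous_map_def by auto
  have "continuous_map (subtopology X U) euclidean k"
    using continuous_map_from_subtopology_mono[OF continuous_map_into_fulltopology[OF k] U(2)] .
  moreover have "inj_on k U" using hk' U(2) by (intro inj_on_inverseI[of _ h]) blast
  ultimately have "open (k ` U)" by (rule surface_invariance_of_domain_from[OF X U(1)])
  moreover have "k ` U \<subseteq> cball 0 1" using kC U(2) by blast
  ultimately have "k ` U \<subseteq> interior (cball 0 1)" by (rule interior_maximal[rotated])
  then have "k ` U \<subseteq> ball 0 1" by simp
  show "U \<subseteq> F"
  proof
    fix x assume x: "x \<in> U"
    have "k x \<in> ball 0 1" using \<open>k ` U \<subseteq> ball 0 1\<close> x by blast
    then have "h (k x) \<in> F" using F by blast
    then show "x \<in> F" using hk'[OF subsetD[OF U(2) x]] by simp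
  qed
qed

lemma surface_singleton_interior:
  assumes X: "closed_surface X" and v: "v \<in> topspace X"
  shows "X interior_of {v} = {}"
proof (rule surface_open_not_in_thin[OF X])
  show "subtopology X {v} homeomorphic_space top_of_set {0::complex}"
    unfolding homeomorphic_space_def homeomorphic_maps_def
    by (rule exI[of _ "\<lambda>_. 0"], rule exI[of _ "\<lambda>_. v"])
      (use v in \<open>auto simp: continuous_map_in_subtopology\<close>)
qed (auto simp: interior_of_subset)

lemma openin_meets_closure_of: "p \<in> X closure_of S \<Longrightarrow> openin X T \<Longrightarrow> p \<in> T \<Longrightarrow> S \<inter> T \<noteq> {}"
  by (auto simp: in_closure_of)

context quadrangulation
begin

lemma vertices_subset_topspace: "V \<subseteq> topspace X"
  using embedding unfolding embedding_def by simp

text \<open>Points and arcs are closed with empty interior, and finite unions inherit both. This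
  makes the faces dense.\<close>

lemma graph_interior: "closedin X (V \<union> \<Union>(\<gamma> ` E))" "X interior_of (V \<union> \<Union>(\<gamma> ` E)) = {}"
proof -
  have 1: "closedin X W \<and> X interior_of W = {}" if "finite W" "W \<subseteq> V" for W
    using that
  proof (induction W rule: finite_induct)
    case (insert v W)
    have v: "v \<in> topspace X" using insert.prems vertices_subset_topspace by blast
    have cv: "closedin X {v}" by (rule closedin_Hausdorff_singleton[OF Hausdorff v])
    have W: "closedin X W" "X interior_of W = {}" using insert by auto
    have "X interior_of ({v} \<union> W) = {}"
      using interior_of_closedin_union_empty_interior_of[OF cv W(2)] surface_singleton_interior[OF surface v] by simp
    then show ?case using closedin_Un[OF cv W(1)] by simp
  qed simp
  have 2: "closedin X (V \<union> \<Union>(\<gamma> ` D)) \<and> X interior_of (V \<union> \<Union>(\<gamma> ` D)) = {}" if "finite D" "D \<subseteq> E" for D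
    using that
  proof (induction D rule: finite_induct)
    case empty
    show ?case using 1[OF finite_graph(1)] by simp
  next
    case (insert e D)
    have e: "e \<in> E" using insert.prems by blast
    obtain u v where arc: "arc_joining X u v (\<gamma> e)" using e by (rule edge_doubleton)
    have ce: "closedin X (\<gamma> e)" using arc_joining_closedin[OF Hausdorff arc] .
    have ie: "X interior_of (\<gamma> e) = {}"
      by (rule surface_open_not_in_arc[OF surface arc]) (auto simp: interior_of_subset)
    have D: "closedin X (V \<union> \<Union>(\<gamma> ` D))" "X interior_of (V \<union> \<Union>(\<gamma> ` D)) = {}" using insert by auto
    have "X interior_of (\<gamma> e \<union> (V \<union> \<Union>(\<gamma> ` D))) = {}"
      using interior_of_closedin_union_empty_interior_of[OF ce D(2)] ie by simp
    moreover have "V \<union> \<Union>(\<gamma> ` insert e D) = \<gamma> e \<union> (V \<union> \<Union>(\<gamma> ` D))" by auto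
    ultimately show ?case using closedin_Un[OF ce D(1)] by simp
  qed
  show "closedin X (V \<union> \<Union>(\<gamma> ` E))" "X interior_of (V \<union> \<Union>(\<gamma> ` E)) = {}"
    using 2[OF finite_graph(2)] by auto
qed

lemma edge_inner_point:
  assumes "e \<in> E"
  obtains p where "p \<in> \<gamma> e" "p \<notin> e"
proof -
  have "\<not> \<gamma> e \<subseteq> e" using infinite_edge[OF assms] edge_subset(2)[OF assms] finite_subset by blast
  then show ?thesis using that by blast
qed

text \<open>Two of the faces and the inner part of the edge form an open set. A third face with an
  inner point of the edge in its closure would have to meet this set.\<close>

lemma edge_not_in_three_frontiers:
  assumes e: "e \<in> E"
    and F: "F \<in> faces X V E \<gamma>" "F' \<in> faces X V E \<gamma>" "G \<in> faces X V E \<gamma>" "F \<noteq> F'" "F \<noteq> G" "F' \<noteq> G"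
    and fr: "\<gamma> e \<subseteq> X frontier_of F" "\<gamma> e \<subseteq> X frontier_of F'" "\<gamma> e \<subseteq> X frontier_of G"
  shows False
proof -
  obtain a b where ab: "e = {a, b}" using e by (rule edge_doubleton)
  obtain c d where q: "quad_face F a b c d" using quad_face_at_edge[OF F(1)] e fr(1) unfolding ab by blast
  obtain c' d' where q': "quad_face F' a b c' d'" using quad_face_at_edge[OF F(2)] e fr(2) unfolding ab by blast
  have op: "openin X (F \<union> F' \<union> (\<gamma> e - e))" using shared_edge_open[OF q q' F(4)] unfolding ab .
  obtain p where p: "p \<in> \<gamma> e" "p \<notin> e" using e by (rule edge_inner_point)
  have "p \<in> X closure_of G" using subsetD[OF fr(3) p(1)] unfolding frontier_of_def by simp
  then have "G \<inter> (F \<union> F' \<union> (\<gamma> e - e)) \<noteq> {}" by (rule openin_meets_closure_of[OF _ op]) (use p in simp)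
  then show False
    using faces_disjoint[OF F(1,3,5)] faces_disjoint[OF F(2,3,6)] face_disjoint_graph(2)[OF F(3) e] by blast
qed

text \<open>Finiteness is a separate claim: \<open>card\<close> of an infinite set is
  \<open>0\<close>, so the bound alone would say nothing then. Excluding three-element subsets gives
  both.\<close>

lemma finite_faces_at_edge:
  assumes e: "e \<in> E"
  shows "finite {F \<in> faces X V E \<gamma>. \<gamma> e \<subseteq> X frontier_of F}" "card {F \<in> faces X V E \<gamma>. \<gamma> e \<subseteq> X frontier_of F} \<le> 2"
proof -
  let ?S = "{F \<in> faces X V E \<gamma>. \<gamma> e \<subseteq> X frontier_of F}"
  have no3: "\<not> (\<exists>T\<subseteq>?S. card T = 3)"
  proof
    assume "\<exists>T\<subseteq>?S. card T = 3"
    then obtain T where T: "T \<subseteq> ?S" "card T = 3" by blast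
    then obtain F F' G where "T = {F, F', G}" "F \<noteq> F'" "F' \<noteq> G" "F \<noteq> G" unfolding card_3_iff by blast
    then show False using edge_not_in_three_frontiers[OF e, of F F' G] T(1) by blast
  qed
  show fin: "finite ?S"
  proof (rule ccontr)
    assume "infinite ?S"
    then obtain B where "finite B \<and> card B = 3 \<and> B \<subseteq> ?S" using infinite_arbitrarily_large by meson
    then show False using no3 by meson
  qed
  show "card ?S \<le> 2"
  proof (rule ccontr)
    assume "\<not> card ?S \<le> 2"
    then have "3 \<le> card ?S" by simp
    then obtain T where "T \<subseteq> ?S" "card T = 3" by (rule obtain_subset_with_card_n)
    then show False using no3 by meson
  qed
qed

text \<open>Every face lies at some edge, and there are finitely many edges with finitely many faces
  each.\<close>

lemma finite_faces: "finite (faces X V E \<gamma>)"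
proof (rule finite_subset)
  show "faces X V E \<gamma> \<subseteq> (\<Union>e\<in>E. {F \<in> faces X V E \<gamma>. \<gamma> e \<subseteq> X frontier_of F})"
  proof
    fix F assume F: "F \<in> faces X V E \<gamma>"
    then obtain a b c d where q: "quad_face F a b c d" using ex_quad_face by blast
    then have "{a, b} \<in> E" "\<gamma> {a, b} \<subseteq> X frontier_of F"
      using frontier_quad_face[OF q] unfolding quad_face_def by auto
    then show "F \<in> (\<Union>e\<in>E. {F \<in> faces X V E \<gamma>. \<gamma> e \<subseteq> X frontier_of F})"
      by (intro UN_I[of "{a, b}"]) (simp_all add: F)
  qed
qed (use finite_graph(2) finite_faces_at_edge(1) in auto)

text \<open>A finite union of closures is closed; its complement is an open part of the graph, which
  has empty interior.\<close>

lemma faces_dense: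
  assumes "p \<in> topspace X"
  obtains F where "F \<in> faces X V E \<gamma>" "p \<in> X closure_of F"
proof -
  let ?D = "\<Union>((closure_of) X ` faces X V E \<gamma>)"
  have "closedin X ?D" using finite_faces by (intro closedin_Union) auto
  then have op: "openin X (topspace X - ?D)" by blast
  have "F \<subseteq> X closure_of F" if "F \<in> faces X V E \<gamma>" for F
    using openin_subset[OF face_basics(1)[OF that]] by (rule closure_of_subset)
  then have "\<Union>(faces X V E \<gamma>) \<subseteq> ?D" by blast
  then have "topspace X - ?D \<subseteq> V \<union> \<Union>(\<gamma> ` E)" unfolding Union_faces by blast
  then have "topspace X - ?D \<subseteq> X interior_of (V \<union> \<Union>(\<gamma> ` E))" using op interior_of_maximal by blast
  then have "p \<in> ?D" using assms graph_interior(2) by blast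
  then show ?thesis using that by blast
qed

lemma closure_face: "quad_face F a b c d \<Longrightarrow> X closure_of F = F \<union> X frontier_of F"
  using bounded_by_basics(1) bounded_by_surface(2)[OF surface] unfolding quad_face_def by metis

text \<open>A vertex in the closure of a face lies on the boundary arcs, and these contain no
  vertices but the corners.\<close>

lemma vertex_on_face:
  assumes v: "v \<in> V"
  obtains F b c d where "quad_face F v b c d"
proof -
  have "v \<in> topspace X" using vertices_subset_topspace v by blast
  then obtain F where F: "F \<in> faces X V E \<gamma>" "v \<in> X closure_of F" by (rule faces_dense)
  obtain a b c d where q: "quad_face F a b c d" using ex_quad_face[OF F(1)] by blast
  have E: "{a, b} \<in> E" "{b, c} \<in> E" "{c, d} \<in> E" "{d, a} \<in> E" using q unfolding quad_face_def by auto
  have "v \<in> \<gamma> {a, b} \<union> \<gamma> {b, c} \<union> \<gamma> {c, d} \<union> \<gamma> {d, a}"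
    using F(2) closure_face[OF q] frontier_quad_face[OF q] face_disjoint_graph(1)[OF F(1)] v by blast
  then have "v \<in> {a, b} \<union> {b, c} \<union> {c, d} \<union> {d, a}"
    using edge_vertices[OF E(1)] edge_vertices[OF E(2)] edge_vertices[OF E(3)] edge_vertices[OF E(4)] v by blast
  then have "v = a \<or> v = b \<or> v = c \<or> v = d" by blast
  then have "\<exists>b c d. quad_face F v b c d"
  proof (elim disjE)
    assume "v = a" then show ?thesis using q by blast
  next
    assume "v = b" then show ?thesis using quad_face_rotate[OF q] by blast
  next
    assume "v = c" then show ?thesis using quad_face_rotate[OF quad_face_rotate[OF q]] by blast
  next
    assume "v = d" then show ?thesis using quad_face_rotate[OF quad_face_rotate[OF quad_face_rotate[OF q]]] by blast
  qed
  then show ?thesis using that by blast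
qed

text \<open>If no other face came near an inner point of the edge, that point would have a
  neighbourhood in the closed disc of \<open>F\<close>, although it lies on the boundary of this
  disc.\<close>

lemma edge_other_face:
  assumes q: "quad_face F a b c d"
  obtains F' where "F' \<in> faces X V E \<gamma>" "F' \<noteq> F" "\<gamma> {a, b} \<subseteq> X frontier_of F'"
proof -
  have e: "{a, b} \<in> E" using q unfolding quad_face_def by blast
  obtain p where p: "p \<in> \<gamma> {a, b}" "p \<notin> {a, b}" using e by (rule edge_inner_point)
  have pX: "p \<in> topspace X" using edge_subset_topspace[OF e] p(1) by blast
  let ?D = "\<Union>((closure_of) X ` (faces X V E \<gamma> - {F}))"
  have "p \<in> ?D"
  proof (rule ccontr)
    assume np: "p \<notin> ?D"
    have "closedin X ?D" using finite_faces by (intro closedin_Union) auto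
    then have op: "openin X (topspace X - ?D)" by blast
    have "topspace X - ?D \<subseteq> X closure_of F"
    proof
      fix x assume x: "x \<in> topspace X - ?D"
      then obtain G where "G \<in> faces X V E \<gamma>" "x \<in> X closure_of G" using faces_dense by blast
      then show "x \<in> X closure_of F" using x by blast
    qed
    then have "topspace X - ?D \<subseteq> F"
      using bounded_by_open_subset[OF surface _ op] q bounded_by_basics(1) unfolding quad_face_def by metis
    then have "p \<in> F" using np pX by blast
    then show False using face_disjoint_graph(2)[OF quad_face_face[OF q] e] p(1) by blast
  qed
  then obtain F' where F': "F' \<in> faces X V E \<gamma>" "F' \<noteq> F" "p \<in> X closure_of F'" by blast
  obtain x y z w where q': "quad_face F' x y z w" using ex_quad_face[OF F'(1)] by blast
  have "p \<notin> F'" using face_disjoint_graph(2)[OF F'(1) e] p(1) by blast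
  then have "p \<in> \<gamma> {x, y} \<union> \<gamma> {y, z} \<union> \<gamma> {z, w} \<union> \<gamma> {w, x}"
    using F'(3) closure_face[OF q'] frontier_quad_face[OF q'] by blast
  moreover have "{x, y} \<in> E" "{y, z} \<in> E" "{z, w} \<in> E" "{w, x} \<in> E" using q' unfolding quad_face_def by blast+
  moreover have "\<gamma> {x, y} \<subseteq> X frontier_of F'" "\<gamma> {y, z} \<subseteq> X frontier_of F'"
    "\<gamma> {z, w} \<subseteq> X frontier_of F'" "\<gamma> {w, x} \<subseteq> X frontier_of F'"
    unfolding frontier_quad_face[OF q'] by blast+
  ultimately obtain e' where e': "e' \<in> E" "p \<in> \<gamma> e'" "\<gamma> e' \<subseteq> X frontier_of F'" by (elim UnE) metis+
  \<comment> \<open>Distinct edges meet only in common ends, and \<open>p\<close> is an inner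
    point.\<close>
  have "e' = {a, b}"
  proof (rule ccontr)
    assume "e' \<noteq> {a, b}"
    then show False using edge_Int[OF e'(1) e] p e'(2) by blast
  qed
  then have "\<gamma> {a, b} \<subseteq> X frontier_of F'" using e'(3) by simp
  then show ?thesis using that F' by blast
qed

text \<open>Two faces share the edge vb, and each has one more edge at \<open>v\<close>. If these
  were equal, the faces would share two edges.\<close>

lemma face_simple_degree:
  assumes fs: "face_simple X V E \<gamma>" and v: "v \<in> V"
  shows "3 \<le> card {e \<in> E. v \<in> e}"
proof -
  obtain F b c d where q: "quad_face F v b c d" using v by (rule vertex_on_face)
  obtain F' where F': "F' \<in> faces X V E \<gamma>" "F' \<noteq> F" "\<gamma> {v, b} \<subseteq> X frontier_of F'"
    using q by (rule edge_other_face)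
  have E: "{v, b} \<in> E" "{d, v} \<in> E" and dist: "distinct [v, b, c, d]" using q unfolding quad_face_def by auto
  obtain c' d' where q': "quad_face F' v b c' d'" using quad_face_at_edge[OF F'(1) E(1) F'(3)] by blast
  have E': "{d', v} \<in> E" and dist': "distinct [v, b, c', d']" using q' unfolding quad_face_def by auto
  have "d' \<noteq> d"
  proof
    assume "d' = d"
    let ?S = "{e \<in> E. \<gamma> e \<subseteq> X frontier_of F' \<and> \<gamma> e \<subseteq> X frontier_of F}"
    have "{{v, b}, {d, v}} \<subseteq> ?S"
      using E frontier_quad_face[OF q] frontier_quad_face[OF q'] \<open>d' = d\<close> by auto
    then have "card {{v, b}, {d, v}} \<le> card ?S" using finite_graph(2) by (intro card_mono) auto
    moreover have "card {{v, b}, {d, v}} = 2" using dist by (auto simp: card_2_iff doubleton_eq_iff)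
    moreover have "card ?S \<le> 1" using fs F'(1,2) quad_face_face[OF q] unfolding face_simple_def by blast
    ultimately show False by simp
  qed
  then have "card {{v, b}, {d, v}, {d', v}} = 3"
    using dist dist' by (auto simp: doubleton_eq_iff card_insert_if)
  moreover have "{{v, b}, {d, v}, {d', v}} \<subseteq> {e \<in> E. v \<in> e}" using E E' by auto
  ultimately show ?thesis using finite_graph(2) card_mono[of "{e \<in> E. v \<in> e}" "{{v, b}, {d, v}, {d', v}}"] by simp
qed

lemma handshake: "(\<Sum>v\<in>V. card {e \<in> E. v \<in> e}) = 2 * card E"
proof -
  have "\<forall>e\<in>E. card {v \<in> V. v \<in> e} = 2"
  proof
    fix e assume e: "e \<in> E"
    then have "{v \<in> V. v \<in> e} = e" using edge_subset(1) by blast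
    then show "card {v \<in> V. v \<in> e} = 2" using graph e unfolding simple_graph_def by simp
  qed
  from sum_multicount_gen[OF finite_graph this] show ?thesis by simp
qed

text \<open>Incidences of edges and faces are counted twice: four for each face, at most two for
  each edge.\<close>

lemma four_faces_le_two_edges: "4 * card (faces X V E \<gamma>) \<le> 2 * card E"
proof -
  have four: "\<forall>F\<in>faces X V E \<gamma>. card {e \<in> E. \<gamma> e \<subseteq> X frontier_of F} = 4"
  proof
    fix F assume F: "F \<in> faces X V E \<gamma>"
    then obtain a b c d where q: "quad_face F a b c d" using ex_quad_face by blast
    have "{e \<in> E. \<gamma> e \<subseteq> X frontier_of F} = {{a, b}, {b, c}, {c, d}, {d, a}}"
      using edge_in_frontier_iff[OF q] q unfolding quad_face_def by blast
    moreover have "card {{a, b}, {b, c}, {c, d}, {d, a}} = 4"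
      using q unfolding quad_face_def by (auto simp: doubleton_eq_iff card_insert_if)
    ultimately show "card {e \<in> E. \<gamma> e \<subseteq> X frontier_of F} = 4" by simp
  qed
  have "(\<Sum>e\<in>E. card {F \<in> faces X V E \<gamma>. \<gamma> e \<subseteq> X frontier_of F}) = (\<Sum>F\<in>faces X V E \<gamma>. 4)"
    by (rule sum_multicount_gen[OF finite_graph(2) finite_faces]) (use four in blast)
  moreover have "(\<Sum>e\<in>E. card {F \<in> faces X V E \<gamma>. \<gamma> e \<subseteq> X frontier_of F}) \<le> (\<Sum>e\<in>E. 2)"
    by (rule sum_mono) (rule finite_faces_at_edge(2))
  ultimately show ?thesis by simp
qed

end

lemma face_simple_quadrangulation_sphere_card:
  fixes V :: "'n::euclidean_space set"
  assumes dim: "DIM('n) = 3" and g: "simple_graph V E"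
    and quad: "quadrangular_embedding (top_of_set (sphere 0 1)) V E \<gamma>"
    and fs: "face_simple (top_of_set (sphere 0 1)) V E \<gamma>"
  shows "8 \<le> card V"
proof -
  let ?X = "top_of_set (sphere (0::'n) 1)"
  interpret quadrangulation ?X V E \<gamma>
    by unfold_locales (rule closed_surface_sphere[OF dim], rule g, rule quad)
  obtain p where "p \<in> topspace ?X" using surface unfolding closed_surface_def by blast
  then obtain F where "F \<in> faces ?X V E \<gamma>" by (rule faces_dense)
  then obtain a b c d where "quad_face F a b c d" using ex_quad_face by blast
  then have "{a, b} \<in> E" unfolding quad_face_def by blast
  then have ne: "V \<noteq> {}" using edge_subset(1) by blast
  have "card E + 2 \<le> card (faces ?X V E \<gamma>) + card V"
    by (rule Euler_inequality_sphere[OF dim g embedding finite_faces ne])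
  moreover have "3 * card V \<le> 2 * card E"
  proof -
    have "(\<Sum>v\<in>V. 3) \<le> (\<Sum>v\<in>V. card {e \<in> E. v \<in> e})"
      by (rule sum_mono) (rule face_simple_degree[OF fs])
    then show ?thesis unfolding handshake by simp
  qed
  \<comment> \<open>From |F| \<le> |E|/2 follows |E| \<le> 2|V| - 4.\<close>
  ultimately show ?thesis using four_faces_le_two_edges by linarith
qed

section \<open>The cube\<close>

abbreviation (input) S2 :: "(real^3) set" where
  "S2 \<equiv> sphere 0 1"

definition radial :: "real^3 \<Rightarrow> real^3" where
  "radial x = x /\<^sub>R norm x"

definition cube_surface :: "(real^3) set" where
  "cube_surface = {w. (\<forall>i. \<bar>w $ i\<bar> \<le> 1) \<and> (\<exists>i. \<bar>w $ i\<bar> = 1)}"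

definition cube_corners :: "(real^3) set" where
  "cube_corners = {w. \<forall>i. \<bar>w $ i\<bar> = 1}"

text \<open>As a function of \<open>t\<close> it is the line through \<open>c\<close> in direction
  \<open>k\<close>. Equality of two such functions identifies the lines, whichever points represent
  them.\<close>

definition set_coord :: "real^3 \<Rightarrow> 3 \<Rightarrow> real \<Rightarrow> real^3" where
  "set_coord c k t = (\<chi> j. if j = k then t else c $ j)"

text \<open>The coordinate \<open>c $ k\<close> is overwritten, so either end of an edge names
  it.\<close>

definition cube_edge :: "3 \<Rightarrow> real^3 \<Rightarrow> (real^3) set" where
  "cube_edge k c = radial ` {set_coord c k (-1), set_coord c k 1}"

definition cube_segment :: "3 \<Rightarrow> real^3 \<Rightarrow> (real^3) set" where
  "cube_segment k c = set_coord c k ` {-1..1}"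

definition cube_V :: "(real^3) set" where
  "cube_V = radial ` cube_corners"

definition cube_E :: "(real^3) set set" where
  "cube_E = {cube_edge k c | k c. c \<in> cube_corners}"

text \<open>The union avoids choosing a representation of the edge as \<open>cube_edge k c\<close>.\<close>

definition cube_arc :: "(real^3) set \<Rightarrow> (real^3) set" where
  "cube_arc e = \<Union>{radial ` cube_segment k c | k c. c \<in> cube_corners \<and> e = cube_edge k c}"

text \<open>Indices of type \<open>3\<close> are added modulo 3, so \<open>i\<close>,
  \<open>i + 1\<close>, \<open>i + 2\<close> are the three axes and one formula covers all six
  facets.\<close>

definition face_point :: "3 \<Rightarrow> real \<Rightarrow> real \<times> real \<Rightarrow> real^3" where
  "face_point i s z = (\<chi> j. if j = i then s else if j = i + 1 then fst z else snd z)"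

definition open_facet :: "3 \<Rightarrow> real \<Rightarrow> (real^3) set" where
  "open_facet i s = {w. w $ i = s \<and> (\<forall>j. j \<noteq> i \<longrightarrow> \<bar>w $ j\<bar> < 1)}"

lemma index_3: "i + 1 \<noteq> i" "i + 2 \<noteq> i" "i + 2 \<noteq> i + 1" "j = i \<or> j = i + 1 \<or> j = i + 2" for i j :: 3
  using exhaust_3[of i] exhaust_3[of j] by auto

lemma set_coord_nth [simp]: "set_coord c k t $ j = (if j = k then t else c $ j)"
  by (simp add: set_coord_def)

lemma face_point_nth: "face_point i s z $ i = s" "face_point i s z $ (i + 1) = fst z" "face_point i s z $ (i + 2) = snd z"
  using index_3(1-3)[of i] by (simp_all add: face_point_def)

lemma face_point_eqI:
  assumes "w $ i = s" "w $ (i + 1) = y" "w $ (i + 2) = z"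
  shows "w = face_point i s (y, z)"
  unfolding vec_eq_iff
proof
  fix j
  show "w $ j = face_point i s (y, z) $ j"
    using index_3(4)[of j i] assms by (auto simp: face_point_nth)
qed

lemma set_coord_face_point:
  "set_coord (face_point i s (y, z)) (i + 1) t = face_point i s (t, z)"
  "set_coord (face_point i s (y, z)) (i + 2) t = face_point i s (y, t)"
  using index_3(1-3)[of i] by (auto intro!: face_point_eqI simp: face_point_nth)

lemma corners_subset: "cube_corners \<subseteq> cube_surface"
  by (auto simp: cube_corners_def cube_surface_def)

lemma set_coord_corner: "c \<in> cube_corners \<Longrightarrow> \<bar>t\<bar> = 1 \<Longrightarrow> set_coord c k t \<in> cube_corners"
  by (auto simp: cube_corners_def)

lemma segment_subset: "c \<in> cube_corners \<Longrightarrow> cube_segment k c \<subseteq> cube_surface"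
proof -
  assume c: "c \<in> cube_corners"
  have "k + 1 \<noteq> k" by (rule index_3)
  then show ?thesis using c by (auto simp: cube_corners_def cube_surface_def cube_segment_def intro!: exI[of _ "k + 1"])
qed

lemma zero_notin_surface: "0 \<notin> cube_surface"
  by (auto simp: cube_surface_def)

lemma radial_scaleR: "0 < a \<Longrightarrow> radial (a *\<^sub>R x) = radial x"
  by (simp add: radial_def)

lemma norm_radial: "x \<noteq> 0 \<Longrightarrow> norm (radial x) = 1"
  by (simp add: radial_def)

lemma continuous_on_radial: "0 \<notin> A \<Longrightarrow> continuous_on A radial"
  unfolding radial_def by (intro continuous_intros) auto

text \<open>A ray from the origin leaves the cube in one point: if x = a y with both of maximum norm
  1, then a = 1.\<close>

lemma inj_on_radial: "inj_on radial cube_surface"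
proof (rule inj_onI)
  fix x y assume x: "x \<in> cube_surface" and y: "y \<in> cube_surface" and e: "radial x = radial y"
  have nz: "x \<noteq> 0" "y \<noteq> 0" using x y zero_notin_surface by auto
  define a where "a = norm x / norm y"
  have a: "a > 0" using nz by (simp add: a_def)
  have "x = norm x *\<^sub>R radial x" using nz by (simp add: radial_def)
  also have "\<dots> = norm x *\<^sub>R radial y" by (simp only: e)
  also have "\<dots> = a *\<^sub>R y" using nz by (simp add: radial_def a_def divide_inverse)
  finally have xy: "x = a *\<^sub>R y" .
  obtain i where i: "\<bar>x $ i\<bar> = 1" using x by (auto simp: cube_surface_def)
  obtain j where j: "\<bar>y $ j\<bar> = 1" using y by (auto simp: cube_surface_def)
  have "\<bar>y $ i\<bar> \<le> 1" "\<bar>x $ j\<bar> \<le> 1" using x y by (auto simp: cube_surface_def)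
  moreover have "\<bar>x $ i\<bar> = a * \<bar>y $ i\<bar>" "\<bar>x $ j\<bar> = a * \<bar>y $ j\<bar>" using a by (simp_all add: xy abs_mult)
  ultimately have "a \<le> 1" "1 \<le> a" using i j a mult_left_le[of "\<bar>y $ i\<bar>" a] by auto
  then show "x = y" using xy by simp
qed

lemma radial_surface: "radial ` cube_surface = S2"
proof
  show "radial ` cube_surface \<subseteq> S2"
  proof (rule image_subsetI)
    fix x assume "x \<in> cube_surface"
    then have "x \<noteq> 0" using zero_notin_surface by blast
    then show "radial x \<in> S2" using norm_radial by simp
  qed
  show "S2 \<subseteq> radial ` cube_surface"
  proof
    fix x :: "real^3" assume x: "x \<in> S2"
    \<comment> \<open>Division by the maximum norm moves a point of the sphere to the cube along its
      ray.\<close>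
    define m where "m = Max (range (\<lambda>i. \<bar>x $ i\<bar>))"
    have le: "\<bar>x $ i\<bar> \<le> m" for i unfolding m_def by (rule Max_ge) auto
    have "m \<in> range (\<lambda>i. \<bar>x $ i\<bar>)" unfolding m_def by (rule Max_in) auto
    then obtain i where i: "m = \<bar>x $ i\<bar>" by blast
    have "m \<noteq> 0"
    proof
      assume "m = 0"
      then have "x $ j = 0" for j using le[of j] by simp
      then have "x = 0" by (simp add: vec_eq_iff)
      then show False using x by simp
    qed
    then have m: "m > 0" using i by simp
    have "x /\<^sub>R m \<in> cube_surface"
      using le m i by (auto simp: cube_surface_def abs_mult field_simps intro!: exI[of _ i])
    moreover have "radial (x /\<^sub>R m) = x" using radial_scaleR[of "inverse m" x] m x by (simp add: radial_def)
    ultimately show "x \<in> radial ` cube_surface" by (metis image_eqI)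
  qed
qed

lemma radial_Int: "A \<subseteq> cube_surface \<Longrightarrow> B \<subseteq> cube_surface \<Longrightarrow> radial ` A \<inter> radial ` B = radial ` (A \<inter> B)"
  using inj_on_image_Int[OF inj_on_radial] by blast

text \<open>The axis of an edge is the only coordinate in which its ends differ, and the other
  coordinates are those of either end.\<close>

lemma cube_edge_eq:
  assumes c: "c \<in> cube_corners" "c' \<in> cube_corners" and e: "cube_edge k c = cube_edge k' c'"
  shows "k = k'" "set_coord c k = set_coord c' k'"
proof -
  have sub: "{set_coord c k (-1), set_coord c k 1} \<subseteq> cube_surface" "{set_coord c' k' (-1), set_coord c' k' 1} \<subseteq> cube_surface"
    using set_coord_corner c corners_subset by auto
  have eq: "{set_coord c k (-1), set_coord c k 1} = {set_coord c' k' (-1), set_coord c' k' 1}"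
    using e unfolding cube_edge_def inj_on_image_eq_iff[OF inj_on_radial sub] .
  show k: "k = k'"
  proof (rule ccontr)
    assume ne: "k \<noteq> k'"
    then have "x $ k = c' $ k" if "x \<in> {set_coord c k (-1), set_coord c k 1}" for x
      using that unfolding eq by auto
    from this[of "set_coord c k (-1)"] this[of "set_coord c k 1"] show False by simp
  qed
  have "c $ j = c' $ j" if "j \<noteq> k" for j
  proof -
    have "set_coord c k 1 \<in> {set_coord c' k' (-1), set_coord c' k' 1}" using eq by blast
    then obtain t where "set_coord c k 1 = set_coord c' k' t" by blast
    then have "set_coord c k 1 $ j = set_coord c' k' t $ j" by (rule arg_cong)
    then show ?thesis using that k by simp
  qed
  then show "set_coord c k = set_coord c' k'" unfolding k by (auto simp: fun_eq_iff vec_eq_iff k)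
qed

text \<open>All names of an edge describe the same segment, so the union in \<open>cube_arc\<close>
  has a single member.\<close>

lemma cube_arc_edge:
  assumes c: "c \<in> cube_corners"
  shows "cube_arc (cube_edge k c) = radial ` cube_segment k c"
proof
  show "radial ` cube_segment k c \<subseteq> cube_arc (cube_edge k c)" using c unfolding cube_arc_def by blast
  show "cube_arc (cube_edge k c) \<subseteq> radial ` cube_segment k c"
  proof
    fix x assume "x \<in> cube_arc (cube_edge k c)"
    then obtain k' c' where h: "x \<in> radial ` cube_segment k' c'" "c' \<in> cube_corners" "cube_edge k c = cube_edge k' c'"
      unfolding cube_arc_def by blast
    have "cube_segment k' c' = cube_segment k c"
      unfolding cube_segment_def cube_edge_eq(2)[OF c h(2,3)] ..
    then show "x \<in> radial ` cube_segment k c" using h(1) by simp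
  qed
qed

lemma card_cube_V: "card cube_V = 8"
proof -
  let ?f = "\<lambda>(a, b, c). vector [a, b, c] :: real^3"
  have eq: "cube_corners = ?f ` ({-1, 1} \<times> {-1, 1} \<times> {-1, 1})"
  proof (intro equalityI subsetI)
    fix w assume "w \<in> cube_corners"
    then have "\<bar>w $ 1\<bar> = 1" "\<bar>w $ 2\<bar> = 1" "\<bar>w $ 3\<bar> = 1" by (auto simp: cube_corners_def)
    then have mem: "(w $ 1, w $ 2, w $ 3) \<in> {-1, 1} \<times> {-1, 1} \<times> {-1, 1}" by (auto simp: abs_if split: if_splits)
    have "w = ?f (w $ 1, w $ 2, w $ 3)" by (simp add: vec_eq_iff forall_3)
    then show "w \<in> ?f ` ({-1, 1} \<times> {-1, 1} \<times> {-1, 1})" using mem by (rule image_eqI)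
  qed (auto simp: cube_corners_def forall_3)
  have "inj_on ?f ({-1, 1} \<times> {-1, 1} \<times> {-1, 1})"
    by (auto simp: inj_on_def vec_eq_iff forall_3)
  then have "card cube_corners = card ({-1, 1::real} \<times> {-1, 1::real} \<times> {-1, 1::real})"
    unfolding eq by (rule card_image)
  also have "\<dots> = 8" by (simp add: card_cartesian_product)
  finally show ?thesis
    unfolding cube_V_def using card_image[OF inj_on_subset[OF inj_on_radial corners_subset]] by simp
qed

lemma cube_edge_E: "c \<in> cube_corners \<Longrightarrow> cube_edge k c \<in> cube_E"
  unfolding cube_E_def by blast

lemma cube_edge_subset_V: "c \<in> cube_corners \<Longrightarrow> cube_edge k c \<subseteq> cube_V"
  using set_coord_corner[of c] unfolding cube_edge_def cube_V_def by auto

lemma simple_graph_cube: "simple_graph cube_V cube_E"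
  unfolding simple_graph_def
proof (intro conjI ballI)
  show "finite cube_V" using card_cube_V card.infinite by fastforce
  fix e assume "e \<in> cube_E"
  then obtain k c where e: "e = cube_edge k c" "c \<in> cube_corners" unfolding cube_E_def by blast
  show "e \<subseteq> cube_V" using cube_edge_subset_V e by blast
  have "set_coord c k (-1) \<noteq> set_coord c k 1"
  proof
    assume "set_coord c k (-1) = set_coord c k 1"
    then have "set_coord c k (-1) $ k = set_coord c k 1 $ k" by simp
    then show False by simp
  qed
  moreover have sub: "{set_coord c k (-1), set_coord c k 1} \<subseteq> cube_surface"
    using set_coord_corner e(2) corners_subset by auto
  have "card e = card {set_coord c k (-1), set_coord c k 1}"
    unfolding e(1) cube_edge_def by (rule card_image[OF inj_on_subset[OF inj_on_radial sub]])
  ultimately show "card e = 2" by simp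
qed

lemma segment_corner:
  assumes c: "c \<in> cube_corners" and w: "w \<in> cube_segment k c" "w \<in> cube_corners"
  shows "w \<in> {set_coord c k (-1), set_coord c k 1}"
proof -
  obtain t where t: "w = set_coord c k t" using w(1) unfolding cube_segment_def by blast
  have "\<bar>w $ k\<bar> = 1" using w(2) by (simp add: cube_corners_def)
  then have "t = -1 \<or> t = 1" using t by (auto simp: abs_if split: if_splits)
  then show ?thesis using t by blast
qed

text \<open>A point of a segment that is no corner has exactly one coordinate of absolute value
  below 1. This gives the axis, and the remaining coordinates give the edge.\<close>

lemma segment_Int_segment:
  assumes c: "c \<in> cube_corners" "c' \<in> cube_corners" and ne: "cube_edge k c \<noteq> cube_edge k' c'"
    and w: "w \<in> cube_segment k c" "w \<in> cube_segment k' c'"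
  shows "w \<in> cube_corners"
proof (rule ccontr)
  assume nc: "w \<notin> cube_corners"
  obtain t where t: "w = set_coord c k t" using w(1) unfolding cube_segment_def by blast
  obtain t' where t': "w = set_coord c' k' t'" using w(2) unfolding cube_segment_def by blast
  have w1: "\<bar>w $ j\<bar> = 1" if "j \<noteq> k" for j using that t c(1) by (simp add: cube_corners_def)
  have w2: "\<bar>w $ j\<bar> = 1" if "j \<noteq> k'" for j using that t' c(2) by (simp add: cube_corners_def)
  have k: "k = k'"
  proof (rule ccontr)
    assume "k \<noteq> k'"
    then have "\<bar>w $ j\<bar> = 1" for j using w1[of j] w2[of j] by blast
    then show False using nc by (simp add: cube_corners_def)
  qed
  have "c $ j = c' $ j" if "j \<noteq> k" for j
  proof -
    have "w $ j = c $ j" using that unfolding t by simp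
    moreover have "w $ j = c' $ j" using that k unfolding t' by simp
    ultimately show ?thesis by simp
  qed
  then have "set_coord c k = set_coord c' k'" using k by (auto simp: fun_eq_iff vec_eq_iff)
  then show False using ne unfolding cube_edge_def by simp
qed

lemma arc_cube_edge:
  assumes c: "c \<in> cube_corners"
  shows "arc_joining (top_of_set S2) (radial (set_coord c k (-1))) (radial (set_coord c k 1)) (cube_arc (cube_edge k c))"
proof -
  \<comment> \<open>The affine map takes the parameter interval from 0 to 1 to the one from -1 to
    1.\<close>
  define p where "p t = radial (set_coord c k (2 * t - 1))" for t
  have im: "(\<lambda>t. 2 * t - 1) ` {0..1} = {-1..1::real}"
  proof
    show "{-1..1} \<subseteq> (\<lambda>t. 2 * t - 1) ` {0..1::real}"
    proof
      fix x :: real assume "x \<in> {-1..1}"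
      then show "x \<in> (\<lambda>t. 2 * t - 1) ` {0..1}" by (intro image_eqI[of _ _ "(x + 1) / 2"]) (auto simp: field_simps)
    qed
  qed auto
  have sc: "(\<lambda>t. set_coord c k (2 * t - 1)) ` {0..1} = cube_segment k c"
    unfolding cube_segment_def im[symmetric] image_image ..
  then have pim: "p ` {0..1} = radial ` cube_segment k c"
    unfolding p_def by (metis image_image)
  have c1: "continuous_on {0..1} (\<lambda>t. set_coord c k (2 * t - 1))"
    unfolding set_coord_def
  proof (rule continuous_on_vec_lambda)
    show "continuous_on {0..1} (\<lambda>t. if j = k then 2 * t - 1 else c $ j)" for j
      by (cases "j = k") (auto intro!: continuous_intros)
  qed
  have c2: "continuous_on (cube_segment k c) radial"
    using segment_subset[OF c] zero_notin_surface by (intro continuous_on_radial) blast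
  have "continuous_on {0..1} p"
    unfolding p_def by (rule continuous_on_compose2[OF c2 c1]) (simp only: sc order_refl)
  moreover have "p ` {0..1} \<subseteq> S2" unfolding pim radial_surface[symmetric] by (intro image_mono segment_subset[OF c])
  ultimately have "pathin (top_of_set S2) p"
    unfolding pathin_def by (auto simp: continuous_map_in_subtopology)
  moreover have "inj_on p {0..1}"
  proof (rule inj_onI)
    fix x y :: real assume xy: "x \<in> {0..1}" "y \<in> {0..1}" "p x = p y"
    have "set_coord c k (2 * x - 1) \<in> cube_segment k c" "set_coord c k (2 * y - 1) \<in> cube_segment k c"
      using sc xy by blast+
    then have "set_coord c k (2 * x - 1) = set_coord c k (2 * y - 1)"
      using xy(3) inj_onD[OF inj_on_radial] segment_subset[OF c] unfolding p_def by blast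
    then have "set_coord c k (2 * x - 1) $ k = set_coord c k (2 * y - 1) $ k" by simp
    then show "x = y" by simp
  qed
  ultimately show ?thesis
    unfolding arc_joining_def cube_arc_edge[OF c] using pim by (intro exI[of _ p]) (simp add: p_def)
qed

lemma embedding_cube: "embedding (top_of_set S2) cube_V cube_E cube_arc"
  unfolding embedding_def
proof (intro conjI allI impI ballI)
  show "cube_V \<subseteq> topspace (top_of_set S2)"
    unfolding cube_V_def using corners_subset radial_surface by auto
next
  fix u v assume "{u, v} \<in> cube_E"
  then obtain k c where e: "{u, v} = cube_edge k c" "c \<in> cube_corners" unfolding cube_E_def by blast
  note a = arc_cube_edge[OF e(2), of k]
  have "u = radial (set_coord c k (-1)) \<and> v = radial (set_coord c k 1) \<or>
      v = radial (set_coord c k (-1)) \<and> u = radial (set_coord c k 1)"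
    using e(1) unfolding cube_edge_def image_insert image_empty doubleton_eq_iff by blast
  then show "arc_joining (top_of_set S2) u v (cube_arc {u, v})"
    unfolding e(1) using a arc_joining_reverse[OF a] by auto
next
  fix e assume "e \<in> cube_E"
  then obtain k c where e: "e = cube_edge k c" "c \<in> cube_corners" unfolding cube_E_def by blast
  have "cube_arc e \<inter> cube_V = radial ` (cube_segment k c \<inter> cube_corners)"
    unfolding e(1) cube_arc_edge[OF e(2)] cube_V_def
    using radial_Int[OF segment_subset[OF e(2)] corners_subset] .
  also have "cube_segment k c \<inter> cube_corners = {set_coord c k (-1), set_coord c k 1}"
    using segment_corner[OF e(2)] set_coord_corner[OF e(2)] unfolding cube_segment_def by auto
  finally show "cube_arc e \<inter> cube_V = e" unfolding e(1) cube_edge_def .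
next
  fix e e' assume ee: "e \<in> cube_E" "e' \<in> cube_E" "e \<noteq> e'"
  obtain k c where e: "e = cube_edge k c" "c \<in> cube_corners" using ee(1) unfolding cube_E_def by blast
  obtain k' c' where e': "e' = cube_edge k' c'" "c' \<in> cube_corners" using ee(2) unfolding cube_E_def by blast
  have "cube_arc e \<inter> cube_arc e' = radial ` (cube_segment k c \<inter> cube_segment k' c')"
    unfolding e(1) e'(1) cube_arc_edge[OF e(2)] cube_arc_edge[OF e'(2)]
    using radial_Int[OF segment_subset[OF e(2)] segment_subset[OF e'(2)]] .
  also have "cube_segment k c \<inter> cube_segment k' c' = {set_coord c k (-1), set_coord c k 1} \<inter> {set_coord c' k' (-1), set_coord c' k' 1}"
  proof
    show "cube_segment k c \<inter> cube_segment k' c' \<subseteq> {set_coord c k (-1), set_coord c k 1} \<inter> {set_coord c' k' (-1), set_coord c' k' 1}"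
      using segment_Int_segment[OF e(2) e'(2) ee(3)[unfolded e(1) e'(1)]] segment_corner[OF e(2)] segment_corner[OF e'(2)] by blast
    show "{set_coord c k (-1), set_coord c k 1} \<inter> {set_coord c' k' (-1), set_coord c' k' 1} \<subseteq> cube_segment k c \<inter> cube_segment k' c'"
      unfolding cube_segment_def by auto
  qed
  also have "radial ` \<dots> = radial ` {set_coord c k (-1), set_coord c k 1} \<inter> radial ` {set_coord c' k' (-1), set_coord c' k' 1}"
    using set_coord_corner e(2) e'(2) corners_subset by (intro radial_Int[symmetric]) auto
  finally show "cube_arc e \<inter> cube_arc e' = e \<inter> e'" unfolding e(1) e'(1) cube_edge_def .
qed

section \<open>Facets and faces of the cube\<close>

abbreviation (input) face_square :: "(real \<times> real) set" where
  "face_square \<equiv> {-1..1} \<times> {-1..1}"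

lemma face_point_surface: "\<bar>s\<bar> = 1 \<Longrightarrow> z \<in> face_square \<Longrightarrow> face_point i s z \<in> cube_surface"
  by (cases z) (auto simp: cube_surface_def face_point_def intro!: exI[of _ i])

lemma inj_face_point: "inj (face_point i s)"
  by (rule injI) (metis face_point_nth(2,3) prod_eq_iff)

lemma interior_face_square: "interior face_square = {-1<..<1} \<times> {-1<..<1}"
  by (simp add: interior_Times)

lemma open_facet_eq: "open_facet i s = face_point i s ` interior face_square"
proof (intro equalityI subsetI)
  fix w assume "w \<in> open_facet i s"
  then have w: "w $ i = s" "\<bar>w $ (i + 1)\<bar> < 1" "\<bar>w $ (i + 2)\<bar> < 1"
    using index_3(1-3)[of i] by (auto simp: open_facet_def)
  then have "w = face_point i s (w $ (i + 1), w $ (i + 2))" by (intro face_point_eqI) auto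
  moreover have "(w $ (i + 1), w $ (i + 2)) \<in> interior face_square"
    using w unfolding interior_face_square by auto
  ultimately show "w \<in> face_point i s ` interior face_square" by (metis image_eqI)
next
  fix w assume "w \<in> face_point i s ` interior face_square"
  then show "w \<in> open_facet i s"
    unfolding interior_face_square by (auto simp: open_facet_def face_point_def)
qed

text \<open>The sides come in the cyclic order of the corners (-1, -1), (1, -1), (1, 1), (-1, 1), as
  they are traversed in \<open>facet_cycle\<close>.\<close>

lemma frontier_face_square:
  "frontier face_square = (\<lambda>y. (y, -1)) ` {-1..1} \<union> (\<lambda>z. (1, z)) ` {-1..1} \<union> (\<lambda>y. (y, 1)) ` {-1..1} \<union> (\<lambda>z. (-1, z)) ` {-1..1}"
proof -
  have "frontier face_square = face_square - {-1<..<1} \<times> {-1<..<1}"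
    unfolding frontier_def interior_face_square by (simp add: closure_Times)
  also have "\<dots> = (\<lambda>y. (y, -1)) ` {-1..1} \<union> (\<lambda>z. (1, z)) ` {-1..1} \<union> (\<lambda>y. (y, 1)) ` {-1..1} \<union> (\<lambda>z. (-1, z)) ` {-1..1}"
    by (auto simp: image_iff)
  finally show ?thesis .
qed

lemma bounded_by_facet:
  assumes s: "\<bar>s\<bar> = 1"
  shows "bounded_by (top_of_set S2) (radial ` open_facet i s) (radial ` face_point i s ` frontier face_square)"
proof -
  have sub: "face_point i s ` face_square \<subseteq> cube_surface" using face_point_surface[OF s] by blast
  have "continuous_on face_square (face_point i s)"
    unfolding face_point_def
  proof (rule continuous_on_vec_lambda)
    show "continuous_on face_square (\<lambda>z. if j = i then s else if j = i + 1 then fst z else snd z)" for j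
      by (cases "j = i"; cases "j = i + 1") (auto intro!: continuous_intros)
  qed
  moreover have "continuous_on (face_point i s ` face_square) radial"
    using sub zero_notin_surface by (intro continuous_on_radial) blast
  ultimately have "continuous_on face_square (radial \<circ> face_point i s)" by (rule continuous_on_compose)
  moreover have "(radial \<circ> face_point i s) ` face_square \<subseteq> S2" using sub radial_surface by auto
  ultimately have "continuous_map (top_of_set face_square) (top_of_set S2) (radial \<circ> face_point i s)"
    unfolding image_subset_iff_funcset
    by (simp only: continuous_map_in_subtopology continuous_map_iff_continuous topspace_euclidean_subtopology simp_thms)
  moreover have "inj_on (radial \<circ> face_point i s) face_square"
    using inj_on_subset[OF inj_on_radial sub] inj_on_subset[OF inj_face_point] by (intro comp_inj_on) auto
  ultimately have "bounded_by (top_of_set S2) ((radial \<circ> face_point i s) ` interior face_square)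
      ((radial \<circ> face_point i s) ` frontier face_square)"
    by (intro bounded_by_image) (auto simp: Hausdorff_space_subtopology convex_Times compact_Times interior_face_square)
  then show ?thesis unfolding open_facet_eq image_comp .
qed

lemma facet_cycle:
  assumes s: "\<bar>s\<bar> = 1"
  shows "\<exists>a b c d. distinct [a, b, c, d] \<and>
        {a, b} \<in> cube_E \<and> {b, c} \<in> cube_E \<and> {c, d} \<in> cube_E \<and> {d, a} \<in> cube_E \<and>
        bounded_by (top_of_set S2) (radial ` open_facet i s)
          (cube_arc {a, b} \<union> cube_arc {b, c} \<union> cube_arc {c, d} \<union> cube_arc {d, a})"
proof -
  let ?f = "face_point i s"
  let ?a = "radial (?f (-1, -1))" and ?b = "radial (?f (1, -1))" and ?c = "radial (?f (1, 1))" and ?d = "radial (?f (-1, 1))"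
  have corner: "?f (y, z) \<in> cube_corners" if "\<bar>y\<bar> = 1" "\<bar>z\<bar> = 1" for y z
    using that s by (auto simp: cube_corners_def face_point_def)
  \<comment> \<open>Either end of an edge may serve as its name, because the moving coordinate is
    overwritten.\<close>
  have e: "{?a, ?b} = cube_edge (i + 1) (?f (1, -1))" "{?b, ?c} = cube_edge (i + 2) (?f (1, 1))"
    "{?c, ?d} = cube_edge (i + 1) (?f (1, 1))" "{?d, ?a} = cube_edge (i + 2) (?f (-1, 1))"
    unfolding cube_edge_def set_coord_face_point by auto
  have arcs: "cube_arc {?a, ?b} = radial ` ?f ` (\<lambda>y. (y, -1)) ` {-1..1}" "cube_arc {?b, ?c} = radial ` ?f ` (\<lambda>z. (1, z)) ` {-1..1}"
    "cube_arc {?c, ?d} = radial ` ?f ` (\<lambda>y. (y, 1)) ` {-1..1}" "cube_arc {?d, ?a} = radial ` ?f ` (\<lambda>z. (-1, z)) ` {-1..1}"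
    unfolding e by (subst cube_arc_edge; simp add: corner cube_segment_def set_coord_face_point image_image)+
  have inj: "inj_on (\<lambda>z. radial (?f z)) face_square"
  proof (rule inj_onI)
    fix x y assume xy: "x \<in> face_square" "y \<in> face_square" "radial (?f x) = radial (?f y)"
    have "?f x = ?f y"
      using xy(3) by (rule inj_onD[OF inj_on_radial]) (intro face_point_surface[OF s] xy)+
    then show "x = y" by (rule injD[OF inj_face_point])
  qed
  have "distinct [?a, ?b, ?c, ?d]"
    using inj_onD[OF inj, of "(-1, -1)" "(1, -1)"] inj_onD[OF inj, of "(-1, -1)" "(1, 1)"] inj_onD[OF inj, of "(-1, -1)" "(-1, 1)"]
      inj_onD[OF inj, of "(1, -1)" "(1, 1)"] inj_onD[OF inj, of "(1, -1)" "(-1, 1)"] inj_onD[OF inj, of "(1, 1)" "(-1, 1)"] by auto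
  moreover have "{?a, ?b} \<in> cube_E" "{?b, ?c} \<in> cube_E" "{?c, ?d} \<in> cube_E" "{?d, ?a} \<in> cube_E"
    unfolding e by (auto intro!: cube_edge_E corner)
  moreover have "cube_arc {?a, ?b} \<union> cube_arc {?b, ?c} \<union> cube_arc {?c, ?d} \<union> cube_arc {?d, ?a} = radial ` ?f ` frontier face_square"
    unfolding arcs frontier_face_square image_Un ..
  ultimately show ?thesis using bounded_by_facet[OF s, of i] by metis
qed

lemma open_facet_subset: "\<bar>s\<bar> = 1 \<Longrightarrow> open_facet i s \<subseteq> cube_surface"
  unfolding open_facet_def cube_surface_def by (auto intro: less_imp_le) (metis less_imp_le order_refl)

lemma open_facets_disjoint:
  assumes "\<bar>s\<bar> = 1" "\<bar>s'\<bar> = 1" "(i, s) \<noteq> (i', s')"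
  shows "open_facet i s \<inter> open_facet i' s' = {}"
  using assms unfolding open_facet_def by fastforce

text \<open>Off the edges a surface point has exactly one coordinate of absolute value 1, and that
  coordinate with its sign names the facet.\<close>

lemma surface_minus_graph:
  "cube_surface - (cube_corners \<union> \<Union>{cube_segment k c | k c. c \<in> cube_corners}) = \<Union>{open_facet i s | i s. \<bar>s\<bar> = 1}"
  (is "?L = ?R")
proof (intro equalityI subsetI)
  fix w assume w: "w \<in> ?L"
  then obtain i where i: "\<bar>w $ i\<bar> = 1" and le: "\<And>j. \<bar>w $ j\<bar> \<le> 1" by (auto simp: cube_surface_def)
  have "\<bar>w $ j\<bar> < 1" if j: "j \<noteq> i" for j
  proof (rule ccontr)
    assume "\<not> \<bar>w $ j\<bar> < 1"
    then have wj: "\<bar>w $ j\<bar> = 1" using le[of j] by simp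
    obtain k where k: "k \<noteq> i" "k \<noteq> j" "\<And>l. l = i \<or> l = j \<or> l = k"
      using index_3(1-3)[of i] j index_3(4)[of _ i] by metis
    \<comment> \<open>With two coordinates of absolute value 1, \<open>w\<close> lies on the segment
      along the third axis \<open>k\<close>; replacing its value at \<open>k\<close> by 1 gives a
      corner that names this segment.\<close>
    have c: "set_coord w k 1 \<in> cube_corners"
      unfolding cube_corners_def using i wj k(3) by (auto) metis
    have "w = set_coord (set_coord w k 1) k (w $ k)" by (simp add: vec_eq_iff)
    then have "w \<in> cube_segment k (set_coord w k 1)"
      unfolding cube_segment_def using le[of k] by (auto simp: abs_le_iff)
    then show False using w c by blast
  qed
  then have "w \<in> open_facet i (w $ i)" by (simp add: open_facet_def)
  then show "w \<in> ?R" using i by blast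
next
  fix w assume "w \<in> ?R"
  then obtain i s where s: "\<bar>s\<bar> = 1" and w: "w \<in> open_facet i s" by blast
  have small: "\<bar>w $ j\<bar> < 1" if "j \<noteq> i" for j using w that by (simp add: open_facet_def)
  have "w \<notin> cube_corners" using small[OF index_3(1)[of i]] by (auto simp: cube_corners_def intro!: exI[of _ "i + 1"])
  moreover have "w \<notin> cube_segment k c" if "c \<in> cube_corners" for k c
  proof
    assume "w \<in> cube_segment k c"
    then have big: "\<bar>w $ j\<bar> = 1" if "j \<noteq> k" for j
      using that \<open>c \<in> cube_corners\<close> by (auto simp: cube_segment_def cube_corners_def)
    \<comment> \<open>On a segment only the axis coordinate may be small, yet in an open facet two
      coordinates are.\<close>
    have "i + 1 = k" "i + 2 = k" using big small index_3(1,2)[of i] by (metis less_irrefl)+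
    then show False using index_3(3)[of i] by simp
  qed
  ultimately show "w \<in> ?L" using open_facet_subset[OF s] w by blast
qed

lemma faces_cube: "faces (top_of_set S2) cube_V cube_E cube_arc = {radial ` open_facet i s | i s. \<bar>s\<bar> = 1}"
  unfolding faces_def
proof (rule connected_components_of_open_partition)
  let ?P = "{radial ` open_facet i s | i s. \<bar>s\<bar> = 1}"
  let ?G = "cube_corners \<union> \<Union>{cube_segment k c | k c. c \<in> cube_corners}"
  have K: "cube_V \<union> \<Union>(cube_arc ` cube_E) = radial ` ?G"
  proof -
    have "\<Union>(cube_arc ` cube_E) = radial ` \<Union>{cube_segment k c | k c. c \<in> cube_corners}"
    proof (intro equalityI subsetI)
      fix x assume "x \<in> \<Union>(cube_arc ` cube_E)"
      then obtain k c where c: "c \<in> cube_corners" "x \<in> cube_arc (cube_edge k c)" unfolding cube_E_def by blast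
      then have "x \<in> radial ` cube_segment k c" by (simp only: cube_arc_edge)
      then show "x \<in> radial ` \<Union>{cube_segment k c | k c. c \<in> cube_corners}" using c(1) by blast
    next
      fix x assume "x \<in> radial ` \<Union>{cube_segment k c | k c. c \<in> cube_corners}"
      then obtain k c where c: "c \<in> cube_corners" "x \<in> radial ` cube_segment k c" by blast
      then have "x \<in> cube_arc (cube_edge k c)" by (simp only: cube_arc_edge)
      then show "x \<in> \<Union>(cube_arc ` cube_E)" using cube_edge_E[OF c(1)] by blast
    qed
    then show ?thesis by (simp only: cube_V_def image_Un)
  qed
  have G: "?G \<subseteq> cube_surface" using corners_subset segment_subset by blast
  have "S2 - radial ` ?G = radial ` (cube_surface - ?G)"
    unfolding radial_surface[symmetric] using inj_on_image_set_diff[OF inj_on_radial, of cube_surface ?G] G by auto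
  also have "\<dots> = \<Union>?P" unfolding surface_minus_graph by blast
  finally have UP: "S2 - (cube_V \<union> \<Union>(cube_arc ` cube_E)) = \<Union>?P" unfolding K .
  then show "\<Union>?P = topspace (subtopology (top_of_set S2) (topspace (top_of_set S2) - (cube_V \<union> \<Union>(cube_arc ` cube_E))))"
    by auto
  fix C assume C: "C \<in> ?P"
  then obtain i s where s: "\<bar>s\<bar> = 1" "C = radial ` open_facet i s" by blast
  have sub: "C \<subseteq> S2 - (cube_V \<union> \<Union>(cube_arc ` cube_E))" using C UP by blast
  note b = bounded_by_facet[OF s(1), of i]
  have "openin (top_of_set S2) C"
    using bounded_by_surface(1)[OF closed_surface_sphere b] unfolding s(2) by simp
  moreover have "connectedin (top_of_set S2) C" "C \<noteq> {}"
    using bounded_by_basics(5,8)[OF b] unfolding s(2) by auto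
  ultimately show "C \<noteq> {} \<and> openin (subtopology (top_of_set S2) (topspace (top_of_set S2) - (cube_V \<union> \<Union>(cube_arc ` cube_E)))) C \<and>
      connectedin (subtopology (top_of_set S2) (topspace (top_of_set S2) - (cube_V \<union> \<Union>(cube_arc ` cube_E)))) C"
    using sub by (simp add: connectedin_subtopology openin_subtopology) blast
next
  show "pairwise disjnt {radial ` open_facet i s | i s. \<bar>s\<bar> = 1}"
  proof (rule pairwiseI)
    fix C D assume CD: "C \<in> {radial ` open_facet i s | i s. \<bar>s\<bar> = 1}" "D \<in> {radial ` open_facet i s | i s. \<bar>s\<bar> = 1}" "C \<noteq> D"
    then obtain i s i' s' where h: "C = radial ` open_facet i s" "\<bar>s\<bar> = 1" "D = radial ` open_facet i' s'" "\<bar>s'\<bar> = 1" by blast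
    then have "(i, s) \<noteq> (i', s')" using CD(3) by auto
    then show "disjnt C D"
      unfolding disjnt_def h(1,3) radial_Int[OF open_facet_subset[OF h(2)] open_facet_subset[OF h(4)]]
      using open_facets_disjoint[OF h(2,4)] by simp
  qed
qed

lemma quadrangular_cube: "quadrangular_embedding (top_of_set S2) cube_V cube_E cube_arc"
  unfolding quadrangular_embedding_def cellular_embedding_def
proof (intro conjI ballI)
  show "embedding (top_of_set S2) cube_V cube_E cube_arc" by (rule embedding_cube)
  fix F assume "F \<in> faces (top_of_set S2) cube_V cube_E cube_arc"
  then obtain i s where s: "\<bar>s\<bar> = 1" "F = radial ` open_facet i s" unfolding faces_cube by blast
  show "subtopology (top_of_set S2) F homeomorphic_space top_of_set (ball (0::complex) 1)"
    unfolding s(2) by (rule bounded_by_basics(9)[OF bounded_by_facet[OF s(1)]])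
  show "\<exists>a b c d. distinct [a, b, c, d] \<and>
        {a, b} \<in> cube_E \<and> {b, c} \<in> cube_E \<and> {c, d} \<in> cube_E \<and> {d, a} \<in> cube_E \<and>
        bounded_by (top_of_set S2) F (cube_arc {a, b} \<union> cube_arc {b, c} \<union> cube_arc {c, d} \<union> cube_arc {d, a})"
    unfolding s(2) by (rule facet_cycle[OF s(1)])
qed

text \<open>All points of a closed facet have the same coordinate \<open>s\<close> at
  \<open>i\<close>, so the edge cannot run in direction \<open>i\<close>.\<close>

lemma segment_in_facet:
  assumes s: "\<bar>s\<bar> = 1" and c: "c \<in> cube_corners"
    and sub: "cube_arc (cube_edge k c) \<subseteq> top_of_set S2 frontier_of (radial ` open_facet i s)"
  shows "k \<noteq> i" "c $ i = s"
proof -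
  have "cube_arc (cube_edge k c) \<subseteq> radial ` face_point i s ` frontier face_square"
    using sub bounded_by_surface(2)[OF closed_surface_sphere bounded_by_facet[OF s, of i]] by simp
  also have "\<dots> \<subseteq> radial ` face_point i s ` face_square"
    by (intro image_mono frontier_subset_closed closed_Times closed_atLeastAtMost)
  finally have r: "radial ` cube_segment k c \<subseteq> radial ` face_point i s ` face_square"
    unfolding cube_arc_edge[OF c] .
  have "face_point i s ` face_square \<subseteq> cube_surface" using face_point_surface[OF s] by blast
  then have "cube_segment k c \<subseteq> face_point i s ` face_square"
    using r inj_on_image_subset_iff[OF inj_on_radial segment_subset[OF c]] by blast
  then have val: "set_coord c k t $ i = s" if "t \<in> {-1..1}" for t
    using that face_point_nth(1)[of i s] unfolding cube_segment_def by fastforce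
  \<comment> \<open>For \<open>k = i\<close> the ends would have the values -1 and 1 there, both
    equal to \<open>s\<close>.\<close>
  from val[of "-1"] val[of 1] show "k \<noteq> i" by (cases "i = k") auto
  then show "c $ i = s" using val[of 1] by simp
qed

text \<open>Distinct facets with the same axis have no common edge. For different axes
  \<open>i\<close> and \<open>i'\<close>, a common edge runs along the third axis with the
  coordinates \<open>s\<close> and \<open>s'\<close> fixed, which leaves only one.\<close>

lemma face_simple_cube: "face_simple (top_of_set S2) cube_V cube_E cube_arc"
  unfolding face_simple_def
proof (intro ballI impI)
  fix F F' assume F: "F \<in> faces (top_of_set S2) cube_V cube_E cube_arc" "F' \<in> faces (top_of_set S2) cube_V cube_E cube_arc" "F \<noteq> F'"
  let ?S = "{e \<in> cube_E. cube_arc e \<subseteq> top_of_set S2 frontier_of F \<and> cube_arc e \<subseteq> top_of_set S2 frontier_of F'}"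
  obtain i s where s: "\<bar>s\<bar> = 1" "F = radial ` open_facet i s" using F(1) unfolding faces_cube by blast
  obtain i' s' where s': "\<bar>s'\<bar> = 1" "F' = radial ` open_facet i' s'" using F(2) unfolding faces_cube by blast
  have "e = e'" if e: "e \<in> ?S" and e': "e' \<in> ?S" for e e'
  proof -
    obtain k c where c: "e = cube_edge k c" "c \<in> cube_corners" using e unfolding cube_E_def by blast
    obtain k' c' where c': "e' = cube_edge k' c'" "c' \<in> cube_corners" using e' unfolding cube_E_def by blast
    have 1: "k \<noteq> i" "c $ i = s" "k \<noteq> i'" "c $ i' = s'" "k' \<noteq> i" "c' $ i = s" "k' \<noteq> i'" "c' $ i' = s'"
      using segment_in_facet[OF s(1) c(2)] segment_in_facet[OF s'(1) c(2)]
        segment_in_facet[OF s(1) c'(2)] segment_in_facet[OF s'(1) c'(2)] e e' unfolding c(1) c'(1) s(2) s'(2) by auto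
    have ii: "i \<noteq> i'" using 1 F(3) s(2) s'(2) by auto
    then have kk: "k = k'" using 1 index_3(4)[of k i] index_3(4)[of k' i] index_3(4)[of i' i] by metis
    have "c $ j = c' $ j" if "j \<noteq> k" for j
    proof -
      have "j = i \<or> j = i'" using that 1 ii index_3(4)[of k i] index_3(4)[of j i] index_3(4)[of i' i] by metis
      then show ?thesis using 1 by auto
    qed
    then have "set_coord c k = set_coord c' k'" using kk by (auto simp: fun_eq_iff vec_eq_iff)
    then show ?thesis unfolding c(1) c'(1) cube_edge_def by simp
  qed
  then show "card ?S \<le> 1"
    by (metis (no_types, lifting) One_nat_def card.infinite card_le_Suc0_iff_eq zero_le)
qed

lemma min_face_simple_quad_sphere: "min_face_simple_quad (top_of_set S2) = 8"
proof -
  let ?S = "{enat (card V) | V. \<exists>E \<gamma>. simple_graph V E \<and> quadrangular_embedding (top_of_set S2) V E \<gamma> \<and>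
      face_simple (top_of_set S2) V E \<gamma>}"
  have "enat (card cube_V) \<in> ?S"
    using simple_graph_cube quadrangular_cube face_simple_cube by blast
  then have "8 \<in> ?S" unfolding card_cube_V by (simp add: numeral_eq_enat)
  moreover have "8 \<le> n" if n: "n \<in> ?S" for n
  proof -
    obtain V E \<gamma> where h: "n = enat (card V)" "simple_graph V E" "quadrangular_embedding (top_of_set S2) V E \<gamma>"
      "face_simple (top_of_set S2) V E \<gamma>" using n by blast
    have "8 \<le> card V" by (rule face_simple_quadrangulation_sphere_card[OF _ h(2-4)]) simp
    then show ?thesis unfolding h(1) by (simp add: numeral_eq_enat)
  qed
  ultimately have "Inf ?S = 8" by (intro antisym Inf_lower Inf_greatest)
  then show ?thesis unfolding min_face_simple_quad_def .
qed

theorem theorem1p4: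
  fixes X :: "'a topology"
  shows "min_face_simple_quad (top_of_set (sphere (0::real^3) 1)) = 8 \<and>
         (\<forall>g\<ge>1. orientable_surface g X \<longrightarrow> min_face_simple_quad X = min_quad X)"
  using min_face_simple_quad_sphere min_face_simple_quad_eq by blast

end
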